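(* Let $t\ge3$ be an integer, let $Z\subset\mathbb{P}^2$ be a set of $\binom{t+1}{2}$ double points, and let $P$ be a simple point (a point of $\mathbb{P}^2$ not in the support of $Z$). Then the sequence $$\Delta H=(\underbrace{1,2,3,\ldots,t}_{t},\underbrace{t+1,\ldots,t+1}_{t},1)$$ is the first difference of the Hilbert function of $Z+P$ if and only if $Z$ is a set of double points whose support is a star configuration of $t+1$ lines and $P$ lies on one of those lines.
   Context: Let $k$ be an algebraically closed field of characteristic zero, $\mathbb{P}^2=\mathbb{P}^2_k$ and $R=k[x_0,x_1,x_2]$ with the standard grading. A set of $s$ double points is a scheme $Z=2P_1+\cdots+2P_s$, with $P_1,\ldots,P_s\in\mathbb{P}^2$ distinct, defined by $I_Z=I_{P_1}^2\cap\cdots\cap I_{P_s}^2$, where $I_{P_i}$ is the homogeneous ideal of $P_i$; its support is $\{P_1,\ldots,P_s\}$. $Z+P$ is the scheme defined by $I_Z\cap I_P$. For a scheme $W\subset\mathbb{P}^2$ with saturated ideal $I_W$, the Hilbert function is $H_W(i)=\dim_k(R/I_W)_i$ and its first difference is $\Delta H_W(i)=H_W(i)-H_W(i-1)$ with $H_W(-1)=0$. A finite sequence $(h_0,\ldots,h_\sigma)$ being the first difference of $H_W$ means $\Delta H_W(i)=h_i$ for $0\le i\le\sigma$ and $\Delta H_W(i)=0$ for $i>\sigma$. A star configuration of $t+1$ lines in $\mathbb{P}^2$ is the set of all $\binom{t+1}{2}$ pairwise intersection points $\ell_i\cap\ell_j$ ($1\le i<j\le t+1$) of $t+1$ distinct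 lines $\ell_1,\ldots,\ell_{t+1}$ in $\mathbb{P}^2$ no three of which meet at a point. *)

theory Defs
  imports
    "HOL-Analysis.Cartesian_Space"
    "HOL-Library.Numeral_Type"
    "HOL-Library.Poly_Mapping"
    "HOL-Computational_Algebra.Polynomial"
begin

section \<open>Dimension of a quotient space\<close>

context vector_space
begin

text \<open>
  A finite set \<open>B\<close> of representatives of a basis of \<open>V / W\<close>: the classes of the elements of
  \<open>B\<close> are linearly independent (hence pairwise distinct) and span the quotient.
\<close>

definition quotient_basis :: "'b set \<Rightarrow> 'b set \<Rightarrow> 'b set \<Rightarrow> bool" where
  "quotient_basis V W B \<longleftrightarrow>
     finite B \<and> B \<subseteq> V \<and>
     (\<forall>c. (\<Sum>b\<in>B. scale (c b) b) \<in> W \<longrightarrow> (\<forall>b\<in>B. c b = 0)) \<and>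
     (\<forall>v\<in>V. \<exists>c. v - (\<Sum>b\<in>B. scale (c b) b) \<in> W)"

definition quotient_dim :: "'b set \<Rightarrow> 'b set \<Rightarrow> nat" where
  "quotient_dim V W =
     (if \<exists>B. local.quotient_basis V W B then card (SOME B. local.quotient_basis V W B) else 0)"

lemma card_quotient_basis:
  assumes V: "subspace V" and W: "subspace W" "W \<subseteq> V"
    and A: "finite A" "V \<subseteq> span A" and B: "local.quotient_basis V W B"
  shows "card B + dim W = dim V"
proof -
  obtain C where C: "C \<subseteq> W" "independent C" "W \<subseteq> span C" "card C = dim W"
    using basis_exists by blast
  have "C \<subseteq> span A" using C W A by blast
  then have fC: "finite C" using independent_span_bound[OF A(1) C(2)] by blast
  have fB: "finite B" "B \<subseteq> V"
    and ind: "\<And>c b. (\<Sum>b\<in>B. scale (c b) b) \<in> W \<Longrightarrow> b \<in> B \<Longrightarrow> c b = 0"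
    and spn: "\<And>v. v \<in> V \<Longrightarrow> \<exists>c. v - (\<Sum>b\<in>B. scale (c b) b) \<in> W"
    using B unfolding local.quotient_basis_def by blast+
  have disj: "B \<inter> C = {}"
  proof (rule ccontr)
    assume "B \<inter> C \<noteq> {}"
    then obtain b where b: "b \<in> B" "b \<in> C" by blast
    have "(\<Sum>x\<in>B. scale (if x = b then 1 else 0) x) = (\<Sum>x\<in>B. if x = b then x else 0)"
      by (rule sum.cong) auto
    also have "\<dots> = b" using fB b by simp
    finally have "(\<Sum>x\<in>B. scale (if x = b then 1 else 0) x) \<in> W" using b C by auto
    from ind[OF this b(1)] show False by simp
  qed
  have indU: "independent (B \<union> C)"
  proof (rule independent_if_scalars_zero)
    show "finite (B \<union> C)" using fB fC by simp
    fix f x assume s: "(\<Sum>x\<in>B \<union> C. scale (f x) x) = 0" and x: "x \<in> B \<union> C"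
    have s2: "(\<Sum>x\<in>B. scale (f x) x) + (\<Sum>x\<in>C. scale (f x) x) = 0"
      using s disj fB fC by (simp add: sum.union_disjoint)
    have "(\<Sum>x\<in>C. scale (f x) x) \<in> W"
      using C by (intro subspace_sum[OF W(1)] subspace_scale[OF W(1)]) auto
    then have "(\<Sum>x\<in>B. scale (f x) x) \<in> W"
      using s2 subspace_neg[OF W(1)] by (metis eq_neg_iff_add_eq_0)
    then have zB: "\<And>b. b \<in> B \<Longrightarrow> f b = 0" using ind by blast
    then have "(\<Sum>x\<in>C. scale (f x) x) = 0" using s2 by simp
    then have "\<And>b. b \<in> C \<Longrightarrow> f b = 0" using C(2) fC independentD by blast
    with zB x show "f x = 0" by blast
  qed
  have "V \<subseteq> span (B \<union> C)"
  proof
    fix v assume "v \<in> V"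
    then obtain c where "v - (\<Sum>b\<in>B. scale (c b) b) \<in> W" using spn by blast
    then have "v - (\<Sum>b\<in>B. scale (c b) b) \<in> span (B \<union> C)"
      using C(3) span_mono[of C "B \<union> C"] by blast
    moreover have "(\<Sum>b\<in>B. scale (c b) b) \<in> span (B \<union> C)"
      by (intro span_sum span_scale span_base) auto
    ultimately show "v \<in> span (B \<union> C)"
      using span_add by fastforce
  qed
  then have "card (B \<union> C) = dim V"
    using dim_unique[of "B \<union> C" V "card (B \<union> C)"] fB C W indU by simp
  then show ?thesis using C disj fB fC by (simp add: card_Un_disjoint)
qed

lemma quotient_basis_exists:
  assumes W: "subspace W" "W \<subseteq> V" and A: "finite A" "V \<subseteq> span A"
  shows "\<exists>B. local.quotient_basis V W B"
proof -
  obtain C where C: "C \<subseteq> W" "independent C" "W \<subseteq> span C" "card C = dim W"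
    using basis_exists by blast
  have "C \<subseteq> V" using C W by blast
  then obtain B where B: "C \<subseteq> B" "B \<subseteq> V" "independent B" "V \<subseteq> span B"
    using maximal_independent_subset_extend[OF _ C(2)] by metis
  have "B \<subseteq> span A" using B A by blast
  then have fB: "finite B" using independent_span_bound[OF A(1) B(3)] by blast
  then have fC: "finite C" using B finite_subset by blast
  have split: "(\<Sum>b\<in>B. g b) = (\<Sum>b\<in>B - C. g b) + (\<Sum>b\<in>C. g b)" for g :: "'b \<Rightarrow> 'b"
    using sum.subset_diff[OF B(1) fB] .
  have "local.quotient_basis V W (B - C)"
    unfolding local.quotient_basis_def
  proof (intro conjI allI impI ballI)
    show "finite (B - C)" using fB by simp
    show "B - C \<subseteq> V" using B by blast
  next
    fix c b assume s: "(\<Sum>b\<in>B - C. scale (c b) b) \<in> W" and b: "b \<in> B - C"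
    have "(\<Sum>b\<in>B - C. scale (c b) b) \<in> span C" using s C by blast
    then obtain u where u: "(\<Sum>b\<in>B - C. scale (c b) b) = (\<Sum>b\<in>C. scale (u b) b)"
      using span_finite[OF fC] by auto
    have "(\<Sum>x\<in>B. scale (if x \<in> C then - u x else c x) x) = 0"
      unfolding split using u by (simp add: sum_negf)
    then have "(if b \<in> C then - u b else c b) = 0"
      using independentD[OF B(3) fB subset_refl, of "\<lambda>x. if x \<in> C then - u x else c x"] b by blast
    then show "c b = 0" using b by simp
  next
    fix v assume "v \<in> V"
    then obtain u where "v = (\<Sum>b\<in>B. scale (u b) b)" using B(4) span_finite[OF fB] by blast
    then have "v - (\<Sum>b\<in>B - C. scale (u b) b) = (\<Sum>b\<in>C. scale (u b) b)" by (simp add: split)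
    also have "\<dots> \<in> W" using C
      by (intro subspace_sum[OF W(1)] subspace_scale[OF W(1)]) auto
    finally show "\<exists>c. v - (\<Sum>b\<in>B - C. scale (c b) b) \<in> W" by blast
  qed
  then show ?thesis by blast
qed

lemma quotient_dim_eq:
  assumes "subspace V" "subspace W" "W \<subseteq> V" "finite A" "V \<subseteq> span A"
  shows "local.quotient_dim V W = dim V - dim W"
  using local.card_quotient_basis[OF assms] local.quotient_basis_exists[OF assms(2-5)]
  unfolding local.quotient_dim_def by (metis diff_add_inverse2 someI_ex)

end

section \<open>The polynomial ring in three variables\<close>

text \<open>
  A monomial is an exponent vector indexed by the three-element type \<open>3 = {0, 1, 2}\<close>, and a
  polynomial maps monomials to coefficients with finite support; the ring structure is the
  convolution product on \<open>poly_mapping\<close>.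
\<close>

type_synonym mon3 = "3 \<Rightarrow>\<^sub>0 nat"
type_synonym 'k mpoly3 = "mon3 \<Rightarrow>\<^sub>0 'k"

definition mon_degree :: "mon3 \<Rightarrow> nat" where
  "mon_degree m = (\<Sum>i\<in>UNIV. Poly_Mapping.lookup m i)"

definition poly_scale :: "'k::field \<Rightarrow> 'k mpoly3 \<Rightarrow> 'k mpoly3" where
  "poly_scale c f = Poly_Mapping.map ((*) c) f"

definition eval_at :: "'k::field mpoly3 \<Rightarrow> 'k ^ 3 \<Rightarrow> 'k" where
  "eval_at f v = (\<Sum>m\<in>Poly_Mapping.keys f. Poly_Mapping.lookup f m * (\<Prod>i\<in>UNIV. (v $ i) ^ Poly_Mapping.lookup m i))"

text \<open>The graded piece of degree \<open>d\<close>; it contains \<open>0\<close>.\<close>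

definition forms :: "nat \<Rightarrow> 'k::field mpoly3 set" where
  "forms d = {f. \<forall>m\<in>Poly_Mapping.keys f. mon_degree m = d}"

lemma poly_scale_conv_mult: "poly_scale c f = Poly_Mapping.single 0 c * f"
  by (simp add: poly_scale_def mult_map_scale_conv_mult)

lemma lookup_poly_scale: "Poly_Mapping.lookup (poly_scale c f) m = c * Poly_Mapping.lookup f m"
  by (simp add: poly_scale_def Poly_Mapping.map.rep_eq when_def)

interpretation mpoly3: vector_space "poly_scale :: 'k::field \<Rightarrow> _"
  by unfold_locales
    (rule poly_mapping_eqI, simp add: lookup_poly_scale lookup_add algebra_simps)+

text \<open>Ideals are the submodules of the ring over itself.\<close>

interpretation ring_ideal: module "(*) :: 'a::comm_ring_1 \<Rightarrow> 'a \<Rightarrow> 'a"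
  by unfold_locales (simp_all add: algebra_simps)

definition ideal_product :: "'a::comm_ring_1 set \<Rightarrow> 'a set \<Rightarrow> 'a set" where
  "ideal_product I J = ring_ideal.span {f * g | f g. f \<in> I \<and> g \<in> J}"

text \<open>For homogeneous \<open>I\<close>, \<open>(R/I)\<^sub>d\<close> is \<open>R\<^sub>d / (I \<inter> R\<^sub>d)\<close>.\<close>

definition hilbert_function :: "'k::field mpoly3 set \<Rightarrow> nat \<Rightarrow> nat" where
  "hilbert_function I d = mpoly3.quotient_dim (forms d) (I \<inter> forms d)"

text \<open>Conventionally \<open>h (-1) = 0\<close>.\<close>

definition first_difference :: "(nat \<Rightarrow> nat) \<Rightarrow> nat \<Rightarrow> int" where
  "first_difference h i = int (h i) - (if i = 0 then 0 else int (h (i - 1)))"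

text \<open>A finite sequence is compared with a first difference after extension by zero.\<close>

definition is_first_difference :: "int list \<Rightarrow> (nat \<Rightarrow> nat) \<Rightarrow> bool" where
  "is_first_difference hs h \<longleftrightarrow>
     (\<forall>i. first_difference h i = (if i < length hs then hs ! i else 0))"

section \<open>The projective plane, double points and star configurations\<close>

text \<open>A point is a one-dimensional linear subspace of \<open>k\<^sup>3\<close>.\<close>

definition proj_plane :: "('k::field ^ 3) set set" where
  "proj_plane = {p. vec.subspace p \<and> vec.dim p = 1}"

text \<open>
  Meaningful for homogeneous \<open>f\<close>, for which it is equivalent to vanishing at one nonzero
  representative of \<open>p\<close>.
\<close>

definition vanishes_at :: "'k::field mpoly3 \<Rightarrow> ('k ^ 3) set \<Rightarrow> bool" where
  "vanishes_at f p \<longleftrightarrow> (\<forall>v\<in>p. v \<noteq> 0 \<longrightarrow> eval_at f v = 0)"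

definition point_ideal :: "('k::field ^ 3) set \<Rightarrow> 'k mpoly3 set" where
  "point_ideal p = ring_ideal.span {f. (\<exists>d. f \<in> forms d) \<and> vanishes_at f p}"

text \<open>The ideal of the set of double points supported on \<open>S\<close>.\<close>

definition double_points_ideal :: "('k::field ^ 3) set set \<Rightarrow> 'k mpoly3 set" where
  "double_points_ideal S = (\<Inter>p\<in>S. ideal_product (point_ideal p) (point_ideal p))"

definition is_line :: "('k::field ^ 3) set set \<Rightarrow> bool" where
  "is_line l \<longleftrightarrow> (\<exists>f\<in>forms 1. f \<noteq> 0 \<and> l = {p \<in> proj_plane. vanishes_at f p})"

definition no_three_concurrent :: "'p set set \<Rightarrow> bool" where
  "no_three_concurrent L \<longleftrightarrow>
     (\<forall>l\<in>L. \<forall>m\<in>L. \<forall>n\<in>L. l \<noteq> m \<and> l \<noteq> n \<and> m \<noteq> n \<longrightarrow> l \<inter> m \<inter> n = {})"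

definition is_star_configuration ::
  "nat \<Rightarrow> ('k::field ^ 3) set set set \<Rightarrow> ('k ^ 3) set set \<Rightarrow> bool" where
  "is_star_configuration r L S \<longleftrightarrow>
     finite L \<and> card L = r \<and> (\<forall>l\<in>L. is_line l) \<and> no_three_concurrent L \<and>
     S = {p. \<exists>l\<in>L. \<exists>m\<in>L. l \<noteq> m \<and> p \<in> l \<inter> m}"

section \<open>The Hilbert function as a difference of dimensions\<close>

lemma subspace_forms: "mpoly3.subspace (forms d)"
proof (rule mpoly3.subspaceI)
  fix f g :: "'k::field mpoly3" and c :: 'k
  assume f: "f \<in> forms d"
  show "f + g \<in> forms d" if "g \<in> forms d"
    using f that keys_add[of f g] unfolding forms_def by blast
  have "Poly_Mapping.keys (poly_scale c f) \<subseteq> Poly_Mapping.keys f"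
    by (rule subsetI) (simp add: in_keys_iff lookup_poly_scale)
  then show "poly_scale c f \<in> forms d"
    using f unfolding forms_def by blast
qed (simp add: forms_def)

lemma subspace_ideal:
  fixes I :: "'k::field mpoly3 set"
  assumes "ring_ideal.subspace I"
  shows "mpoly3.subspace I"
proof (rule mpoly3.subspaceI)
  show "0 \<in> I" by (rule ring_ideal.subspace_0[OF assms])
  show "f + g \<in> I" if "f \<in> I" "g \<in> I" for f g
    by (rule ring_ideal.subspace_add[OF assms that])
  show "poly_scale c f \<in> I" if "f \<in> I" for c f
    unfolding poly_scale_conv_mult by (rule ring_ideal.subspace_scale[OF assms that])
qed

lemma finite_mon_degree: "finite {m. mon_degree m = d}"
proof (rule finite_imageD)
  have "Poly_Mapping.lookup m i \<le> mon_degree m" for m i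
    unfolding mon_degree_def by (rule member_le_sum) simp_all
  then have "Poly_Mapping.lookup ` {m. mon_degree m = d} \<subseteq> {f. range f \<subseteq> {..d}}"
    by fastforce
  also have "\<dots> = UNIV \<rightarrow>\<^sub>E {..d}"
    by (auto simp: PiE_def Pi_def)
  finally show "finite (Poly_Mapping.lookup ` {m. mon_degree m = d})"
    by (rule finite_subset) (rule finite_PiE, simp_all)
  show "inj_on Poly_Mapping.lookup {m. mon_degree m = d}"
    by (rule inj_onI) (simp add: poly_mapping.lookup_inject)
qed

lemma forms_subset_span:
  "(forms d :: 'k::field mpoly3 set) \<subseteq> mpoly3.span ((\<lambda>m. Poly_Mapping.single m 1) ` {m. mon_degree m = d})"
proof
  fix f :: "'k mpoly3" assume f: "f \<in> forms d"
  have "f = (\<Sum>m\<in>Poly_Mapping.keys f.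
      poly_scale (Poly_Mapping.lookup f m) (Poly_Mapping.single m 1))"
  proof (rule poly_mapping_eqI)
    fix n
    have "(\<Sum>m\<in>Poly_Mapping.keys f. Poly_Mapping.lookup f m * (1 when m = n)) =
        (\<Sum>m\<in>Poly_Mapping.keys f. if m = n then Poly_Mapping.lookup f m else 0)"
      by (rule sum.cong) (auto simp: when_def)
    also have "\<dots> = Poly_Mapping.lookup f n"
      by (simp add: in_keys_iff)
    finally show "Poly_Mapping.lookup f n = Poly_Mapping.lookup (\<Sum>m\<in>Poly_Mapping.keys f.
        poly_scale (Poly_Mapping.lookup f m) (Poly_Mapping.single m 1)) n"
      by (simp add: lookup_sum lookup_poly_scale lookup_single)
  qed
  moreover have "\<dots> \<in> mpoly3.span ((\<lambda>m. Poly_Mapping.single m 1) ` {m. mon_degree m = d})"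
    using f by (intro mpoly3.span_sum mpoly3.span_scale mpoly3.span_base) (auto simp: forms_def)
  ultimately show "f \<in> mpoly3.span ((\<lambda>m. Poly_Mapping.single m 1) ` {m. mon_degree m = d})"
    by simp
qed

lemma hilbert_function_eq:
  fixes I :: "'k::field mpoly3 set"
  assumes "ring_ideal.subspace I"
  shows "hilbert_function I d = mpoly3.dim (forms d :: 'k mpoly3 set) - mpoly3.dim (I \<inter> forms d)"
  unfolding hilbert_function_def
proof (rule mpoly3.quotient_dim_eq[OF subspace_forms _ _ _ forms_subset_span])
  show "mpoly3.subspace (I \<inter> forms d)"
    by (rule mpoly3.subspace_inter[OF subspace_ideal[OF assms] subspace_forms])
  show "finite ((\<lambda>m. Poly_Mapping.single m (1::'k)) ` {m. mon_degree m = d})"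
    by (rule finite_imageI[OF finite_mon_degree])
qed simp

lemma subspace_double_points_ideal: "ring_ideal.subspace (double_points_ideal S)"
  unfolding double_points_ideal_def ideal_product_def ring_ideal.subspace_def
  by (simp add: ring_ideal.span_zero ring_ideal.span_add ring_ideal.span_scale)

lemma subspace_point_ideal: "ring_ideal.subspace (point_ideal p)"
  unfolding point_ideal_def by (rule ring_ideal.subspace_span)

end

theory Submission
  imports Defs
begin

text \<open>
  Let \<open>N\<close> be the number of double points, and call singular a form that vanishes doubly at all of
  them. Forms are treated in coordinates: points are vectors, linear forms are coefficient
  vectors, and membership of a form of positive degree in the ideal is a system of \<open>3 N + 1\<close> linear conditions,
  the partial derivatives at the double points and the value at \<open>P\<close>
  (\<open>hilbert_function_double_points\<close>). The prescribed sequence says that the ideal has in each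
  degree below \<open>2 t\<close> the dimension of the multiples of one form of degree \<open>t + 1\<close>, and that the
  Hilbert function is \<open>3 N + 1\<close> from degree \<open>2 t\<close> on.

  Let the support be a star configuration, \<open>F\<close> the product of its lines and \<open>F\<close> zero at \<open>P\<close>. A form
  of degree less than \<open>2 t\<close> in the ideal vanishes on every line, which contains \<open>t\<close> double points,
  so it is a multiple of \<open>F\<close>. From degree \<open>2 t\<close> on the \<open>3 N + 1\<close> conditions are independent, because
  the square of the product of the lines that avoid a given double point separates this point
  from the others (\<open>star_hilbert_function\<close>).

  Conversely the Hilbert function provides a form \<open>F\<close> of degree \<open>t + 1\<close> whose multiples are the
  ideal in degrees below \<open>2 t\<close>. It turns out that lines split off from \<open>F\<close> one at a time.

  \<^item> No curve of degree less than \<open>t\<close> passes through the \<open>N\<close> points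
    (\<open>no_curve_of_smaller_degree\<close>). Let \<open>C\<close> be one of minimal degree. Then \<open>F\<close> divides \<open>C\<^sup>2\<close>
    and the products of \<open>C\<close> with the derivatives of \<open>F\<close>. Comparing with the derivatives of \<open>C\<^sup>2\<close>
    yields forms of smaller degree through the points; as these are zero, \<open>C\<^sup>2\<close> is a constant
    multiple of \<open>F\<close>, which a dimension count excludes. Hence \<open>F\<close> has no double line,
    and the values at the points can be interpolated by forms of degree \<open>t - 1\<close>.

  \<^item> The conditions of the double points and of \<open>P\<close> are dependent in degree \<open>2 t - 1\<close>, because \<open>F\<close>
    satisfies them. Tested on products of two interpolating forms and a linear form, a
    relation between them turns out to involve only points of one line through \<open>P\<close>, and at least
    \<open>t\<close> of the double points are on this line (\<open>line_with_many_points\<close>). The line divides \<open>F\<close>.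

  \<^item> The quotient of \<open>F\<close> by the line and the double points off the line satisfy the assumptions
    for \<open>t - 1\<close>, with a double point on the line in the role of \<open>P\<close>. By induction \<open>F\<close> is a product of
    \<open>t + 1\<close> lines (\<open>product_of_lines\<close>).

  The double points are then intersection points of the \<open>t + 1\<close> lines, and as there are as many of
  them as pairs of lines, they form a star configuration (\<open>star_if_product_of_lines\<close>).
\<close>

(* The interpretation of a ring as a module over itself makes a * (b * x) = (a * b) * x a rewrite
   rule, which undoes the usual normal form of products. *)
declare ring_ideal.scale_scale [simp del]

section \<open>Linear functionals on a finite-dimensional subspace\<close>

context vector_space
begin

lemma dim_kernel_functional:
  assumes V: "subspace V" "V \<subseteq> span A" "finite A"
    and add: "\<And>f g. \<phi> (f + g) = \<phi> f + \<phi> g" and scl: "\<And>c f. \<phi> (scale c f) = c * \<phi> f"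
    and e: "e \<in> V" "\<phi> e \<noteq> 0"
  shows "dim V = dim {f\<in>V. \<phi> f = 0} + 1"
proof -
  let ?K = "{f\<in>V. \<phi> f = 0}"
  have z: "\<phi> 0 = 0" using scl[of 0 0] by simp
  have K: "subspace ?K"
    using V(1) by (auto intro!: subspaceI simp: subspace_add subspace_scale subspace_0 add scl z)
  obtain B where B: "B \<subseteq> ?K" "independent B" "?K \<subseteq> span B" "card B = dim ?K"
    using basis_exists by blast
  have spB: "span B \<subseteq> ?K" using B(1) K span_minimal by blast
  have "B \<subseteq> span A" using B V by blast
  then have fB: "finite B" using independent_span_bound[OF V(3) B(2)] by blast
  have ne: "e \<notin> span B" using spB e by blast
  have ind: "independent (insert e B)" using ne B(2) independent_insert by auto
  have "V \<subseteq> span (insert e B)"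
  proof
    fix f assume f: "f \<in> V"
    let ?c = "\<phi> f / \<phi> e"
    have "f - scale ?c e \<in> V" by (intro subspace_diff subspace_scale V(1) f e(1))
    moreover have "\<phi> (f - scale ?c e) = 0"
      using add[of "f - scale ?c e" "scale ?c e"] scl[of ?c e] e by simp
    ultimately have "f - scale ?c e \<in> span B" using B(3) by auto
    then show "f \<in> span (insert e B)" unfolding span_breakdown_eq by (rule exI)
  qed
  then have "card (insert e B) = dim V"
    using B(1) e(1) by (intro dim_unique[OF _ _ ind refl, symmetric]) auto
  moreover have "e \<notin> B" using ne span_base by blast
  ultimately show ?thesis using B fB by simp
qed

lemma dim_le_joint_kernel:
  assumes V: "subspace V" "V \<subseteq> span A" "finite A" and I: "finite I"
    and add: "\<And>i f g. \<phi> i (f + g) = \<phi> i f + \<phi> i g"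
    and scl: "\<And>i c f. \<phi> i (scale c f) = c * \<phi> i f"
  shows "dim V \<le> dim {f\<in>V. \<forall>i\<in>I. \<phi> i f = 0} + card I"
  using I
proof (induction I rule: finite_induct)
  case (insert j I)
  let ?K = "{f\<in>V. \<forall>i\<in>I. \<phi> i f = 0}"
  have z: "\<phi> i 0 = 0" for i using scl[of i 0 0] by simp
  have K: "subspace ?K"
    using V(1) by (auto intro!: subspaceI simp: subspace_add subspace_scale subspace_0 add scl z)
  have eq: "{f\<in>V. \<forall>i\<in>insert j I. \<phi> i f = 0} = {f\<in>?K. \<phi> j f = 0}" by auto
  have "dim ?K \<le> dim {f\<in>?K. \<phi> j f = 0} + 1"
  proof (cases "\<exists>e\<in>?K. \<phi> j e \<noteq> 0")
    case True
    then obtain e where "e \<in> ?K" "\<phi> j e \<noteq> 0" by blast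
    with V show ?thesis
      by (intro eq_imp_le dim_kernel_functional[OF K _ V(3)]) (auto simp: add scl)
  next
    case False
    then have "{f\<in>?K. \<phi> j f = 0} = ?K" by blast
    then show ?thesis by simp
  qed
  then show ?case using insert eq by simp
qed simp

text \<open>
  By induction on the number of functionals: if \<open>\<phi> j\<close> is nonzero at some \<open>e\<close> in the common kernel of
  the others, subtract the multiple of \<open>\<phi> j\<close> that has the value of \<open>\<psi>\<close> at \<open>e\<close>.
\<close>

lemma functional_in_span_of_functionals:
  assumes V: "subspace V" and I: "finite I"
    and add: "\<And>i f g. \<phi> i (f + g) = \<phi> i f + \<phi> i g"
    and scl: "\<And>i c f. \<phi> i (scale c f) = c * \<phi> i f"
    and "\<And>f g. \<psi> (f + g) = \<psi> f + \<psi> g" and "\<And>c f. \<psi> (scale c f) = c * \<psi> f"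
    and "\<And>f. f \<in> V \<Longrightarrow> \<forall>i\<in>I. \<phi> i f = 0 \<Longrightarrow> \<psi> f = 0"
  shows "\<exists>c. \<forall>f\<in>V. \<psi> f = (\<Sum>i\<in>I. c i * \<phi> i f)"
  using I assms(5-)
proof (induction I arbitrary: \<psi> rule: finite_induct)
  case (insert j I)
  show ?case
  proof (cases "\<exists>e\<in>V. (\<forall>i\<in>I. \<phi> i e = 0) \<and> \<phi> j e \<noteq> 0")
    case True
    then obtain e where e: "e \<in> V" "\<forall>i\<in>I. \<phi> i e = 0" "\<phi> j e \<noteq> 0" by blast
    let ?s = "\<psi> e / \<phi> j e"
    have "\<exists>c. \<forall>f\<in>V. \<psi> f - ?s * \<phi> j f = (\<Sum>i\<in>I. c i * \<phi> i f)"
    proof (rule insert.IH)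
      fix f assume f: "f \<in> V" "\<forall>i\<in>I. \<phi> i f = 0"
      let ?h = "f + scale (- (\<phi> j f / \<phi> j e)) e"
      have "?h \<in> V" by (intro subspace_add subspace_scale V f(1) e(1))
      moreover have "\<forall>i\<in>insert j I. \<phi> i ?h = 0" using f e by (simp add: add scl del: scale_minus_left)
      ultimately have "\<psi> ?h = 0" by (rule insert.prems(3))
      then show "\<psi> f - ?s * \<phi> j f = 0"
        unfolding insert.prems(1,2) by (simp add: field_simps)
    next
      show "\<psi> (f + g) - ?s * \<phi> j (f + g) = \<psi> f - ?s * \<phi> j f + (\<psi> g - ?s * \<phi> j g)" for f g
        unfolding insert.prems(1) add by (simp add: ring_distribs)
      show "\<psi> (scale c f) - ?s * \<phi> j (scale c f) = c * (\<psi> f - ?s * \<phi> j f)" for c f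
        unfolding insert.prems(2) scl by (simp add: ring_distribs)
    qed
    then obtain c where "\<forall>f\<in>V. \<psi> f - ?s * \<phi> j f = (\<Sum>i\<in>I. c i * \<phi> i f)" by blast
    moreover have "(\<Sum>i\<in>I. (if i = j then ?s else c i) * \<phi> i f) = (\<Sum>i\<in>I. c i * \<phi> i f)" for f
      using insert.hyps by (intro sum.cong) auto
    ultimately have "\<forall>f\<in>V. \<psi> f = (\<Sum>i\<in>insert j I. (if i = j then ?s else c i) * \<phi> i f)"
      using insert.hyps by (simp add: diff_eq_eq add.commute)
    then show ?thesis by (rule exI[of _ "\<lambda>i. if i = j then ?s else c i"])
  next
    case False
    have "\<exists>c. \<forall>f\<in>V. \<psi> f = (\<Sum>i\<in>I. c i * \<phi> i f)"
    proof (rule insert.IH[OF insert.prems(1,2)])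
      fix f assume "f \<in> V" "\<forall>i\<in>I. \<phi> i f = 0"
      with False show "\<psi> f = 0" by (intro insert.prems(3)) auto
    qed
    then obtain c where "\<forall>f\<in>V. \<psi> f = (\<Sum>i\<in>I. c i * \<phi> i f)" by blast
    moreover have "(\<Sum>i\<in>I. (if i = j then 0 else c i) * \<phi> i f) = (\<Sum>i\<in>I. c i * \<phi> i f)" for f
      using insert.hyps by (intro sum.cong) auto
    ultimately have "\<forall>f\<in>V. \<psi> f = (\<Sum>i\<in>insert j I. (if i = j then 0 else c i) * \<phi> i f)"
      using insert.hyps by simp
    then show ?thesis by (rule exI[of _ "\<lambda>i. if i = j then 0 else c i"])
  qed
qed auto

text \<open>
  A functional that vanishes on the common kernel of others is a combination of them; so each of
  a sequence of independent functionals lowers the dimension of the common kernel.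
\<close>

lemma dim_joint_kernel_independent:
  assumes V: "subspace V" "V \<subseteq> span A" "finite A" and I: "finite I"
    and add: "\<And>i f g. \<phi> i (f + g) = \<phi> i f + \<phi> i g"
    and scl: "\<And>i c f. \<phi> i (scale c f) = c * \<phi> i f"
    and ind: "\<And>c. \<forall>f\<in>V. (\<Sum>i\<in>I. c i * \<phi> i f) = 0 \<Longrightarrow> \<forall>i\<in>I. c i = 0"
  shows "dim V = dim {f\<in>V. \<forall>i\<in>I. \<phi> i f = 0} + card I"
  using I ind
proof (induction I rule: finite_induct)
  case (insert j I)
  let ?K = "{f\<in>V. \<forall>i\<in>I. \<phi> i f = 0}"
  have z: "\<phi> i 0 = 0" for i using scl[of i 0 0] by simp
  have K: "subspace ?K"
    using V(1) by (auto intro!: subspaceI simp: subspace_add subspace_scale subspace_0 add scl z)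
  have eq: "{f\<in>V. \<forall>i\<in>insert j I. \<phi> i f = 0} = {f\<in>?K. \<phi> j f = 0}" by auto
  have IH: "dim V = dim ?K + card I"
  proof (rule insert.IH)
    fix c assume c0: "\<forall>f\<in>V. (\<Sum>i\<in>I. c i * \<phi> i f) = 0"
    have "\<forall>f\<in>V. (\<Sum>i\<in>insert j I. (if i = j then 0 else c i) * \<phi> i f) = 0"
    proof (intro ballI)
      fix f assume f: "f \<in> V"
      have "(\<Sum>i\<in>I. (if i = j then 0 else c i) * \<phi> i f) = (\<Sum>i\<in>I. c i * \<phi> i f)"
        using insert.hyps by (intro sum.cong) auto
      then show "(\<Sum>i\<in>insert j I. (if i = j then 0 else c i) * \<phi> i f) = 0"
        using insert.hyps c0 f by simp
    qed
    from insert.prems[OF this] show "\<forall>i\<in>I. c i = 0" using insert.hyps by (metis insertCI)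
  qed
  have "\<exists>e\<in>?K. \<phi> j e \<noteq> 0"
  proof (rule ccontr)
    assume "\<not> ?thesis"
    then have "\<exists>c. \<forall>f\<in>V. \<phi> j f = (\<Sum>i\<in>I. c i * \<phi> i f)"
      using functional_in_span_of_functionals[OF V(1) insert.hyps(1), of \<phi> "\<phi> j"] add scl by blast
    then obtain c where c: "\<forall>f\<in>V. \<phi> j f = (\<Sum>i\<in>I. c i * \<phi> i f)" by blast
    have "\<forall>f\<in>V. (\<Sum>i\<in>insert j I. (if i = j then - 1 else c i) * \<phi> i f) = 0"
    proof
      fix f assume "f \<in> V"
      have "(\<Sum>i\<in>I. (if i = j then - 1 else c i) * \<phi> i f) = (\<Sum>i\<in>I. c i * \<phi> i f)"
        using insert.hyps by (intro sum.cong) auto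
      then show "(\<Sum>i\<in>insert j I. (if i = j then - 1 else c i) * \<phi> i f) = 0"
        using insert.hyps c \<open>f \<in> V\<close> by simp
    qed
    from insert.prems[OF this] show False by simp
  qed
  then obtain e where "e \<in> ?K" "\<phi> j e \<noteq> 0" by blast
  with V have "dim ?K = dim {f\<in>?K. \<phi> j f = 0} + 1"
    by (intro dim_kernel_functional[OF K _ V(3)]) (auto simp: add scl)
  then show ?case using IH insert.hyps eq by simp
qed simp

lemma subspace_eq_if_dim_le:
  assumes W: "subspace W" "W \<subseteq> V" and V: "V \<subseteq> span A" "finite A" and le: "dim V \<le> dim W"
  shows "W = V"
proof -
  obtain C where C: "C \<subseteq> W" "independent C" "W \<subseteq> span C" "card C = dim W"
    using basis_exists by blast
  have "C \<subseteq> V" using C W by blast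
  then obtain B where B: "C \<subseteq> B" "B \<subseteq> V" "independent B" "V \<subseteq> span B"
    using maximal_independent_subset_extend[OF _ C(2)] by metis
  have "B \<subseteq> span A" using B V by blast
  then have fB: "finite B" using independent_span_bound[OF V(2) B(3)] by blast
  have "card B = dim V" using dim_unique[OF B(2,4,3)] by simp
  then have "C = B" using card_seteq[OF fB B(1)] C(4) le by simp
  then show ?thesis using B(4) W C(1) span_minimal[OF C(1) W(1)] by blast
qed

lemma dim_injective_image:
  assumes V: "subspace V" "V \<subseteq> span A" "finite A"
    and add: "\<And>f g. h (f + g) = h f + h g" and scl: "\<And>c f. h (scale c f) = scale c (h f)"
    and inj: "\<And>f. h f = 0 \<Longrightarrow> f = 0"
  shows "dim (h ` V) = dim V"
proof -
  obtain B where B: "B \<subseteq> V" "independent B" "V \<subseteq> span B" "card B = dim V"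
    using basis_exists by blast
  have "B \<subseteq> span A" using B V by blast
  then have fB: "finite B" using independent_span_bound[OF V(3) B(2)] by blast
  have z: "h 0 = 0" using scl[of 0 0] by simp
  have hdiff: "h (f - g) = h f - h g" for f g using add[of "f - g" g] by (simp add: algebra_simps)
  have injh: "inj h" by (rule injI) (metis hdiff inj right_minus_eq)
  have hsum: "h (\<Sum>b\<in>B. scale (c b) b) = (\<Sum>b\<in>B. scale (c b) (h b))" for c
    using fB by (induction B rule: finite_induct) (simp_all add: z add scl)
  have re: "(\<Sum>y\<in>h ` B. scale (c y) y) = (\<Sum>b\<in>B. scale (c (h b)) (h b))" for c
    using injh by (subst sum.reindex) (auto simp: inj_on_def)
  have "independent (h ` B)"
  proof (rule independent_if_scalars_zero)
    show "finite (h ` B)" using fB by simp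
    fix c y assume "(\<Sum>y\<in>h ` B. scale (c y) y) = 0" and y: "y \<in> h ` B"
    then have "(\<Sum>b\<in>B. scale (c (h b)) b) = 0" using re hsum[of "\<lambda>b. c (h b)"] inj by metis
    then show "c y = 0" using independentD[OF B(2) fB subset_refl, of "\<lambda>b. c (h b)"] y by blast
  qed
  moreover have "h ` V \<subseteq> span (h ` B)"
  proof
    fix y assume "y \<in> h ` V"
    then obtain f where f: "f \<in> V" "y = h f" by blast
    then obtain c where c: "f = (\<Sum>b\<in>B. scale (c b) b)" using B(3) span_finite[OF fB] by blast
    show "y \<in> span (h ` B)"
      unfolding f(2) c hsum by (intro span_sum span_scale span_base imageI)
  qed
  ultimately have "dim (h ` V) = card (h ` B)"
    using B(1) by (intro dim_unique) auto
  then show ?thesis using B(4) injh card_image[of h B] by (simp add: inj_on_def)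
qed

end

section \<open>Forms, evaluation and directional derivatives\<close>

definition mconst :: "'k::field \<Rightarrow> 'k mpoly3" where
  "mconst c = Poly_Mapping.single 0 c"

definition mvar :: "3 \<Rightarrow> 'k::field mpoly3" where
  "mvar i = Poly_Mapping.single (Poly_Mapping.single i 1) 1"

lemma mconst_simps [simp]:
  "mconst 0 = 0" "mconst 1 = 1" "mconst (a + b) = mconst a + mconst b"
  "mconst (- a) = - mconst a" "mconst (a - b) = mconst a - mconst b"
  "mconst (a * b) = mconst a * mconst b" "mconst (of_nat n) = of_nat n"
  "mconst a = 0 \<longleftrightarrow> a = 0"
  by (simp_all add: mconst_def single_add single_uminus single_diff mult_single)
    (metis lookup_single_eq lookup_zero single_zero)

lemma poly_scale_mconst: "poly_scale c f = mconst c * f"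
  by (simp add: poly_scale_conv_mult mconst_def)

lemma mon_degree_simps [simp]:
  "mon_degree 0 = 0" "mon_degree (m + n) = mon_degree m + mon_degree n"
  "mon_degree (Poly_Mapping.single i e) = e"
  by (simp_all add: mon_degree_def lookup_add sum.distrib lookup_single when_def)

lemma mon_degree_0_iff [simp]: "mon_degree m = 0 \<longleftrightarrow> m = 0"
  by (auto simp: mon_degree_def intro!: poly_mapping_eqI)

lemma single_mon_split:
  assumes "Poly_Mapping.lookup m i > 0"
  shows "\<exists>n. m = Poly_Mapping.single i 1 + n \<and>
           (Poly_Mapping.single m a :: 'k::field mpoly3) = mvar i * Poly_Mapping.single n a"
proof -
  have "m = Poly_Mapping.single i 1 + (m - Poly_Mapping.single i 1)"
    using assms by (intro poly_mapping_eqI) (auto simp: lookup_add lookup_minus lookup_single when_def)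
  then show ?thesis
    by (metis mult_single mvar_def mult_1)
qed

lemma poly_mapping_sum_single: "f = (\<Sum>m\<in>Poly_Mapping.keys f. Poly_Mapping.single m (Poly_Mapping.lookup f m))"
proof (rule poly_mapping_eqI)
  fix n
  have "(\<Sum>m\<in>Poly_Mapping.keys f. Poly_Mapping.lookup f m when m = n) =
      (\<Sum>m\<in>Poly_Mapping.keys f. if m = n then Poly_Mapping.lookup f m else 0)"
    by (rule sum.cong) (auto simp: when_def)
  also have "\<dots> = Poly_Mapping.lookup f n" by (simp add: in_keys_iff)
  finally show "Poly_Mapping.lookup f n = Poly_Mapping.lookup
      (\<Sum>m\<in>Poly_Mapping.keys f. Poly_Mapping.single m (Poly_Mapping.lookup f m)) n"
    by (simp add: lookup_sum lookup_single)
qed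

lemma forms_0 [simp]: "0 \<in> forms d"
  and forms_add: "f \<in> forms d \<Longrightarrow> g \<in> forms d \<Longrightarrow> f + g \<in> forms d"
  and forms_diff: "f \<in> forms d \<Longrightarrow> g \<in> forms d \<Longrightarrow> f - g \<in> forms d"
  and forms_sum: "(\<And>i. i \<in> I \<Longrightarrow> h i \<in> forms d) \<Longrightarrow> sum h I \<in> forms d"
  by (rule mpoly3.subspace_0[OF subspace_forms] mpoly3.subspace_add[OF subspace_forms]
      mpoly3.subspace_diff[OF subspace_forms]
      mpoly3.subspace_sum[OF subspace_forms]; assumption?)+

lemma forms_mult: "f \<in> forms d \<Longrightarrow> g \<in> forms e \<Longrightarrow> f * g \<in> forms (d + e)"
  using keys_mult[of f g] by (fastforce simp: forms_def)

lemma mconst_forms [simp]: "mconst c \<in> forms 0"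
  and mvar_forms [simp]: "mvar i \<in> forms 1" "mvar i \<in> forms (Suc 0)"
  by (auto simp: forms_def mconst_def mvar_def)

lemma one_forms [simp]: "1 \<in> forms 0"
  using mconst_forms[of 1] by (simp del: mconst_forms)

lemma forms_mconst_mult [intro]: "f \<in> forms d \<Longrightarrow> mconst c * f \<in> forms d"
  using forms_mult[OF mconst_forms, of f d c] by simp

lemma forms_power: "f \<in> forms d \<Longrightarrow> f ^ n \<in> forms (n * d)"
  by (induction n) (auto dest: forms_mult)

lemma forms_induct [consumes 1, case_names zero add const mult]:
  assumes f: "f \<in> forms d"
    and zero: "\<And>d. Q d 0"
    and add: "\<And>d f g. f \<in> forms d \<Longrightarrow> g \<in> forms d \<Longrightarrow> Q d f \<Longrightarrow> Q d g \<Longrightarrow> Q d (f + g)"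
    and const: "\<And>c. Q 0 (mconst c)"
    and mult: "\<And>d i f. f \<in> forms d \<Longrightarrow> Q d f \<Longrightarrow> Q (Suc d) (mvar i * f)"
  shows "Q d f"
proof -
  have mono: "Q (mon_degree m) (Poly_Mapping.single m a)" for m a
  proof (induction "mon_degree m" arbitrary: m)
    case 0
    then show ?case using const[of a] by (simp add: mconst_def)
  next
    case (Suc d)
    then obtain i where "Poly_Mapping.lookup m i > 0"
      by (metis gr0I mon_degree_0_iff nat.distinct(1) poly_mapping_eqI lookup_zero)
    then obtain n where n: "m = Poly_Mapping.single i 1 + n"
        "Poly_Mapping.single m a = mvar i * Poly_Mapping.single n a"
      using single_mon_split by blast
    then have "d = mon_degree n" using Suc(2) by simp
    then have "Q (Suc d) (mvar i * Poly_Mapping.single n a)"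
      using Suc(1) by (intro mult) (auto simp: forms_def)
    then show ?case using n Suc(2) by simp
  qed
  have "(\<Sum>m\<in>M. Poly_Mapping.single m (Poly_Mapping.lookup f m)) \<in> forms d \<and>
      Q d (\<Sum>m\<in>M. Poly_Mapping.single m (Poly_Mapping.lookup f m))"
    if "finite M" "M \<subseteq> Poly_Mapping.keys f" for M
    using that
  proof (induction M rule: finite_induct)
    case (insert m M)
    then have "mon_degree m = d" using f by (auto simp: forms_def)
    then have "Q d (Poly_Mapping.single m (Poly_Mapping.lookup f m))"
        "Poly_Mapping.single m (Poly_Mapping.lookup f m) \<in> forms d"
      using mono[of m] by (auto simp: forms_def)
    moreover have "(\<Sum>m\<in>M. Poly_Mapping.single m (Poly_Mapping.lookup f m)) \<in> forms d"
        "Q d (\<Sum>m\<in>M. Poly_Mapping.single m (Poly_Mapping.lookup f m))"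
      using insert by auto
    ultimately show ?case using insert.hyps by (simp add: add forms_add)
  qed (simp add: zero)
  from this[of "Poly_Mapping.keys f"] show ?thesis by (simp flip: poly_mapping_sum_single)
qed

lemma mpoly3_induct [case_names add const mult]:
  assumes add: "\<And>f g. Q f \<Longrightarrow> Q g \<Longrightarrow> Q (f + g)"
    and const: "\<And>c. Q (mconst c)"
    and mult: "\<And>i f. Q f \<Longrightarrow> Q (mvar i * f)"
  shows "Q f"
proof -
  have "Q 0" using const[of 0] by simp
  have mono: "Q (Poly_Mapping.single m a)" for m a
    by (rule forms_induct[where d = "mon_degree m"])
      (auto simp: forms_def \<open>Q 0\<close> intro: assms)
  have "Q (\<Sum>m\<in>M. Poly_Mapping.single m (Poly_Mapping.lookup f m))" if "finite M" for M
    using that by (induction M rule: finite_induct) (auto intro: add mono \<open>Q 0\<close>)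
  from this[of "Poly_Mapping.keys f"] show ?thesis by (simp flip: poly_mapping_sum_single)
qed

text \<open>
  Substitution into a commutative ring. Evaluation, restriction to a line and the Taylor shift
  are instances, so they are ring homomorphisms for one and the same reason.
\<close>

definition insertion :: "('k::field \<Rightarrow> 'a::comm_ring_1) \<Rightarrow> (3 \<Rightarrow> 'a) \<Rightarrow> 'k mpoly3 \<Rightarrow> 'a" where
  "insertion \<kappa> g f =
     (\<Sum>m\<in>Poly_Mapping.keys f. \<kappa> (Poly_Mapping.lookup f m) * (\<Prod>i\<in>UNIV. g i ^ Poly_Mapping.lookup m i))"

context
  fixes \<kappa> :: "'k::field \<Rightarrow> 'a::comm_ring_1" and g :: "3 \<Rightarrow> 'a"
  assumes kadd: "\<And>a b. \<kappa> (a + b) = \<kappa> a + \<kappa> b" and kmult: "\<And>a b. \<kappa> (a * b) = \<kappa> a * \<kappa> b"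
    and k1: "\<kappa> 1 = 1"
begin

lemma k0: "\<kappa> 0 = 0"
  using kadd[of 0 0] by simp

lemma insertion_superset:
  assumes "finite M" "Poly_Mapping.keys f \<subseteq> M"
  shows "insertion \<kappa> g f = (\<Sum>m\<in>M. \<kappa> (Poly_Mapping.lookup f m) * (\<Prod>i\<in>UNIV. g i ^ Poly_Mapping.lookup m i))"
  unfolding insertion_def
  by (rule sum.mono_neutral_left[OF assms]) (auto simp: in_keys_iff k0)

lemma insertion_add: "insertion \<kappa> g (f + h) = insertion \<kappa> g f + insertion \<kappa> g h"
proof -
  let ?M = "Poly_Mapping.keys f \<union> Poly_Mapping.keys h"
  have "finite ?M" by simp
  note s = insertion_superset[OF this]
  show ?thesis
    using keys_add[of f h] by (simp add: s lookup_add kadd distrib_right sum.distrib)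
qed

lemma insertion_single:
  "insertion \<kappa> g (Poly_Mapping.single m a) = \<kappa> a * (\<Prod>i\<in>UNIV. g i ^ Poly_Mapping.lookup m i)"
  by (simp add: insertion_def k0)

lemma insertion_sum: "insertion \<kappa> g (sum h I) = (\<Sum>i\<in>I. insertion \<kappa> g (h i))"
  by (induction I rule: infinite_finite_induct) (simp_all add: insertion_add, simp_all add: insertion_def)

lemma insertion_mult: "insertion \<kappa> g (f * h) = insertion \<kappa> g f * insertion \<kappa> g h"
proof -
  let ?s = "\<lambda>f m. Poly_Mapping.single m (Poly_Mapping.lookup f m)"
  have *: "insertion \<kappa> g (Poly_Mapping.single m a * Poly_Mapping.single n b) =
      insertion \<kappa> g (Poly_Mapping.single m a) * insertion \<kappa> g (Poly_Mapping.single n b)" for m n a b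
    unfolding mult_single insertion_single lookup_add power_add prod.distrib kmult by (simp only: ac_simps)
  have "f * h = (\<Sum>m\<in>Poly_Mapping.keys f. \<Sum>n\<in>Poly_Mapping.keys h. ?s f m * ?s h n)"
    by (simp flip: sum_product poly_mapping_sum_single)
  then have "insertion \<kappa> g (f * h) =
      (\<Sum>m\<in>Poly_Mapping.keys f. \<Sum>n\<in>Poly_Mapping.keys h. insertion \<kappa> g (?s f m) * insertion \<kappa> g (?s h n))"
    by (simp add: insertion_sum *)
  also have "\<dots> = insertion \<kappa> g (\<Sum>m\<in>Poly_Mapping.keys f. ?s f m) * insertion \<kappa> g (\<Sum>n\<in>Poly_Mapping.keys h. ?s h n)"
    by (simp only: insertion_sum sum_product)
  finally show ?thesis by (simp flip: poly_mapping_sum_single)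
qed

lemma insertion_mconst: "insertion \<kappa> g (mconst a) = \<kappa> a"
  by (simp add: mconst_def insertion_single)

lemma insertion_mvar: "insertion \<kappa> g (mvar i) = g i"
proof -
  have "(\<Prod>j\<in>UNIV. g j ^ Poly_Mapping.lookup (Poly_Mapping.single i 1) j) = (\<Prod>j\<in>UNIV. if j = i then g j else 1)"
    by (rule prod.cong) (auto simp: lookup_single)
  then show ?thesis by (simp add: mvar_def insertion_single k1)
qed

lemmas insertion_hom = insertion_add insertion_mult insertion_mconst insertion_mvar

end

lemma eval_at_insertion: "eval_at f v = insertion (\<lambda>c. c) (($) v) f"
  by (simp add: eval_at_def insertion_def)

lemma eval_hom [simp]:
  "eval_at (f + g) v = eval_at f v + eval_at g v" "eval_at (f * g) v = eval_at f v * eval_at g v"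
  "eval_at (mconst c) v = c" "eval_at (mvar i) v = v $ i"
  by (simp_all add: eval_at_insertion insertion_hom)

lemma eval_hom2 [simp]:
  "eval_at 0 v = 0" "eval_at 1 v = 1" "eval_at (- f) v = - eval_at f v"
  "eval_at (f - g) v = eval_at f v - eval_at g v" "eval_at (f ^ n) v = eval_at f v ^ n"
  "eval_at (sum h I) v = (\<Sum>i\<in>I. eval_at (h i) v)" "eval_at (prod h I) v = (\<Prod>i\<in>I. eval_at (h i) v)"
  "eval_at (of_nat n) v = of_nat n"
proof -
  show z: "eval_at 0 v = 0" and o: "eval_at 1 v = 1"
    using eval_hom(3)[of 0] eval_hom(3)[of 1] by simp_all
  show m: "eval_at (- f) v = - eval_at f v" for f
    using eval_hom(1)[of f "- f" v] z by (simp add: eq_neg_iff_add_eq_0 add.commute)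
  show "eval_at (f - g) v = eval_at f v - eval_at g v"
    using eval_hom(1)[of f "- g" v] m by simp
  show "eval_at (f ^ n) v = eval_at f v ^ n" by (induction n) (simp_all add: o)
  show "eval_at (sum h I) v = (\<Sum>i\<in>I. eval_at (h i) v)"
    by (induction I rule: infinite_finite_induct) (simp_all add: z)
  show "eval_at (prod h I) v = (\<Prod>i\<in>I. eval_at (h i) v)"
    by (induction I rule: infinite_finite_induct) (simp_all add: o)
  show "eval_at (of_nat n) v = of_nat n"
    using eval_hom(3)[of "of_nat n"] by (simp del: eval_hom)
qed

text \<open>The form \<open>f\<close> restricted to the affine line \<open>X \<mapsto> v + X c\<close>.\<close>

definition restrict_line :: "'k::field ^ 3 \<Rightarrow> 'k ^ 3 \<Rightarrow> 'k mpoly3 \<Rightarrow> 'k poly" where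
  "restrict_line v c = insertion (\<lambda>a. [:a:]) (\<lambda>i. [:v $ i, c $ i:])"

lemma restrict_line_hom [simp]:
  "restrict_line v c (f + g) = restrict_line v c f + restrict_line v c g"
  "restrict_line v c (f * g) = restrict_line v c f * restrict_line v c g"
  "restrict_line v c (mconst a) = [:a:]" "restrict_line v c (mvar i) = [:v $ i, c $ i:]"
  by (simp_all add: restrict_line_def insertion_hom one_pCons)

lemma restrict_line_0 [simp]: "restrict_line v c 0 = 0"
  using restrict_line_hom(3)[of v c 0] by simp

lemma poly_restrict_line: "poly (restrict_line v c f) s = eval_at f (v + s *s c)"
  by (induction f rule: mpoly3_induct) (simp_all add: algebra_simps)

lemma coeff_0_restrict_line: "coeff (restrict_line v c f) 0 = eval_at f v"
  using poly_restrict_line[of v c f 0] by (simp add: poly_0_coeff_0)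

lemma coeff_restrict_line_forms:
  assumes "f \<in> forms d"
  shows "coeff (restrict_line v c f) d = eval_at f c" and "degree (restrict_line v c f) \<le> d"
proof -
  have "coeff (restrict_line v c f) d = eval_at f c \<and> degree (restrict_line v c f) \<le> d"
    using assms
  proof (induction rule: forms_induct)
    case (add d f g)
    then show ?case by (simp add: degree_add_le)
  next
    case (mult d i f)
    then have "degree ([:v $ i, c $ i:] * restrict_line v c f) \<le> 1 + d"
      by (intro order.trans[OF degree_mult_le] add_mono) auto
    moreover have "coeff (restrict_line v c f) (Suc d) = 0"
      using mult by (intro coeff_eq_0) simp
    ultimately show ?case using mult by simp
  qed simp_all
  then show "coeff (restrict_line v c f) d = eval_at f c" "degree (restrict_line v c f) \<le> d" by auto
qed

text \<open>
  The derivative in direction \<open>c\<close> is the linear coefficient of the Taylor shift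
  \<open>f (x + \<epsilon> c)\<close>; Leibniz' rule is then the multiplication of linear coefficients.
\<close>

definition taylor_shift :: "'k::field ^ 3 \<Rightarrow> 'k mpoly3 \<Rightarrow> 'k mpoly3 poly" where
  "taylor_shift c = insertion (\<lambda>a. [:mconst a:]) (\<lambda>i. [:mvar i, mconst (c $ i):])"

lemma taylor_shift_hom:
  "taylor_shift c (f + g) = taylor_shift c f + taylor_shift c g"
  "taylor_shift c (f * g) = taylor_shift c f * taylor_shift c g"
  "taylor_shift c (mconst a) = [:mconst a:]" "taylor_shift c (mvar i) = [:mvar i, mconst (c $ i):]"
  by (simp_all add: taylor_shift_def insertion_hom one_pCons)

lemma coeff_0_taylor_shift: "coeff (taylor_shift c f) 0 = f"
  by (induction f rule: mpoly3_induct) (simp_all add: taylor_shift_hom coeff_mult)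

definition dderiv :: "'k::field ^ 3 \<Rightarrow> 'k mpoly3 \<Rightarrow> 'k mpoly3" where
  "dderiv c f = coeff (taylor_shift c f) 1"

lemma dderiv_simps [simp]:
  "dderiv c (f + g) = dderiv c f + dderiv c g"
  "dderiv c (f * g) = dderiv c f * g + f * dderiv c g"
  "dderiv c (mconst a) = 0" "dderiv c (mvar i) = mconst (c $ i)"
  by (simp_all add: dderiv_def taylor_shift_hom coeff_mult coeff_0_taylor_shift
      coeff_0_taylor_shift[unfolded One_nat_def] algebra_simps numeral_2_eq_2)

lemma dderiv_simps2 [simp]:
  "dderiv c 0 = 0" "dderiv c 1 = 0" "dderiv c (- f) = - dderiv c f"
  "dderiv c (f - g) = dderiv c f - dderiv c g"
  "dderiv c (sum h I) = (\<Sum>i\<in>I. dderiv c (h i))"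
proof -
  show z: "dderiv c 0 = 0" and "dderiv c 1 = 0"
    using dderiv_simps(3)[of c 0] dderiv_simps(3)[of c 1] by simp_all
  show m: "dderiv c (- f) = - dderiv c f" for f
    using dderiv_simps(1)[of c f "- f"] z by (simp add: eq_neg_iff_add_eq_0 add.commute)
  show "dderiv c (f - g) = dderiv c f - dderiv c g"
    using dderiv_simps(1)[of c f "- g"] m by simp
  show "dderiv c (sum h I) = (\<Sum>i\<in>I. dderiv c (h i))"
    by (induction I rule: infinite_finite_induct) (simp_all add: z)
qed

lemma dderiv_add_left: "dderiv (a + b) f = dderiv a f + dderiv b f"
  by (induction f rule: mpoly3_induct) (simp_all add: distrib_left distrib_right add_ac)

lemma dderiv_scale_left: "dderiv (s *s a) f = mconst s * dderiv a f"
  by (induction f rule: mpoly3_induct) (simp_all add: algebra_simps)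

lemma dderiv_0_left [simp]: "dderiv 0 f = 0"
  by (induction f rule: mpoly3_induct) simp_all

lemma dderiv_sum_left: "dderiv (sum h I) f = (\<Sum>i\<in>I. dderiv (h i) f)"
  by (induction I rule: infinite_finite_induct) (simp_all add: dderiv_add_left)

lemma forms_0_const:
  assumes "f \<in> forms 0"
  shows "\<exists>a. f = mconst a"
proof (rule exI, rule poly_mapping_eqI)
  fix m
  show "Poly_Mapping.lookup f m = Poly_Mapping.lookup (mconst (Poly_Mapping.lookup f 0)) m"
    using assms by (cases "m = 0") (auto simp: forms_def mconst_def in_keys_iff lookup_single)
qed

lemma dderiv_forms: "f \<in> forms d \<Longrightarrow> dderiv c f \<in> forms (d - 1)"
proof (induction rule: forms_induct)
  case (mult d i f)
  then have "mvar i * dderiv c f \<in> forms d"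
    using forms_mult[OF mvar_forms(1), of "dderiv c f" "d - 1" i]
  proof (cases d)
    case 0
    then have "\<exists>a. f = mconst a" using mult(1) forms_0_const by blast
    then show ?thesis by auto
  qed simp
  then show ?case using mult forms_add by auto
qed (simp_all add: forms_add)

lemma pderiv_restrict_line: "pderiv (restrict_line v c f) = restrict_line v c (dderiv c f)"
  by (induction f rule: mpoly3_induct) (simp_all add: pderiv_add pderiv_mult pderiv_pCons pderiv_smult)

lemma coeff_1_restrict_line: "coeff (restrict_line v c f) 1 = eval_at (dderiv c f) v"
  using coeff_0_restrict_line[of v c "dderiv c f"]
  by (simp flip: pderiv_restrict_line add: coeff_pderiv)

text \<open>
  In characteristic zero Euler's identity recovers a form of positive degree, and its value at a
  point, from the derivatives.
\<close>

lemma euler_eval: "f \<in> forms d \<Longrightarrow> eval_at (dderiv v f) v = of_nat d * eval_at f v"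
  by (induction rule: forms_induct) (simp_all add: algebra_simps)

lemma euler_forms: "f \<in> forms d \<Longrightarrow> (\<Sum>i\<in>UNIV. mvar i * dderiv (axis i 1) f) = of_nat d * f"
proof (induction rule: forms_induct)
  case (mult d j f)
  have "(\<Sum>i\<in>UNIV. mvar i * (mconst (axis i 1 $ j) * f)) = (\<Sum>i\<in>UNIV. if i = j then mvar i * f else 0)"
    by (rule sum.cong) (auto simp: axis_def)
  then have "(\<Sum>i\<in>UNIV. mvar i * dderiv (axis i 1) (mvar j * f)) =
      mvar j * f + mvar j * (\<Sum>i\<in>UNIV. mvar i * dderiv (axis i 1) f)"
    by (simp add: distrib_left sum.distrib sum_distrib_left mult.left_commute mult.assoc)
  also have "\<dots> = of_nat (Suc d) * (mvar j * f)" using mult by (simp add: algebra_simps)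
  finally show ?case .
qed (simp_all add: distrib_left sum.distrib)

lemma of_nat_mpoly3_eq_0_iff [simp]: "(of_nat n :: 'k::field_char_0 mpoly3) = 0 \<longleftrightarrow> n = 0"
  using mconst_simps(8)[of "of_nat n :: 'k"] by (simp del: mconst_simps(8))

lemma forms_eq_0_if_dderiv_0:
  fixes f :: "'k::field_char_0 mpoly3"
  assumes "f \<in> forms d" "d > 0" "\<And>c. dderiv c f = 0"
  shows "f = 0"
  using euler_forms[OF assms(1)] assms(2,3) by simp

text \<open>
  A form that vanishes at every point is zero: its derivatives vanish at every point as well,
  because they are coefficients of restrictions to lines, and Euler's identity recovers the form.
\<close>

lemma forms_eq_0_if_eval_0:
  fixes f :: "'k::field_char_0 mpoly3"
  assumes "f \<in> forms d" "\<And>v. eval_at f v = 0"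
  shows "f = 0"
  using assms
proof (induction d arbitrary: f)
  case 0
  then show ?case using forms_0_const[of f] by auto
next
  case (Suc d)
  have "dderiv c f = 0" for c
  proof (rule Suc.IH)
    show "dderiv c f \<in> forms d" using dderiv_forms[OF Suc.prems(1)] by simp
    fix v
    have "restrict_line v c f = 0"
      using Suc.prems(2) by (simp add: poly_eq_poly_eq_iff[symmetric] fun_eq_iff poly_restrict_line)
    then show "eval_at (dderiv c f) v = 0" using coeff_1_restrict_line[of v c f] by simp
  qed
  then show ?case using forms_eq_0_if_dderiv_0 Suc.prems(1) by blast
qed

lemma eval_scale: "f \<in> forms d \<Longrightarrow> eval_at f (s *s v) = s ^ d * eval_at f v"
  by (induction rule: forms_induct) (simp_all add: algebra_simps)

section \<open>Linear forms, points and lines in coordinates\<close>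

definition dot :: "'k::field ^ 3 \<Rightarrow> 'k ^ 3 \<Rightarrow> 'k" where
  "dot a v = (\<Sum>i\<in>UNIV. a $ i * v $ i)"

text \<open>
  Two vectors span the same point of the plane, and two linear forms define the same line,
  exactly if their cross product is zero.
\<close>

definition cross :: "'k::field ^ 3 \<Rightarrow> 'k ^ 3 \<Rightarrow> 'k ^ 3" where
  "cross a b = vector [a$2 * b$3 - a$3 * b$2, a$3 * b$1 - a$1 * b$3, a$1 * b$2 - a$2 * b$1]"

definition lin :: "'k::field ^ 3 \<Rightarrow> 'k mpoly3" where
  "lin a = (\<Sum>i\<in>UNIV. mconst (a $ i) * mvar i)"

lemma dot_3: "dot a v = a$1 * v$1 + a$2 * v$2 + a$3 * v$3"
  by (simp add: dot_def sum_3)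

lemma cross_nth [simp]:
  "cross a b $ 1 = a$2 * b$3 - a$3 * b$2" "cross a b $ 2 = a$3 * b$1 - a$1 * b$3"
  "cross a b $ 3 = a$1 * b$2 - a$2 * b$1"
  by (simp_all add: cross_def)

lemma vec3_eq_iff: "(a :: 'k ^ 3) = b \<longleftrightarrow> a$1 = b$1 \<and> a$2 = b$2 \<and> a$3 = b$3"
  by (simp add: vec_eq_iff forall_3)

lemma dot_simps [simp]:
  "dot (a + b) v = dot a v + dot b v" "dot a (v + w) = dot a v + dot a w"
  "dot (s *s a) v = s * dot a v" "dot a (s *s v) = s * dot a v"
  "dot 0 v = 0" "dot a 0 = 0" "dot (a - b) v = dot a v - dot b v" "dot a (v - w) = dot a v - dot a w"
  "dot (- a) v = - dot a v" "dot a (- v) = - dot a v"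
  by (simp_all add: dot_3 algebra_simps)

lemma dot_commute: "dot a v = dot v a"
  by (simp add: dot_3 algebra_simps)

lemma dot_axis [simp]: "dot (axis i 1) v = v $ i" "dot v (axis i 1) = v $ i"
proof -
  have "axis i 1 $ j * v $ j = (if j = i then v $ j else 0)" for j
    by (simp add: axis_def)
  then show "dot (axis i 1) v = v $ i" by (simp add: dot_def)
  then show "dot v (axis i 1) = v $ i" by (simp add: dot_commute)
qed

lemma eq_0_if_dot_0: "(\<And>a. dot a v = 0) \<Longrightarrow> v = 0"
  by (metis dot_axis(1) vec_eq_iff zero_index)

lemma dot_cross [simp]: "dot a (cross a b) = 0" "dot b (cross a b) = 0"
    "dot (cross a b) a = 0" "dot (cross a b) b = 0"
  by (simp_all add: dot_3 algebra_simps)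

lemma cross_self [simp]: "cross a a = 0" "cross 0 a = 0" "cross a 0 = 0"
  by (simp_all add: vec3_eq_iff)

lemma cross_commute: "cross a b = - cross b a"
  by (simp add: vec3_eq_iff)

lemma cross_simps [simp]:
  "cross (a + b) v = cross a v + cross b v" "cross a (v + w) = cross a v + cross a w"
  "cross (s *s a) v = s *s cross a v" "cross a (s *s v) = s *s cross a v"
  by (simp_all add: vec3_eq_iff algebra_simps)

lemma vector_scale_eq_0_iff [simp]: "s *s (v :: 'k::field ^ 'n) = 0 \<longleftrightarrow> s = 0 \<or> v = 0"
  by (auto simp: vec_eq_iff)

lemma vec3_nonzero: "(v :: 'k::zero ^ 3) \<noteq> 0 \<Longrightarrow> v$1 \<noteq> 0 \<or> v$2 \<noteq> 0 \<or> v$3 \<noteq> 0"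
  by (simp add: vec3_eq_iff)

lemma cross_eq_0_imp_scale:
  assumes "cross u v = 0" "u \<noteq> 0"
  shows "\<exists>s. v = s *s u"
proof -
  have e: "u$2 * v$3 = u$3 * v$2" "u$3 * v$1 = u$1 * v$3" "u$1 * v$2 = u$2 * v$1"
    using assms(1) by (simp_all add: vec3_eq_iff)
  from vec3_nonzero[OF assms(2)] show ?thesis
  proof (elim disjE)
    assume "u$1 \<noteq> 0"
    then show ?thesis using e by (intro exI[of _ "v$1 / u$1"]) (simp add: vec3_eq_iff field_simps)
  next
    assume "u$2 \<noteq> 0"
    then show ?thesis using e by (intro exI[of _ "v$2 / u$2"]) (simp add: vec3_eq_iff field_simps)
  next
    assume "u$3 \<noteq> 0"
    then show ?thesis using e by (intro exI[of _ "v$3 / u$3"]) (simp add: vec3_eq_iff field_simps)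
  qed
qed

text \<open>By the triple product expansion \<open>(a \<times> b) \<times> v = (a \<cdot> v) b - (b \<cdot> v) a\<close>.\<close>

lemma orthogonal_imp_scale_cross:
  assumes "dot a v = 0" "dot b v = 0" "cross a b \<noteq> 0"
  shows "\<exists>s. v = s *s cross a b"
proof (rule cross_eq_0_imp_scale[OF _ assms(3)])
  have "cross (cross a b) v = dot a v *s b - dot b v *s a"
    by (simp add: vec3_eq_iff dot_3 algebra_simps)
  then show "cross (cross a b) v = 0" using assms by simp
qed

lemma combination_if_scaled:
  fixes z a b :: "'k::field ^ 3"
  assumes "m \<noteq> 0" "m * z$1 = p * a$1 + q * b$1" "m * z$2 = p * a$2 + q * b$2"
    "m * z$3 = p * a$3 + q * b$3"
  shows "\<exists>\<alpha> \<beta>. z = \<alpha> *s a + \<beta> *s b"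
proof (intro exI)
  have "m *s z = p *s a + q *s b" using assms by (simp add: vec3_eq_iff)
  then have "(1 / m) *s (m *s z) = (1 / m) *s (p *s a + q *s b)" by simp
  then show "z = (p / m) *s a + (q / m) *s b"
    using assms(1) by (simp add: vec3_eq_iff add_divide_distrib)
qed

text \<open>
  Cramer's rule: the coefficients are the cross products \<open>z \<times> b\<close> and \<open>a \<times> z\<close> divided by \<open>a \<times> b\<close>,
  compared at a coordinate where \<open>a \<times> b\<close> is nonzero.
\<close>

lemma coplanar_imp_combination:
  assumes "cross a b \<noteq> 0" "dot z (cross a b) = 0"
  shows "\<exists>\<alpha> \<beta>. z = \<alpha> *s a + \<beta> *s b"
proof -
  define n1 n2 n3 where n: "n1 = a$2 * b$3 - a$3 * b$2" "n2 = a$3 * b$1 - a$1 * b$3"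
    "n3 = a$1 * b$2 - a$2 * b$1"
  have z: "z$1 * n1 + z$2 * n2 + z$3 * n3 = 0" using assms(2) by (simp add: dot_3 n)
  have ab: "a$1 * n1 + a$2 * n2 + a$3 * n3 = 0" "b$1 * n1 + b$2 * n2 + b$3 * n3 = 0"
    unfolding n by algebra+
  have "n1 \<noteq> 0 \<or> n2 \<noteq> 0 \<or> n3 \<noteq> 0" using vec3_nonzero[OF assms(1)] by (simp add: n)
  then show ?thesis
  proof (elim disjE)
    assume n0: "n1 \<noteq> 0"
    have "n1 * z$1 = (z$2 * b$3 - z$3 * b$2) * a$1 + (a$2 * z$3 - a$3 * z$2) * b$1"
      "n1 * z$2 = (z$2 * b$3 - z$3 * b$2) * a$2 + (a$2 * z$3 - a$3 * z$2) * b$2"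
      "n1 * z$3 = (z$2 * b$3 - z$3 * b$2) * a$3 + (a$2 * z$3 - a$3 * z$2) * b$3"
      using z unfolding n by (algebra | simp add: algebra_simps)+
    then show ?thesis by (rule combination_if_scaled[OF n0])
  next
    assume n0: "n2 \<noteq> 0"
    have "n2 * z$1 = (z$3 * b$1 - z$1 * b$3) * a$1 + (a$3 * z$1 - a$1 * z$3) * b$1"
      "n2 * z$2 = (z$3 * b$1 - z$1 * b$3) * a$2 + (a$3 * z$1 - a$1 * z$3) * b$2"
      "n2 * z$3 = (z$3 * b$1 - z$1 * b$3) * a$3 + (a$3 * z$1 - a$1 * z$3) * b$3"
      using z unfolding n by (algebra | simp add: algebra_simps)+
    then show ?thesis by (rule combination_if_scaled[OF n0])
  next
    assume n0: "n3 \<noteq> 0"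
    have "n3 * z$1 = (z$1 * b$2 - z$2 * b$1) * a$1 + (a$1 * z$2 - a$2 * z$1) * b$1"
      "n3 * z$2 = (z$1 * b$2 - z$2 * b$1) * a$2 + (a$1 * z$2 - a$2 * z$1) * b$2"
      "n3 * z$3 = (z$1 * b$2 - z$2 * b$1) * a$3 + (a$1 * z$2 - a$2 * z$1) * b$3"
      using z unfolding n by (algebra | simp add: algebra_simps)+
    then show ?thesis by (rule combination_if_scaled[OF n0])
  qed
qed

lemma two_lines_through_point:
  assumes "v \<noteq> 0"
  shows "\<exists>a b. dot a v = 0 \<and> dot b v = 0 \<and> cross a b \<noteq> 0"
  using vec3_nonzero[OF assms]
proof (elim disjE)
  assume "v$1 \<noteq> 0"
  then show ?thesis
    by (intro exI[of _ "vector [v$2, - v$1, 0]"] exI[of _ "vector [v$3, 0, - v$1]"])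
      (simp add: dot_3 vec3_eq_iff)
next
  assume "v$2 \<noteq> 0"
  then show ?thesis
    by (intro exI[of _ "vector [v$2, - v$1, 0]"] exI[of _ "vector [0, v$3, - v$2]"])
      (simp add: dot_3 vec3_eq_iff)
next
  assume "v$3 \<noteq> 0"
  then show ?thesis
    by (intro exI[of _ "vector [v$3, 0, - v$1]"] exI[of _ "vector [0, v$3, - v$2]"])
      (simp add: dot_3 vec3_eq_iff)
qed

lemma functional_one:
  assumes "v \<noteq> 0"
  shows "\<exists>k. dot k v = 1"
proof -
  obtain i where "v $ i \<noteq> 0" using assms by (auto simp: vec_eq_iff)
  then show ?thesis by (intro exI[of _ "(1 / v $ i) *s axis i 1"]) (simp add: dot_simps)
qed

lemma separating_functional:
  assumes "cross u v \<noteq> 0"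
  shows "\<exists>a. dot a u = 0 \<and> dot a v \<noteq> 0"
proof -
  have "u \<noteq> 0" using assms by auto
  then obtain a b where ab: "dot a u = 0" "dot b u = 0" "cross a b \<noteq> 0"
    using two_lines_through_point by blast
  show ?thesis
  proof (rule ccontr)
    assume "\<not> ?thesis"
    then have "dot a v = 0" "dot b v = 0" using ab by blast+
    then obtain s r where "v = s *s cross a b" "u = r *s cross a b"
      using ab orthogonal_imp_scale_cross by metis
    then show False using assms by simp
  qed
qed

lemma lin_forms [simp]: "lin a \<in> forms 1" "lin a \<in> forms (Suc 0)"
  using forms_mconst_mult[OF mvar_forms(1)] by (auto simp: lin_def intro!: forms_sum)

lemma eval_lin [simp]: "eval_at (lin a) v = dot a v"
  by (simp add: lin_def dot_def)

lemma mconst_sum: "mconst (sum h I) = (\<Sum>i\<in>I. mconst (h i))"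
  by (induction I rule: infinite_finite_induct) simp_all

lemma dderiv_lin [simp]: "dderiv c (lin a) = mconst (dot a c)"
  by (simp add: lin_def dot_def mconst_sum)

lemma lin_eq_0_iff [simp]: "lin a = 0 \<longleftrightarrow> a = 0"
proof
  assume "lin a = 0"
  then have "dot a v = 0" for v using eval_lin[of a v] by simp
  then show "a = 0" using eq_0_if_dot_0[of a] dot_commute by metis
qed (simp add: lin_def)

lemma lin_add: "lin (a + b) = lin a + lin b"
  and lin_scale: "lin (s *s a) = mconst s * lin a"
  by (simp_all add: lin_def algebra_simps sum.distrib sum_distrib_left)

lemma lin_axis: "lin (axis i 1) = mvar i"
proof -
  have "lin (axis i 1) = (\<Sum>j\<in>UNIV. if j = i then mvar j else 0)"
    unfolding lin_def by (rule sum.cong) (auto simp: axis_def)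
  then show ?thesis by simp
qed

lemma forms_1_lin:
  assumes "f \<in> forms 1"
  shows "\<exists>a. f = lin a"
proof -
  have "(d = 1 \<longrightarrow> (\<exists>a. f = lin a)) \<and> (d = 0 \<longrightarrow> (\<exists>c. f = mconst c))" if "f \<in> forms d" for d f
    using that
  proof (induction rule: forms_induct)
    case (zero d)
    then show ?case using lin_eq_0_iff[of 0] by (metis mconst_simps(1))
  next
    case (add d f g)
    then show ?case by (metis lin_add mconst_simps(3))
  next
    case (mult d i f)
    show ?case
    proof (intro conjI impI)
      assume "Suc d = 1"
      then obtain c where "f = mconst c" using mult by auto
      then have "mvar i * f = lin (c *s axis i 1)" by (simp add: lin_scale lin_axis mult.commute)
      then show "\<exists>a. mvar i * f = lin a" by blast
    qed simp
  qed auto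
  then show ?thesis using assms by blast
qed

section \<open>Divisibility of forms by linear forms\<close>

text \<open>
  The multiples in degree \<open>d\<close> of a form of degree \<open>e\<close>. The case \<open>d < e\<close> needs its own clause,
  because subtraction on the natural numbers would turn the cofactor into a constant.
\<close>

definition multiples :: "'k::field mpoly3 \<Rightarrow> nat \<Rightarrow> nat \<Rightarrow> 'k mpoly3 set" where
  "multiples F e d = (if e \<le> d then (*) F ` forms (d - e) else {0})"

lemma multiples_0 [simp]: "0 \<in> multiples F e d"
  by (auto simp: multiples_def intro!: image_eqI[of _ _ 0])

lemma multiplesI: "g \<in> forms d \<Longrightarrow> F * g \<in> multiples F e (e + d)"
  by (auto simp: multiples_def)

lemma multiples_add: "f \<in> multiples F e d \<Longrightarrow> g \<in> multiples F e d \<Longrightarrow> f + g \<in> multiples F e d"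
  unfolding multiples_def
  by (auto split: if_splits intro!: imageI forms_add simp flip: distrib_left)

lemma multiples_mult: "f \<in> multiples F e d \<Longrightarrow> h \<in> forms k \<Longrightarrow> h * f \<in> multiples F e (k + d)"
proof -
  assume f: "f \<in> multiples F e d" and h: "h \<in> forms k"
  show ?thesis
  proof (cases "e \<le> d")
    case True
    then obtain g where g: "f = F * g" "g \<in> forms (d - e)" using f by (auto simp: multiples_def)
    have "h * g \<in> forms (k + (d - e))" using forms_mult[OF h g(2)] .
    then have "F * (h * g) \<in> multiples F e (e + (k + (d - e)))" by (rule multiplesI)
    then show ?thesis using True g by (simp add: mult.left_commute)
  next
    case False
    then have "f = 0" using f by (simp add: multiples_def)
    then show ?thesis by simp
  qed
qed

lemma multiples_linE:
  assumes "f \<in> multiples (lin a) 1 (Suc d)"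
  obtains g where "g \<in> forms d" "f = lin a * g"
  using assms by (auto simp: multiples_def)

text \<open>
  A form is determined modulo two lines through \<open>v\<close> by its value at \<open>v\<close>: every variable is
  congruent to a multiple of a third linear form that is \<open>1\<close> at \<open>v\<close>.
\<close>

lemma form_modulo_point:
  assumes k: "dot k v = 1" and ab: "dot a v = 0" "dot b v = 0" "cross a b \<noteq> 0"
    and f: "f \<in> forms d"
  shows "\<exists>c g h. g \<in> forms (d - 1) \<and> h \<in> forms (d - 1) \<and> (d = 0 \<longrightarrow> g = 0 \<and> h = 0) \<and>
    f = mconst c * lin k ^ d + lin a * g + lin b * h"
  using f
proof (induction rule: forms_induct)
  case (zero d)
  show ?case by (intro exI[of _ 0]) simp
next
  case (add d f1 f2)
  then obtain c1 g1 h1 c2 g2 h2 where "g1 \<in> forms (d - 1)" "h1 \<in> forms (d - 1)" "d = 0 \<longrightarrow> g1 = 0 \<and> h1 = 0"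
    "f1 = mconst c1 * lin k ^ d + lin a * g1 + lin b * h1"
    "g2 \<in> forms (d - 1)" "h2 \<in> forms (d - 1)" "d = 0 \<longrightarrow> g2 = 0 \<and> h2 = 0"
    "f2 = mconst c2 * lin k ^ d + lin a * g2 + lin b * h2" by blast
  then have "f1 + f2 = mconst (c1 + c2) * lin k ^ d + lin a * (g1 + g2) + lin b * (h1 + h2)"
    "g1 + g2 \<in> forms (d - 1)" "h1 + h2 \<in> forms (d - 1)" "d = 0 \<longrightarrow> g1 + g2 = 0 \<and> h1 + h2 = 0"
    by (auto simp: algebra_simps intro: forms_add)
  then show ?case by blast
next
  case (const c)
  have "mconst c = mconst c * lin k ^ 0 + lin a * 0 + lin b * 0" by simp
  then show ?case using forms_0 by blast
next
  case (mult d i f)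
  then obtain c g h where gh: "g \<in> forms (d - 1)" "h \<in> forms (d - 1)" "d = 0 \<longrightarrow> g = 0 \<and> h = 0"
    "f = mconst c * lin k ^ d + lin a * g + lin b * h" by blast
  let ?z = "axis i 1 - v $ i *s k"
  obtain s where s: "v = s *s cross a b" using orthogonal_imp_scale_cross ab by metis
  have "s \<noteq> 0" using s k by auto
  moreover have "dot ?z v = 0" using k by simp
  ultimately have "dot ?z (cross a b) = 0" using s by (metis dot_simps(4) mult_eq_0_iff)
  then obtain \<alpha> \<beta> where "?z = \<alpha> *s a + \<beta> *s b" using coplanar_imp_combination ab by blast
  then have ax: "axis i 1 = v $ i *s k + \<alpha> *s a + \<beta> *s b" by (simp add: algebra_simps)
  have x: "mvar i = mconst (v $ i) * lin k + mconst \<alpha> * lin a + mconst \<beta> * lin b"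
    unfolding lin_axis[symmetric] ax lin_add lin_scale ..
  have K: "lin k ^ d \<in> forms d" using forms_power[OF lin_forms(1), of k d] by simp
  have M: "mvar i * g \<in> forms d \<and> mvar i * h \<in> forms d"
  proof (cases d)
    case (Suc m)
    then show ?thesis using gh forms_mult[OF mvar_forms(1)] by fastforce
  qed (use gh in simp)
  have "mvar i * f = mvar i * (mconst c * lin k ^ d) + lin a * (mvar i * g) + lin b * (mvar i * h)"
    by (simp add: gh(4) algebra_simps)
  also have "mvar i * (mconst c * lin k ^ d) =
      (mconst (v $ i) * lin k + mconst \<alpha> * lin a + mconst \<beta> * lin b) * (mconst c * lin k ^ d)"
    by (simp only: x)
  finally have "mvar i * f = mconst (v $ i * c) * lin k ^ Suc d +
      lin a * (mvar i * g + mconst (\<alpha> * c) * lin k ^ d) + lin b * (mvar i * h + mconst (\<beta> * c) * lin k ^ d)"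
    by (simp add: algebra_simps)
  moreover have "mvar i * g + mconst (\<alpha> * c) * lin k ^ d \<in> forms (Suc d - 1)"
    "mvar i * h + mconst (\<beta> * c) * lin k ^ d \<in> forms (Suc d - 1)"
    using M K forms_mconst_mult forms_add by (metis diff_Suc_1)+
  ultimately show ?case by blast
qed

lemma form_vanishing_at_point:
  assumes f: "f \<in> forms (Suc d)" "eval_at f v = 0" and v: "v \<noteq> 0"
    and ab: "dot a v = 0" "dot b v = 0" "cross a b \<noteq> 0"
  shows "\<exists>g\<in>forms d. \<exists>h\<in>forms d. f = lin a * g + lin b * h"
proof -
  obtain k where k: "dot k v = 1" using functional_one[OF v] by blast
  then obtain c g h where gh: "g \<in> forms d" "h \<in> forms d"
      "f = mconst c * lin k ^ Suc d + lin a * g + lin b * h"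
    using form_modulo_point[OF _ ab f(1)] by (metis diff_Suc_1)
  then have "c = 0" using f(2) ab k by simp
  then show ?thesis using gh by auto
qed

definition distinct_points :: "('k::field ^ 3) set \<Rightarrow> bool" where
  "distinct_points X \<longleftrightarrow> (\<forall>x\<in>X. x \<noteq> 0) \<and> (\<forall>x\<in>X. \<forall>y\<in>X. x \<noteq> y \<longrightarrow> cross x y \<noteq> 0)"

lemma distinct_points_subset: "distinct_points X \<Longrightarrow> Y \<subseteq> X \<Longrightarrow> distinct_points Y"
  unfolding distinct_points_def by blast

lemma scaled_imp_cross_0: "u = s *s n \<Longrightarrow> v = r *s n \<Longrightarrow> cross u v = 0"
  by simp

text \<open>
  A form of degree \<open>d\<close> that has more than \<open>d\<close> zeros on a line, those in \<open>Y\<close> counted twice, is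
  divisible by the line. At \<open>Y\<close> only the derivative along the line has to vanish: this weaker
  condition is inherited by the cofactor \<open>h\<close> of \<open>f = lin a * g + lin b * h\<close>, where \<open>lin b\<close> is
  another line through the zero that is split off.
\<close>

lemma line_divides:
  assumes "finite Y" "finite Y'" "Y \<inter> Y' = {}" "distinct_points (Y \<union> Y')"
    and "\<And>y. y \<in> Y \<union> Y' \<Longrightarrow> dot a y = 0" and "a \<noteq> 0"
    and "f \<in> forms d" and "\<And>y. y \<in> Y \<union> Y' \<Longrightarrow> eval_at f y = 0"
    and "\<And>y w. y \<in> Y \<Longrightarrow> dot a w = 0 \<Longrightarrow> eval_at (dderiv w f) y = 0"
    and "d < 2 * card Y + card Y'"
  shows "f \<in> multiples (lin a) 1 d"
  using assms
proof (induction d arbitrary: f Y Y')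
  case 0
  then obtain y where "y \<in> Y \<union> Y'" by (cases "Y \<union> Y' = {}") auto
  then have "eval_at f y = 0" by (rule 0)
  then have "f = 0" using forms_0_const[OF \<open>f \<in> forms 0\<close>] by auto
  then show ?case by simp
next
  case (Suc d)
  note dist = Suc.prems(4)
  obtain y where y: "y \<in> Y \<union> Y'" using Suc.prems(10) by (cases "Y \<union> Y' = {}") auto
  then have y0: "y \<noteq> 0" and ay: "dot a y = 0" and fy: "eval_at f y = 0"
    using Suc.prems unfolding distinct_points_def by blast+
  obtain b where b: "dot b y = 0" "cross a b \<noteq> 0"
  proof -
    obtain b c where bc: "dot b y = 0" "dot c y = 0" "cross b c \<noteq> 0"
      using two_lines_through_point[OF y0] by blast
    have "cross a b \<noteq> 0 \<or> cross a c \<noteq> 0"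
    proof (rule ccontr)
      assume "\<not> ?thesis"
      then have "cross a b = 0" "cross a c = 0" by simp_all
      from cross_eq_0_imp_scale[OF this(1) \<open>a \<noteq> 0\<close>] obtain s where "b = s *s a" ..
      moreover from cross_eq_0_imp_scale[OF \<open>cross a c = 0\<close> \<open>a \<noteq> 0\<close>] obtain r where "c = r *s a" ..
      ultimately have "cross b c = 0" by (rule scaled_imp_cross_0)
      then show False using bc(3) by simp
    qed
    then show ?thesis using that bc by blast
  qed
  obtain g h where gh: "g \<in> forms d" "h \<in> forms d" "f = lin a * g + lin b * h"
    using form_vanishing_at_point[OF Suc.prems(7) fy y0 ay b] by blast
  have other: "dot b x \<noteq> 0" if "x \<in> Y \<union> Y'" "x \<noteq> y" for x
  proof
    assume "dot b x = 0"
    moreover have "dot a x = 0" using that(1) by (rule Suc.prems(5))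
    ultimately obtain s r where "x = s *s cross a b" "y = r *s cross a b"
      using orthogonal_imp_scale_cross b ay by metis
    then have "cross x y = 0" by (rule scaled_imp_cross_0)
    then show False using dist that y unfolding distinct_points_def by blast
  qed
  have hx: "eval_at h x = 0" if "x \<in> Y \<union> Y'" "x \<noteq> y" for x
    using Suc.prems(8)[OF that(1)] Suc.prems(5)[OF that(1)] other[OF that] gh(3) by simp
  have dhx: "eval_at (dderiv w h) x = 0" if "x \<in> Y" "x \<noteq> y" "dot a w = 0" for x w
    using Suc.prems(9)[OF that(1,3)] Suc.prems(5)[of x] other[of x] hx[of x] gh(3) that by simp
  have "h \<in> multiples (lin a) 1 d"
  proof (cases "y \<in> Y")
    case True
    obtain w where w: "dot w a = 0" "dot w b \<noteq> 0" using separating_functional[OF b(2)] by blast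
    then have "eval_at h y = 0"
      using Suc.prems(9)[OF True, of w] gh(3) ay b(1) by (simp add: dot_commute)
    then have "\<And>x. x \<in> Y \<union> Y' \<Longrightarrow> eval_at h x = 0" using hx by blast
    moreover have "card Y > 0" using True Suc.prems(1) card_gt_0_iff by blast
    moreover have "Y - {y} \<union> insert y Y' = Y \<union> Y'" using True by blast
    moreover have "y \<notin> Y'" using True Suc.prems(3) by blast
    ultimately show ?thesis using Suc.prems True dhx
      by (intro Suc.IH[of "Y - {y}" "insert y Y'"]) (auto simp: gh(2))
  next
    case False
    then have "y \<in> Y'" using y by blast
    moreover from this have "card Y' > 0" using Suc.prems(2) card_gt_0_iff by blast
    moreover have "distinct_points (Y \<union> (Y' - {y}))" using dist by (rule distinct_points_subset) blast
    moreover have "\<And>x. x \<in> Y \<union> (Y' - {y}) \<Longrightarrow> eval_at h x = 0"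
      "\<And>x w. x \<in> Y \<Longrightarrow> dot a w = 0 \<Longrightarrow> eval_at (dderiv w h) x = 0"
      using hx dhx False by blast+
    ultimately show ?thesis using Suc.prems
      by (intro Suc.IH[of Y "Y' - {y}"]) (auto simp: gh(2))
  qed
  then have "lin b * h \<in> multiples (lin a) 1 (1 + d)" by (rule multiples_mult) simp
  moreover have "lin a * g \<in> multiples (lin a) 1 (1 + d)" by (rule multiplesI[OF gh(1)])
  ultimately show ?case using multiples_add gh(3) by simp
qed

text \<open>
  The points \<open>w + n (a \<times> b)\<close> are infinitely many points of the line \<open>a\<close> that are not on \<open>b\<close>,
  where \<open>w\<close> is one such point.
\<close>

lemma line_divides_if_vanishing:
  fixes f :: "'k::field_char_0 mpoly3"
  assumes f: "f \<in> forms d" and ab: "cross a b \<noteq> 0"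
    and van: "\<And>v. dot a v = 0 \<Longrightarrow> dot b v \<noteq> 0 \<Longrightarrow> eval_at f v = 0"
  shows "f \<in> multiples (lin a) 1 d"
proof -
  let ?u = "cross a b"
  obtain w where w: "dot a w = 0" "dot b w \<noteq> 0"
    using separating_functional[OF ab] dot_commute by metis
  have wu: "cross w ?u \<noteq> 0"
  proof
    assume "cross w ?u = 0"
    moreover have "w \<noteq> 0" using w by auto
    ultimately obtain s where s: "?u = s *s w" using cross_eq_0_imp_scale by blast
    then have "s * dot b w = 0" using dot_cross(2)[of b a] by simp
    then show False using s w ab by simp
  qed
  let ?p = "\<lambda>n::nat. w + of_nat n *s ?u"
  have c: "cross (?p m) (?p n) = (of_nat n - of_nat m) *s cross w ?u" for m n
    by (simp add: cross_commute[of ?u w] algebra_simps)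
  have inj: "inj ?p"
  proof (rule injI)
    fix m n assume "?p m = ?p n"
    then have "cross (?p m) (?p n) = 0" by (simp only: cross_self)
    then show "m = n" using wu unfolding c by simp
  qed
  have bp: "dot b (?p n) \<noteq> 0" for n using w by simp
  have "distinct_points (?p ` {..d})"
    unfolding distinct_points_def
  proof (intro conjI ballI impI)
    fix x assume "x \<in> ?p ` {..d}"
    then obtain n where "x = ?p n" by blast
    then have "dot b x \<noteq> 0" using bp by simp
    then show "x \<noteq> 0" by auto
  next
    fix x y assume "x \<in> ?p ` {..d}" "y \<in> ?p ` {..d}" "x \<noteq> y"
    then show "cross x y \<noteq> 0" using c wu by auto
  qed
  moreover have "card (?p ` {..d}) = Suc d" using card_image[OF inj_on_subset[OF inj]] by simp
  moreover have "a \<noteq> 0" using ab by auto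
  ultimately show ?thesis using f van w bp
    by (intro line_divides[of "{}" "?p ` {..d}"]) auto
qed

text \<open>On the line \<open>a\<close> the form \<open>f\<close> vanishes at all points except possibly the intersection with \<open>b\<close>.\<close>

lemma lin_prime:
  fixes f :: "'k::field_char_0 mpoly3"
  assumes "f \<in> forms d" "cross a b \<noteq> 0" "lin b * f = lin a * g"
  shows "f \<in> multiples (lin a) 1 d"
proof (rule line_divides_if_vanishing[OF assms(1,2)])
  fix v assume "dot a v = 0" "dot b v \<noteq> 0"
  then show "eval_at f v = 0" using arg_cong[OF assms(3), of "\<lambda>h. eval_at h v"] by simp
qed

section \<open>Dimensions of spaces of forms\<close>

lemma forms_finite_span:
  obtains A where "finite A" "(forms d :: 'k::field mpoly3 set) \<subseteq> mpoly3.span A"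
  using forms_subset_span[of d] finite_imageI[OF finite_mon_degree] by blast

text \<open>The exponents of the first two variables determine a monomial of given degree.\<close>

lemma card_mon_degree: "card {m :: mon3. mon_degree m = d} = (d + 2) choose 2"
proof -
  let ?p = "\<lambda>m :: mon3. (Poly_Mapping.lookup m 1, Poly_Mapping.lookup m 2)"
  let ?q = "\<lambda>(i, j). Poly_Mapping.single 1 i + Poly_Mapping.single 2 j + Poly_Mapping.single 3 (d - i - j) :: mon3"
  have deg: "mon_degree m = Poly_Mapping.lookup m 1 + Poly_Mapping.lookup m 2 + Poly_Mapping.lookup m 3" for m
    by (simp add: mon_degree_def sum_3)
  have "bij_betw ?p {m. mon_degree m = d} (SIGMA i:{..d}. {..d - i})"
  proof (rule bij_betw_byWitness[where f' = ?q])
    show "\<forall>m\<in>{m. mon_degree m = d}. ?q (?p m) = m"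
    proof
      fix m :: mon3 assume "m \<in> {m. mon_degree m = d}"
      then have "Poly_Mapping.lookup (?q (?p m)) i = Poly_Mapping.lookup m i" for i
        using exhaust_3[of i] by (auto simp: deg lookup_add lookup_single when_def)
      then show "?q (?p m) = m" by (rule poly_mapping_eqI)
    qed
    show "\<forall>z\<in>SIGMA i:{..d}. {..d - i}. ?p (?q z) = z"
      by (auto simp: lookup_add lookup_single when_def)
    show "?p ` {m. mon_degree m = d} \<subseteq> (SIGMA i:{..d}. {..d - i})"
      by (auto simp: deg)
    show "?q ` (SIGMA i:{..d}. {..d - i}) \<subseteq> {m. mon_degree m = d}"
      by auto
  qed
  then have "card {m :: mon3. mon_degree m = d} = (\<Sum>i\<le>d. Suc (d - i))"
    using bij_betw_same_card by fastforce
  also have "\<dots> = (\<Sum>i\<le>d. Suc i)"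
    by (rule sum.reindex_bij_witness[of _ "\<lambda>i. d - i" "\<lambda>i. d - i"]) auto
  also have "\<dots> = (d + 2) choose 2"
    by (induction d) (simp_all add: numeral_2_eq_2)
  finally show ?thesis .
qed

lemma dim_forms: "mpoly3.dim (forms d :: 'k::field mpoly3 set) = (d + 2) choose 2"
proof -
  let ?s = "\<lambda>m. Poly_Mapping.single m (1 :: 'k)"
  have inj: "inj_on ?s {m. mon_degree m = d}"
    by (rule inj_onI) (metis keys_single the_elem_eq zero_neq_one)
  have "mpoly3.independent (?s ` {m. mon_degree m = d})"
  proof (rule mpoly3.independent_if_scalars_zero)
    show "finite (?s ` {m. mon_degree m = d})" using finite_mon_degree by simp
    fix c x
    assume 0: "(\<Sum>x\<in>?s ` {m. mon_degree m = d}. poly_scale (c x) x) = 0"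
      and "x \<in> ?s ` {m. mon_degree m = d}"
    then obtain n where n: "x = ?s n" "mon_degree n = d" by blast
    have "0 = (\<Sum>m\<in>{m. mon_degree m = d}. poly_scale (c (?s m)) (?s m))"
      using 0 by (simp add: sum.reindex[OF inj])
    then have "0 = Poly_Mapping.lookup (\<Sum>m\<in>{m. mon_degree m = d}. poly_scale (c (?s m)) (?s m)) n"
      by (metis lookup_zero)
    also have "\<dots> = (\<Sum>m\<in>{m. mon_degree m = d}. if m = n then c (?s m) else 0)"
      by (simp add: lookup_sum lookup_poly_scale lookup_single when_def if_distrib cong: if_cong)
    also have "\<dots> = c x" using n finite_mon_degree by simp
    finally show "c x = 0" by simp
  qed
  moreover have "?s ` {m. mon_degree m = d} \<subseteq> forms d" by (auto simp: forms_def)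
  ultimately have "mpoly3.dim (forms d :: 'k mpoly3 set) = card (?s ` {m. mon_degree m = d})"
    using forms_subset_span by (intro mpoly3.dim_unique) auto
  then show ?thesis using card_image[OF inj] card_mon_degree by simp
qed

lemma subspace_multiples: "mpoly3.subspace (multiples F e d)"
proof (rule mpoly3.subspaceI)
  show "poly_scale c f \<in> multiples F e d" if "f \<in> multiples F e d" for c f
    using multiples_mult[OF that mconst_forms, of c] by (simp add: poly_scale_mconst)
qed (simp_all add: multiples_add)

lemma dim_multiples:
  assumes "F \<noteq> (0 :: 'k::field mpoly3)"
  shows "mpoly3.dim (multiples F e d) = (d + 2 - e) choose 2"
proof (cases "e \<le> d")
  case True
  obtain A where A: "finite A" "(forms (d - e) :: 'k mpoly3 set) \<subseteq> mpoly3.span A"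
    by (rule forms_finite_span)
  have "mpoly3.dim ((*) F ` forms (d - e)) = mpoly3.dim (forms (d - e) :: 'k mpoly3 set)"
    using assms
    by (intro mpoly3.dim_injective_image[OF subspace_forms A(2,1)])
      (auto simp: poly_scale_mconst algebra_simps)
  moreover have "d - e + 2 = d + 2 - e" using True by simp
  ultimately show ?thesis using True unfolding multiples_def dim_forms by simp
next
  case False
  then have "multiples F e d = mpoly3.span {}" by (simp add: multiples_def)
  then have "mpoly3.dim (multiples F e d) = 0"
    using mpoly3.dim_span_eq_card_independent[OF mpoly3.independent_empty] by simp
  moreover have "(d + 2 - e) choose 2 = 0" using False by (intro binomial_eq_0) simp
  ultimately show ?thesis by simp
qed

lemma multiples_subset_forms: "F \<in> forms e \<Longrightarrow> multiples F e d \<subseteq> forms d"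
  unfolding multiples_def using forms_mult[of F e _ "d - e"] by auto

context
  fixes \<phi> :: "'i \<Rightarrow> 'k::field mpoly3 \<Rightarrow> 'k" and I :: "'i set"
  assumes I: "finite I" and add: "\<And>i f g. \<phi> i (f + g) = \<phi> i f + \<phi> i g"
    and scl: "\<And>i c f. \<phi> i (mconst c * f) = c * \<phi> i f"
begin

lemma forms_conditions_le:
  "mpoly3.dim (forms d :: 'k mpoly3 set) \<le> mpoly3.dim {f\<in>forms d. \<forall>i\<in>I. \<phi> i f = 0} + card I"
proof -
  obtain A where A: "finite A" "(forms d :: 'k mpoly3 set) \<subseteq> mpoly3.span A"
    by (rule forms_finite_span)
  show ?thesis
    by (rule mpoly3.dim_le_joint_kernel[OF subspace_forms A(2,1) I add])
      (simp add: poly_scale_mconst scl)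
qed

lemma forms_conditions_independent:
  assumes "\<And>c. \<forall>f\<in>forms d. (\<Sum>i\<in>I. c i * \<phi> i f) = 0 \<Longrightarrow> \<forall>i\<in>I. c i = 0"
  shows "mpoly3.dim (forms d :: 'k mpoly3 set) = mpoly3.dim {f\<in>forms d. \<forall>i\<in>I. \<phi> i f = 0} + card I"
proof -
  obtain A where A: "finite A" "(forms d :: 'k mpoly3 set) \<subseteq> mpoly3.span A"
    by (rule forms_finite_span)
  show ?thesis
    by (rule mpoly3.dim_joint_kernel_independent[OF subspace_forms A(2,1) I add])
      (use assms in \<open>simp_all add: poly_scale_mconst scl\<close>)
qed

end

lemma dim_subset_forms:
  fixes W V :: "'k::field mpoly3 set"
  assumes "W \<subseteq> V" "V \<subseteq> forms d" "mpoly3.subspace W"  "mpoly3.subspace V"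
  shows "mpoly3.dim W \<le> mpoly3.dim V" and "mpoly3.dim V \<le> mpoly3.dim W \<Longrightarrow> W = V"
proof -
  obtain A where A: "finite A" "(forms d :: 'k mpoly3 set) \<subseteq> mpoly3.span A"
    by (rule forms_finite_span)
  then show eq: "mpoly3.dim V \<le> mpoly3.dim W \<Longrightarrow> W = V"
    using assms by (intro mpoly3.subspace_eq_if_dim_le[of W V A]) auto
  show "mpoly3.dim W \<le> mpoly3.dim V"
    using eq by (cases "mpoly3.dim V \<le> mpoly3.dim W") auto
qed

lemma nonzero_if_dim_pos:
  assumes "mpoly3.dim V > 0"
  shows "\<exists>f\<in>V. f \<noteq> 0"
proof (rule ccontr)
  assume "\<not> ?thesis"
  then have "V \<subseteq> mpoly3.span {}" by auto
  from mpoly3.dim_le_card[OF this] assms show False by simp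
qed

lemma two_choose_two: "2 * (Suc n choose 2) = Suc n * n"
  by (induction n) (simp_all add: numeral_2_eq_2)

section \<open>The ideal of a scheme of double points and one simple point\<close>

definition singular_at :: "'k::field mpoly3 \<Rightarrow> 'k ^ 3 \<Rightarrow> bool" where
  "singular_at f x \<longleftrightarrow> eval_at f x = 0 \<and> (\<forall>w. eval_at (dderiv w f) x = 0)"

lemma singular_at_0 [simp]: "singular_at 0 x"
  and singular_at_add: "singular_at f x \<Longrightarrow> singular_at g x \<Longrightarrow> singular_at (f + g) x"
  and singular_at_mult: "singular_at f x \<Longrightarrow> singular_at (h * f) x" "singular_at f x \<Longrightarrow> singular_at (f * h) x"
  and singular_at_product: "eval_at f x = 0 \<Longrightarrow> eval_at g x = 0 \<Longrightarrow> singular_at (f * g) x"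
  by (simp_all add: singular_at_def)

lemma singular_at_cancel: "singular_at (h * f) x \<Longrightarrow> eval_at h x \<noteq> 0 \<Longrightarrow> singular_at f x"
  by (auto simp: singular_at_def)

lemma singular_at_iff_pos:
  fixes f :: "'k::field_char_0 mpoly3"
  assumes "f \<in> forms d" "d > 0"
  shows "singular_at f x \<longleftrightarrow> (\<forall>w. eval_at (dderiv w f) x = 0)"
  using euler_eval[OF assms(1), of x] assms(2) by (auto simp: singular_at_def)

definition point :: "'k::field ^ 3 \<Rightarrow> ('k ^ 3) set" where
  "point v = range (\<lambda>s. s *s v)"

lemma point_eq_span: "point v = vec.span {v}"
  by (simp add: point_def vec.span_singleton)

lemma mem_point [simp]: "v \<in> point v"
  unfolding point_eq_span by (rule vec.span_base) simp

lemma point_in_proj_plane: "v \<noteq> 0 \<Longrightarrow> point v \<in> proj_plane"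
  by (simp add: proj_plane_def point_eq_span vec.subspace_span vec.dim_span_eq_card_independent
      vec.independent_insert)

lemma proj_plane_point: "p \<in> proj_plane \<Longrightarrow> \<exists>v. v \<noteq> 0 \<and> p = point v"
proof -
  assume p: "p \<in> proj_plane"
  obtain B where B: "B \<subseteq> p" "vec.independent B" "p \<subseteq> vec.span B" "card B = vec.dim p"
    using vec.basis_exists by blast
  then obtain v where v: "B = {v}" using p by (auto simp: proj_plane_def card_1_singleton_iff)
  then have "v \<noteq> 0" using B(2) by auto
  moreover have "p = vec.span {v}"
  proof
    show "p \<subseteq> vec.span {v}" using B(3) v by simp
    show "vec.span {v} \<subseteq> p"
      using B(1) v p by (intro vec.span_minimal) (auto simp: proj_plane_def)
  qed
  ultimately show ?thesis using point_eq_span by blast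
qed

definition rep :: "('k::field ^ 3) set \<Rightarrow> 'k ^ 3" where
  "rep p = (SOME v. v \<noteq> 0 \<and> p = point v)"

lemma rep:
  assumes "p \<in> proj_plane"
  shows "rep p \<noteq> 0" "point (rep p) = p"
proof -
  have "rep p \<noteq> 0 \<and> p = point (rep p)"
    unfolding rep_def by (rule someI_ex[OF proj_plane_point[OF assms]])
  then show "rep p \<noteq> 0" "point (rep p) = p" by simp_all
qed

lemma point_eq_if_cross_0:
  assumes "cross u v = 0" "u \<noteq> 0" "v \<noteq> 0"
  shows "point u = point v"
proof -
  obtain s where s: "v = s *s u" using cross_eq_0_imp_scale[OF assms(1,2)] by blast
  then have "s \<noteq> 0" using assms by auto
  have "r *s u \<in> point v" for r
    unfolding point_def using s \<open>s \<noteq> 0\<close> by (intro range_eqI[of _ _ "r / s"]) simp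
  moreover have "r *s v \<in> point u" for r
    unfolding point_def using s by (intro range_eqI[of _ _ "r * s"]) simp
  ultimately show ?thesis by (auto simp: point_def)
qed

lemma cross_rep_neq_0:
  assumes "p \<in> proj_plane" "q \<in> proj_plane" "p \<noteq> q"
  shows "cross (rep p) (rep q) \<noteq> 0"
  using point_eq_if_cross_0[of "rep p" "rep q"] rep assms by metis

lemma vanishes_at_point:
  assumes "f \<in> forms d" "v \<noteq> 0"
  shows "vanishes_at f (point v) \<longleftrightarrow> eval_at f v = 0"
  using assms(2) mem_point[of v] unfolding vanishes_at_def
  by (auto simp: point_def eval_scale[OF assms(1)])

lemma vanishes_at_rep:
  assumes "f \<in> forms d" "p \<in> proj_plane"
  shows "vanishes_at f p \<longleftrightarrow> eval_at f (rep p) = 0"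
  using vanishes_at_point[OF assms(1) rep(1)] rep(2) assms(2) by metis

lemma point_ideal_iff:
  assumes "f \<in> forms d" "v \<noteq> 0"
  shows "f \<in> point_ideal (point v) \<longleftrightarrow> eval_at f v = 0"
proof
  assume "f \<in> point_ideal (point v)"
  then show "eval_at f v = 0" unfolding point_ideal_def
  proof (rule ring_ideal.span_induct)
    show "ring_ideal.subspace {f. eval_at f v = 0}"
      by (rule ring_ideal.subspaceI) auto
  qed (use assms(2) in \<open>auto simp: vanishes_at_def\<close>)
next
  assume "eval_at f v = 0"
  then show "f \<in> point_ideal (point v)"
    unfolding point_ideal_def using vanishes_at_point[OF assms] assms(1)
    by (intro ring_ideal.span_base) blast
qed

lemma point_ideal_vanishes: "f \<in> point_ideal (point v) \<Longrightarrow> v \<noteq> 0 \<Longrightarrow> eval_at f v = 0"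
  unfolding point_ideal_def
proof (erule ring_ideal.span_induct)
  show "ring_ideal.subspace {f. eval_at f v = 0}"
    by (rule ring_ideal.subspaceI) auto
qed (auto simp: vanishes_at_def)

text \<open>
  A form singular at \<open>v\<close> is \<open>lin a * g + lin b * h\<close> for two lines through \<open>v\<close>, and the
  derivatives at \<open>v\<close> in suitable directions are the values of \<open>g\<close> and \<open>h\<close>; hence the cofactors
  vanish at \<open>v\<close> as well.
\<close>

lemma square_point_ideal_iff:
  fixes f :: "'k::field_char_0 mpoly3"
  assumes f: "f \<in> forms d" and v: "v \<noteq> 0"
  shows "f \<in> ideal_product (point_ideal (point v)) (point_ideal (point v)) \<longleftrightarrow> singular_at f v"
proof
  assume "f \<in> ideal_product (point_ideal (point v)) (point_ideal (point v))"
  then show "singular_at f v" unfolding ideal_product_def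
  proof (rule ring_ideal.span_induct)
    show "ring_ideal.subspace {f. singular_at f v}"
      by (rule ring_ideal.subspaceI) (auto intro: singular_at_add singular_at_mult)
  qed (use v in \<open>auto intro: singular_at_product point_ideal_vanishes\<close>)
next
  assume s: "singular_at f v"
  show "f \<in> ideal_product (point_ideal (point v)) (point_ideal (point v))"
  proof (cases d)
    case 0
    then obtain c where "f = mconst c" using forms_0_const f by blast
    then have "f = 0" using s by (simp add: singular_at_def)
    then show ?thesis by (simp add: ideal_product_def ring_ideal.span_zero)
  next
    case (Suc e)
    obtain a b where ab: "dot a v = 0" "dot b v = 0" "cross a b \<noteq> 0"
      using two_lines_through_point[OF v] by blast
    obtain g h where gh: "g \<in> forms e" "h \<in> forms e" "f = lin a * g + lin b * h"
      using form_vanishing_at_point[OF _ _ v ab] f s Suc by (metis singular_at_def)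
    have d: "dot a w * eval_at g v + dot b w * eval_at h v = 0" for w
    proof -
      have "eval_at (dderiv w f) v = dot a w * eval_at g v + dot b w * eval_at h v"
        using gh(3) ab by simp
      then show ?thesis using s by (simp add: singular_at_def)
    qed
    obtain w where "dot w a = 0" "dot w b \<noteq> 0" using separating_functional[OF ab(3)] by blast
    then have "eval_at h v = 0" using d[of w] by (simp add: dot_commute)
    moreover have "cross b a \<noteq> 0" using ab(3) cross_commute[of a b] by auto
    then obtain w where "dot w b = 0" "dot w a \<noteq> 0" using separating_functional by blast
    then have "eval_at g v = 0" using d[of w] by (simp add: dot_commute)
    ultimately have "g \<in> point_ideal (point v)" "h \<in> point_ideal (point v)"
      using point_ideal_iff gh v by blast+
    moreover have "lin a \<in> point_ideal (point v)" "lin b \<in> point_ideal (point v)"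
      using point_ideal_iff[OF lin_forms(1) v] ab by simp_all
    ultimately show ?thesis unfolding ideal_product_def gh(3)
      by (intro ring_ideal.span_add ring_ideal.span_base) blast+
  qed
qed

text \<open>
  The homogeneous part of degree \<open>d\<close> of the ideal of the scheme with double points at \<open>X\<close> and a
  simple point at \<open>P\<close> (see \<open>double_system_ideal\<close>).
\<close>

definition double_system :: "('k::field ^ 3) set \<Rightarrow> 'k ^ 3 \<Rightarrow> nat \<Rightarrow> 'k mpoly3 set" where
  "double_system X P d = {f \<in> forms d. (\<forall>x\<in>X. singular_at f x) \<and> eval_at f P = 0}"

lemma subspace_double_system: "mpoly3.subspace (double_system X P d)"
  by (rule mpoly3.subspaceI)
    (auto simp: double_system_def poly_scale_mconst intro: forms_add singular_at_add singular_at_mult)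

lemma double_system_subset: "double_system X P d \<subseteq> forms d"
  by (auto simp: double_system_def)

lemma double_system_ideal:
  fixes S :: "('k::field_char_0 ^ 3) set set"
  assumes "S \<subseteq> proj_plane" "P \<in> proj_plane"
  shows "double_points_ideal S \<inter> point_ideal P \<inter> forms d = double_system (rep ` S) (rep P) d"
proof -
  have "f \<in> ideal_product (point_ideal p) (point_ideal p) \<longleftrightarrow> singular_at f (rep p)"
    if "p \<in> proj_plane" "f \<in> forms d" for p and f :: "'k mpoly3"
    using square_point_ideal_iff[OF that(2) rep(1)[OF that(1)]] rep(2)[OF that(1)] by simp
  moreover have "f \<in> point_ideal P \<longleftrightarrow> eval_at f (rep P) = 0" if "f \<in> forms d" for f :: "'k mpoly3"
    using point_ideal_iff[OF that rep(1)[OF assms(2)]] rep(2)[OF assms(2)] by simp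
  ultimately show ?thesis
    using assms(1) unfolding double_points_ideal_def double_system_def by blast
qed

lemma hilbert_function_double_points:
  fixes S :: "('k::field_char_0 ^ 3) set set"
  assumes "S \<subseteq> proj_plane" "P \<in> proj_plane"
  shows "hilbert_function (double_points_ideal S \<inter> point_ideal P) d =
    ((d + 2) choose 2) - mpoly3.dim (double_system (rep ` S) (rep P) d)"
proof -
  have "ring_ideal.subspace (double_points_ideal S \<inter> point_ideal P)"
    by (rule ring_ideal.subspace_inter[OF subspace_double_points_ideal subspace_point_ideal])
  from hilbert_function_eq[OF this] show ?thesis
    using double_system_ideal[OF assms] dim_forms by metis
qed

text \<open>
  The closed form of the Hilbert function. Below degree \<open>2 * t\<close> it is the Hilbert function of a
  plane curve of degree \<open>t + 1\<close>; from there on it is constant, equal to the degree of the scheme.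
\<close>

definition star_hilbert :: "nat \<Rightarrow> nat \<Rightarrow> nat" where
  "star_hilbert t d =
    (if d < 2 * t then ((d + 2) choose 2) - ((d + 1 - t) choose 2) else 3 * ((t + 1) choose 2) + 1)"

lemma first_difference_star_hilbert:
  assumes "t \<ge> 1"
  shows "first_difference (star_hilbert t) i =
    (if i < length ([1..int t] @ replicate t (int t + 1) @ [1])
     then ([1..int t] @ replicate t (int t + 1) @ [1]) ! i else 0)"
proof -
  have nth: "([1..int t] @ replicate t (int t + 1) @ [1]) ! i =
      (if i < t then int i + 1 else if i < 2 * t then int t + 1 else 1)" if "i \<le> 2 * t"
    using that by (auto simp: nth_append)
  have ch: "int (Suc n choose 2) = int (n choose 2) + int n" for n
    by (simp add: numeral_2_eq_2)
  have le: "((d + 1 - t) choose 2) \<le> ((d + 2) choose 2)" for d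
    by (rule binomial_right_mono) simp
  have low: "int (star_hilbert t d) = int ((d + 2) choose 2) - int ((d + 1 - t) choose 2)" if "d < 2 * t" for d
    using that le[of d] by (simp add: star_hilbert_def of_nat_diff)
  (* The value in degree 2 * t - 1 is 3 * N, so the last jump is 1. *)
  have top: "int ((2 * t + 1) choose 2) - int (t choose 2) = int (3 * ((t + 1) choose 2))"
  proof -
    obtain n where n: "t = Suc n" using assms by (cases t) auto
    show ?thesis
      using two_choose_two[of "2 * t"] two_choose_two[of t] two_choose_two[of n]
      unfolding n by (simp add: algebra_simps)
  qed
  consider "i = 0" | e where "i = Suc e" "i < 2 * t" | "i = 2 * t" "i \<noteq> 0" | "i > 2 * t" by (cases i) force+
  then show ?thesis
  proof cases
    case 1
    have "int (star_hilbert t 0) = 1"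
      using low[of 0] assms by (simp add: binomial_eq_0 numeral_2_eq_2)
    then show ?thesis using 1 nth assms by (simp add: first_difference_def)
  next
    case 2
    have "int ((Suc e + 1 - t) choose 2) = int ((e + 1 - t) choose 2) + int (e + 1 - t)"
    proof (cases "t \<le> e + 1")
      case True
      then have "Suc e + 1 - t = Suc (e + 1 - t)" by simp
      then show ?thesis using ch by simp
    qed (simp add: binomial_eq_0)
    then have "first_difference (star_hilbert t) i = int (e + 2) - int (e + 1 - t)"
      using low[of i] low[of e] ch[of "e + 2"] 2 by (simp add: first_difference_def)
    then show ?thesis using 2 nth by (auto simp: of_nat_diff)
  next
    case 3
    have "int (star_hilbert t (i - 1)) = int (3 * ((t + 1) choose 2))"
      using low[of "i - 1"] 3 top assms by (simp add: numeral_eq_Suc)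
    then have "first_difference (star_hilbert t) i = 1"
      using 3 by (simp add: first_difference_def star_hilbert_def)
    then show ?thesis using 3 nth by simp
  next
    case 4
    then show ?thesis by (simp add: first_difference_def star_hilbert_def)
  qed
qed

lemma is_first_difference_star_hilbert:
  assumes "t \<ge> 1"
  shows "is_first_difference ([1..int t] @ replicate t (int t + 1) @ [1]) h \<longleftrightarrow> (\<forall>d. h d = star_hilbert t d)"
proof
  assume "\<forall>d. h d = star_hilbert t d"
  then have "h = star_hilbert t" by blast
  then show "is_first_difference ([1..int t] @ replicate t (int t + 1) @ [1]) h"
    using first_difference_star_hilbert[OF assms] unfolding is_first_difference_def by blast
next
  assume "is_first_difference ([1..int t] @ replicate t (int t + 1) @ [1]) h"
  then have eq: "first_difference h i = first_difference (star_hilbert t) i" for i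
    using first_difference_star_hilbert[OF assms] unfolding is_first_difference_def by metis
  have "h d = star_hilbert t d" for d
  proof (induction d)
    case 0
    then show ?case using eq[of 0] by (simp add: first_difference_def)
  next
    case (Suc d)
    then show ?case using eq[of "Suc d"] by (simp add: first_difference_def)
  qed
  then show "\<forall>d. h d = star_hilbert t d" ..
qed

section \<open>Linear relations between the conditions\<close>

text \<open>
  The conditions that define \<open>double_system X P d\<close>: the value at \<open>P\<close> and the three partial
  derivatives at each point of \<open>X\<close>. By Euler's identity the values at \<open>X\<close> are included.
\<close>

definition condition_set :: "'x set \<Rightarrow> ('x \<times> 3) option set" where
  "condition_set X = insert None (Some ` (X \<times> UNIV))"

fun condition :: "'k::field ^ 3 \<Rightarrow> (('k ^ 3) \<times> 3) option \<Rightarrow> 'k mpoly3 \<Rightarrow> 'k" where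
  "condition P None f = eval_at f P"
| "condition P (Some (x, i)) f = eval_at (dderiv (axis i 1) f) x"

lemma condition_linear:
  "condition P i (f + g) = condition P i f + condition P i g"
  "condition P i (mconst c * f) = c * condition P i f"
  by (cases "(P, i, f)" rule: condition.cases; simp)+

lemma condition_set_finite [simp]: "finite X \<Longrightarrow> finite (condition_set X)"
  by (simp add: condition_set_def)

lemma card_condition_set: "finite X \<Longrightarrow> card (condition_set X) = 3 * card X + 1"
  by (simp add: condition_set_def card_image card_cartesian_product)

lemma dderiv_axis_expansion: "dderiv w f = (\<Sum>i\<in>UNIV. mconst (w $ i) * dderiv (axis i 1) f)"
proof -
  have "w = (\<Sum>i\<in>UNIV. w $ i *s axis i 1)"
    by (simp add: vec_eq_iff axis_def if_distrib cong: if_cong)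
  then have "dderiv w f = dderiv (\<Sum>i\<in>UNIV. w $ i *s axis i 1) f" by simp
  then show ?thesis by (simp add: dderiv_sum_left dderiv_scale_left)
qed

lemma kernel_conditions:
  fixes X :: "('k::field_char_0 ^ 3) set"
  assumes "d > 0"
  shows "{f\<in>forms d. \<forall>i\<in>condition_set X. condition P i f = 0} = double_system X P d"
proof -
  have "singular_at f x \<longleftrightarrow> (\<forall>i. eval_at (dderiv (axis i 1) f) x = 0)" if "f \<in> forms d"
    for f :: "'k mpoly3" and x
    unfolding singular_at_iff_pos[OF that assms]
    using dderiv_axis_expansion[of _ f] by (metis (no_types, lifting) eval_hom(2) eval_hom2(6) mult_zero_right sum.neutral)
  then show ?thesis unfolding double_system_def condition_set_def by auto
qed

lemma sum_conditions:
  assumes "finite X"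
  shows "(\<Sum>i\<in>condition_set X. c i * condition P i f) =
    (\<Sum>x\<in>X. eval_at (dderiv (\<chi> i. c (Some (x, i))) f) x) + c None * eval_at f P"
proof -
  have "(\<Sum>i\<in>condition_set X. c i * condition P i f) =
      c None * eval_at f P + (\<Sum>z\<in>X \<times> UNIV. c (Some z) * condition P (Some z) f)"
    unfolding condition_set_def using assms
    by (subst sum.insert) (auto simp: sum.reindex)
  also have "(\<Sum>z\<in>X \<times> UNIV. c (Some z) * condition P (Some z) f) =
      (\<Sum>x\<in>X. \<Sum>i\<in>UNIV. c (Some (x, i)) * eval_at (dderiv (axis i 1) f) x)"
    unfolding sum.cartesian_product by (intro sum.cong) auto
  also have "\<dots> = (\<Sum>x\<in>X. eval_at (dderiv (\<chi> i. c (Some (x, i))) f) x)"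
    by (intro sum.cong refl, subst (2) dderiv_axis_expansion) simp
  finally show ?thesis by (simp add: add.commute)
qed

lemma dim_forms_if_no_relation:
  fixes X :: "('k::field_char_0 ^ 3) set"
  assumes X: "finite X" and d: "d > 0"
    and ind: "\<And>w \<mu>. \<forall>f\<in>forms d. (\<Sum>x\<in>X. eval_at (dderiv (w x) f) x) + \<mu> * eval_at f P = 0 \<Longrightarrow>
      (\<forall>x\<in>X. w x = 0) \<and> \<mu> = 0"
  shows "mpoly3.dim (forms d :: 'k mpoly3 set) = mpoly3.dim (double_system X P d) + (3 * card X + 1)"
proof -
  have "mpoly3.dim (forms d :: 'k mpoly3 set) =
      mpoly3.dim {f\<in>forms d. \<forall>i\<in>condition_set X. condition P i f = 0} + card (condition_set X)"
  proof (rule forms_conditions_independent[OF condition_set_finite[OF X] condition_linear])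
    fix c assume "\<forall>f\<in>forms d. (\<Sum>i\<in>condition_set X. c i * condition P i f) = 0"
    then have "(\<forall>x\<in>X. (\<chi> i. c (Some (x, i))) = 0) \<and> c None = 0"
      unfolding sum_conditions[OF X] by (rule ind)
    then have "c None = 0" "\<And>x i. x \<in> X \<Longrightarrow> c (Some (x, i)) = 0"
      by (auto simp: vec_eq_iff)
    then show "\<forall>i\<in>condition_set X. c i = 0" by (auto simp: condition_set_def)
  qed
  then show ?thesis using kernel_conditions[OF d, of X P] card_condition_set[OF X] by simp
qed

text \<open>
  If \<open>w\<close> annihilates the multiples of \<open>K\<close> by linear forms at a point where \<open>K\<close> does not vanish,
  then the factors vanishing there force \<open>w\<close> to be radial, and Euler's identity excludes that.
\<close>

lemma direction_eq_0:
  fixes K :: "'k::field_char_0 mpoly3"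
  assumes K: "K \<in> forms e" "eval_at K x \<noteq> 0"
    and 0: "\<And>a. eval_at (dderiv w (lin a * K)) x = 0"
  shows "w = 0"
proof -
  let ?k = "eval_at K x" and ?r = "eval_at (dderiv w K) x"
  have "dot a (?k *s w + ?r *s x) = 0" for a
    using 0[of a] by (simp add: mult.commute add.commute)
  then have "?k *s w + ?r *s x = 0" by (rule eq_0_if_dot_0)
  then have "?k *s w = (- ?r) *s x" by (simp add: eq_neg_iff_add_eq_0)
  then have "(1 / ?k) *s (?k *s w) = (1 / ?k) *s ((- ?r) *s x)" by simp
  then have w: "w = (- ?r / ?k) *s x" using K(2) by (simp add: vector_smult_assoc)
  define s where "s = - ?r / ?k"
  have "?r = eval_at (dderiv (s *s x) K) x" using w by (simp add: s_def)
  also have "\<dots> = s * (of_nat e * ?k)" by (simp add: dderiv_scale_left euler_eval[OF K(1)])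
  finally have "- s * ?k = s * (of_nat e * ?k)" using K(2) by (simp add: s_def)
  moreover have "s * (of_nat (Suc e) * ?k) = s * (of_nat e * ?k) + s * ?k" by (simp add: algebra_simps)
  ultimately have "s * (of_nat (Suc e) * ?k) = 0" by (metis add.left_inverse mult_minus_left)
  then have "s = 0" using K(2) by (simp del: of_nat_Suc)
  moreover have "w = s *s x" using w by (simp add: s_def)
  ultimately show ?thesis by simp
qed

section \<open>Double points on a star configuration\<close>

text \<open>Coordinates for a star configuration: the lines are \<open>lin (a l)\<close> for \<open>l \<in> L\<close>.\<close>

locale star =
  fixes t :: nat and L :: "'l set" and a :: "'l \<Rightarrow> 'k::field_char_0 ^ 3" and X :: "('k ^ 3) set"
  assumes finite_L: "finite L" and card_L: "card L = t + 1" and finite_X: "finite X"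
    and distinct_X: "distinct_points X"
    and lines_distinct: "\<And>l m. l \<in> L \<Longrightarrow> m \<in> L \<Longrightarrow> l \<noteq> m \<Longrightarrow> cross (a l) (a m) \<noteq> 0"
    and lines_nonzero: "\<And>l. l \<in> L \<Longrightarrow> a l \<noteq> 0"
    and two_lines: "\<And>x. x \<in> X \<Longrightarrow> \<exists>l\<in>L. \<exists>m\<in>L. l \<noteq> m \<and> {n\<in>L. dot (a n) x = 0} = {l, m}"
    and points_on_line: "\<And>l. l \<in> L \<Longrightarrow> card {x\<in>X. dot (a l) x = 0} = t"
begin

definition F :: "'k mpoly3" where
  "F = (\<Prod>l\<in>L. lin (a l))"

end

lemma prod_lin_forms: "finite M \<Longrightarrow> (\<Prod>l\<in>M. lin (a l)) \<in> forms (card M)"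
  by (induction M rule: finite_induct) (auto dest: forms_mult[OF lin_forms(1)])

text \<open>The lines \<open>lin (a m)\<close> are removed from the product one at a time, by \<open>lin_prime\<close>.\<close>

lemma lin_prime_prod:
  fixes a :: "'l \<Rightarrow> 'k::field_char_0 ^ 3"
  assumes "finite M" "\<And>m. m \<in> M \<Longrightarrow> cross b (a m) \<noteq> 0" "g \<in> forms e"
    and "(\<Prod>m\<in>M. lin (a m)) * g \<in> multiples (lin b) 1 (card M + e)"
  shows "g \<in> multiples (lin b) 1 e"
  using assms
proof (induction M rule: finite_induct)
  case (insert m M)
  let ?G = "(\<Prod>m\<in>M. lin (a m)) * g"
  have G: "?G \<in> forms (card M + e)" by (rule forms_mult[OF prod_lin_forms[OF insert.hyps(1)] insert.prems(2)])
  have "lin (a m) * ?G \<in> multiples (lin b) 1 (Suc (card M + e))"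
    using insert by (simp add: mult.assoc)
  then obtain h where h: "lin (a m) * ?G = lin b * h" by (rule multiples_linE)
  have "?G \<in> multiples (lin b) 1 (card M + e)"
    using insert.prems(1) by (intro lin_prime[OF G _ h]) simp
  then show ?case using insert by blast
qed simp

lemma prod_lin_divides:
  fixes a :: "'l \<Rightarrow> 'k::field_char_0 ^ 3"
  assumes "finite M" "\<And>l m. l \<in> M \<Longrightarrow> m \<in> M \<Longrightarrow> l \<noteq> m \<Longrightarrow> cross (a l) (a m) \<noteq> 0"
    and f: "f \<in> forms d" and "\<And>l. l \<in> M \<Longrightarrow> f \<in> multiples (lin (a l)) 1 d"
  shows "f \<in> multiples (\<Prod>l\<in>M. lin (a l)) (card M) d"
  using assms(1,2,4)
proof (induction M rule: finite_induct)
  case empty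
  then show ?case using f by (auto simp: multiples_def)
next
  case (insert l M)
  let ?Q = "\<Prod>l\<in>M. lin (a l)"
  have "f \<in> multiples ?Q (card M) d" using insert by blast
  show ?case
  proof (cases "f = 0")
    case False
    then obtain g where g: "card M \<le> d" "g \<in> forms (d - card M)" "f = ?Q * g"
      using \<open>f \<in> multiples ?Q (card M) d\<close> by (auto simp: multiples_def split: if_splits)
    have "g \<in> multiples (lin (a l)) 1 (d - card M)"
    proof (rule lin_prime_prod[OF insert.hyps(1) _ g(2)])
      show "cross (a l) (a m) \<noteq> 0" if "m \<in> M" for m
        using insert.prems(1)[of l m] insert.hyps(2) that by auto
      show "?Q * g \<in> multiples (lin (a l)) 1 (card M + (d - card M))"
        using insert.prems(2)[of l] g by simp
    qed
    moreover have "g \<noteq> 0" using False g by auto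
    ultimately obtain h where h: "card M < d" "h \<in> forms (d - card M - 1)" "g = lin (a l) * h"
      by (auto simp: multiples_def split: if_splits)
    have "(\<Prod>l\<in>insert l M. lin (a l)) * h \<in> multiples (\<Prod>l\<in>insert l M. lin (a l)) (card (insert l M))
        (card (insert l M) + (d - card M - 1))"
      by (rule multiplesI[OF h(2)])
    then show ?thesis using g h insert.hyps by (simp add: mult_ac)
  qed simp
qed

context star
begin

lemma F_forms: "F \<in> forms (t + 1)"
  unfolding F_def using prod_lin_forms[OF finite_L, of a] card_L by simp

lemma F_nonzero: "F \<noteq> 0"
  unfolding F_def using finite_L lines_nonzero by simp

lemma two_linesE:
  assumes "x \<in> X"
  obtains l m where "l \<in> L" "m \<in> L" "l \<noteq> m" "dot (a l) x = 0" "dot (a m) x = 0"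
proof -
  obtain l m where lm: "l \<in> L" "m \<in> L" "l \<noteq> m" "{n\<in>L. dot (a n) x = 0} = {l, m}"
    using two_lines[OF assms] by auto
  then have "l \<in> {n\<in>L. dot (a n) x = 0}" "m \<in> {n\<in>L. dot (a n) x = 0}" by simp_all
  then have "dot (a l) x = 0" "dot (a m) x = 0" by simp_all
  with lm(1-3) show ?thesis by (rule that)
qed

lemma F_singular: "x \<in> X \<Longrightarrow> singular_at F x"
proof -
  assume x: "x \<in> X"
  obtain l m where lm: "l \<in> L" "m \<in> L" "l \<noteq> m" "dot (a l) x = 0" "dot (a m) x = 0"
    by (rule two_linesE[OF x])
  have "F = lin (a l) * (lin (a m) * (\<Prod>l\<in>L - {l} - {m}. lin (a l)))"
    unfolding F_def using lm finite_L
    by (subst prod.remove[of L l], simp_all, subst prod.remove[of "L - {l}" m]) simp_all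
  then show ?thesis using lm by (auto intro: singular_at_product)
qed

text \<open>
  In degrees below \<open>2 * t\<close> the \<open>t\<close> double points on each line force the line to split off.
\<close>

lemma double_system_low:
  assumes P: "l0 \<in> L" "dot (a l0) P = 0" and d: "d < 2 * t"
  shows "double_system X P d = multiples F (t + 1) d"
proof
  have "eval_at F P = 0" unfolding F_def using P finite_L by auto
  then show "multiples F (t + 1) d \<subseteq> double_system X P d"
    using multiples_subset_forms[OF F_forms, of d] F_singular unfolding double_system_def
    by (auto simp: multiples_def split: if_splits intro: singular_at_mult)
next
  show "double_system X P d \<subseteq> multiples F (t + 1) d"
  proof
    fix f assume f: "f \<in> double_system X P d"
    have "f \<in> multiples (lin (a l)) 1 d" if "l \<in> L" for l
    proof (rule line_divides[of "{x\<in>X. dot (a l) x = 0}" "{}"])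
      show "finite {x\<in>X. dot (a l) x = 0}" using finite_X by simp
      show "distinct_points ({x\<in>X. dot (a l) x = 0} \<union> {})"
        by (rule distinct_points_subset[OF distinct_X]) auto
      show "d < 2 * card {x\<in>X. dot (a l) x = 0} + card {}" using points_on_line[OF that] d by simp
    qed (use f that lines_nonzero in \<open>auto simp: double_system_def singular_at_def\<close>)
    then have "f \<in> multiples (\<Prod>l\<in>L. lin (a l)) (card L) d"
      using f lines_distinct finite_L by (intro prod_lin_divides) (auto simp: double_system_def)
    then show "f \<in> multiples F (t + 1) d" unfolding F_def card_L .
  qed
qed

text \<open>
  From degree \<open>2 * t\<close> on the conditions are independent: the square of the product of the
  \<open>t - 1\<close> lines that miss \<open>x\<close> is singular at all other points of \<open>X\<close>.
\<close>

lemma dim_forms_high: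
  assumes P: "P \<noteq> 0" "\<And>x. x \<in> X \<Longrightarrow> cross P x \<noteq> 0" and d: "2 * t \<le> d" "t > 0"
  shows "mpoly3.dim (forms d :: 'k mpoly3 set) = mpoly3.dim (double_system X P d) + (3 * card X + 1)"
proof (rule dim_forms_if_no_relation[OF finite_X])
  show "d > 0" using d by simp
  fix w \<mu> assume rel: "\<forall>f\<in>forms d. (\<Sum>x\<in>X. eval_at (dderiv (w x) f) x) + \<mu> * eval_at f P = 0"
  have w: "w x = 0" if x: "x \<in> X" for x
  proof -
    obtain l m where lm: "l \<in> L" "m \<in> L" "l \<noteq> m" "{n\<in>L. dot (a n) x = 0} = {l, m}"
      using two_lines[OF x] by blast
    define Q where "Q = (\<Prod>n\<in>L - {l, m}. lin (a n))"
    have "card (L - {l, m}) = t - 1" using lm card_L finite_L by (simp add: card_Diff_subset)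
    then have Qf: "Q \<in> forms (t - 1)"
      unfolding Q_def using prod_lin_forms[of "L - {l, m}" a] finite_L by simp
    have Qx: "eval_at Q x \<noteq> 0" using lm finite_L by (auto simp: Q_def)
    have Qy: "eval_at Q y = 0" if y: "y \<in> X" "y \<noteq> x" for y
    proof -
      obtain l' m' where lm': "l' \<in> L" "m' \<in> L" "l' \<noteq> m'" "dot (a l') y = 0" "dot (a m') y = 0"
        by (rule two_linesE[OF y(1)])
      have "\<not> {l', m'} \<subseteq> {l, m}"
      proof
        assume "{l', m'} \<subseteq> {l, m}"
        then have "dot (a l) y = 0" "dot (a m) y = 0" using lm' by auto
        moreover have "l \<in> {n\<in>L. dot (a n) x = 0}" "m \<in> {n\<in>L. dot (a n) x = 0}"
          using lm(4) by simp_all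
        then have "dot (a l) x = 0" "dot (a m) x = 0" by simp_all
        ultimately obtain s r where "x = s *s cross (a l) (a m)" "y = r *s cross (a l) (a m)"
          using orthogonal_imp_scale_cross[OF _ _ lines_distinct[OF lm(1-3)]] by meson
        then have "cross x y = 0" by (rule scaled_imp_cross_0)
        moreover have "cross x y \<noteq> 0"
          using distinct_X x y unfolding distinct_points_def by simp
        ultimately show False by simp
      qed
      then obtain n where "n \<in> L - {l, m}" "dot (a n) y = 0" using lm' by blast
      then show ?thesis unfolding Q_def using finite_L by auto
    qed
    (* The test form lin b * K vanishes at P because of beta and is singular at X - {x} because of Q. *)
    obtain \<beta> where \<beta>: "dot \<beta> P = 0" "dot \<beta> x \<noteq> 0" using separating_functional[OF P(2)[OF x]] by blast
    define K where "K = Q * Q * lin \<beta> ^ (d + 1 - 2 * t)"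
    have Kf: "K \<in> forms (d - 1)"
    proof -
      have "Q * Q * lin \<beta> ^ (d + 1 - 2 * t) \<in> forms ((t - 1) + (t - 1) + (d + 1 - 2 * t) * 1)"
        by (intro forms_mult Qf forms_power lin_forms)
      moreover have "(t - 1) + (t - 1) + (d + 1 - 2 * t) * 1 = d - 1" using d by simp
      ultimately show ?thesis unfolding K_def by (simp only:)
    qed
    have KP: "eval_at K P = 0" using \<beta> d by (simp add: K_def)
    show "w x = 0"
    proof (rule direction_eq_0[OF Kf])
      show "eval_at K x \<noteq> 0" using Qx \<beta> by (simp add: K_def)
      fix b
      have "lin b * K \<in> forms d" using forms_mult[OF lin_forms(1) Kf, of b] d by simp
      with rel have 0: "(\<Sum>y\<in>X. eval_at (dderiv (w y) (lin b * K)) y) + \<mu> * eval_at (lin b * K) P = 0"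
        by blast
      have "singular_at (lin b * K) y" if "y \<in> X" "y \<noteq> x" for y
        unfolding K_def using Qy[OF that] by (intro singular_at_mult singular_at_product)
      then have "(\<Sum>y\<in>X. eval_at (dderiv (w y) (lin b * K)) y) =
          (\<Sum>y\<in>X. if y = x then eval_at (dderiv (w x) (lin b * K)) x else 0)"
        by (intro sum.cong) (auto simp: singular_at_def)
      with 0 KP show "eval_at (dderiv (w x) (lin b * K)) x = 0" using x finite_X by simp
    qed
  qed
  moreover have "\<mu> = 0"
  proof -
    obtain k where "dot k P = 1" using functional_one[OF P(1)] by blast
    moreover have "lin k ^ d \<in> forms d" using forms_power[OF lin_forms(1), of k d] by simp
    with rel have "(\<Sum>x\<in>X. eval_at (dderiv (w x) (lin k ^ d)) x) + \<mu> * eval_at (lin k ^ d) P = 0" by blast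
    ultimately show ?thesis using w by simp
  qed
  ultimately show "(\<forall>x\<in>X. w x = 0) \<and> \<mu> = 0" by blast
qed

lemma star_hilbert_function:
  assumes P: "l0 \<in> L" "dot (a l0) P = 0" "P \<noteq> 0" "\<And>x. x \<in> X \<Longrightarrow> cross P x \<noteq> 0"
    and card: "card X = (t + 1) choose 2" and t: "t > 0"
  shows "((d + 2) choose 2) - mpoly3.dim (double_system X P d) = star_hilbert t d"
proof (cases "d < 2 * t")
  case True
  have "mpoly3.dim (double_system X P d) = (d + 2 - (t + 1)) choose 2"
    unfolding double_system_low[OF P(1,2) True] by (rule dim_multiples[OF F_nonzero])
  moreover have "d + 2 - (t + 1) = d + 1 - t" by simp
  ultimately show ?thesis using True unfolding star_hilbert_def by simp
next
  case False
  then have "mpoly3.dim (forms d :: 'k mpoly3 set) = mpoly3.dim (double_system X P d) + (3 * card X + 1)"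
    using P t by (intro dim_forms_high) auto
  then show ?thesis using False card unfolding star_hilbert_def dim_forms by simp
qed

end

section \<open>No curve of degree less than \<open>t\<close> passes through the points\<close>

text \<open>
  The situation that the Hilbert function provides: in the degrees below \<open>2 * t\<close> the ideal consists
  of the multiples of a form \<open>F\<close> of degree \<open>t + 1\<close>.
\<close>

locale curve_system =
  fixes t :: nat and X :: "('k::field_char_0 ^ 3) set" and P :: "'k ^ 3" and F :: "'k mpoly3"
  assumes t: "t \<ge> 2" and finite_X: "finite X" and card_X: "card X = (t + 1) choose 2"
    and distinct_X: "distinct_points X" and P: "P \<noteq> 0"
    and F: "F \<in> forms (t + 1)" "F \<noteq> 0"
    and system: "\<And>d. d < 2 * t \<Longrightarrow> double_system X P d = multiples F (t + 1) d"
begin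

lemma F_singular: "x \<in> X \<Longrightarrow> singular_at F x" and F_P: "eval_at F P = 0"
proof -
  have "F \<in> multiples F (t + 1) (t + 1 + 0)" using multiplesI[OF one_forms, of F "t + 1"] by simp
  then have "F \<in> double_system X P (t + 1)" using system[of "t + 1"] t by simp
  then show "x \<in> X \<Longrightarrow> singular_at F x" "eval_at F P = 0" by (auto simp: double_system_def)
qed

lemma system_multiple:
  assumes "f \<in> forms d" "d < 2 * t" "\<And>x. x \<in> X \<Longrightarrow> singular_at f x" "eval_at f P = 0" "f \<noteq> 0"
  shows "t + 1 \<le> d" "\<exists>g\<in>forms (d - (t + 1)). f = F * g"
proof -
  have "f \<in> multiples F (t + 1) d" using assms system[OF assms(2)] by (auto simp: double_system_def)
  with assms(5) show "t + 1 \<le> d" "\<exists>g\<in>forms (d - (t + 1)). f = F * g"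
    by (auto simp: multiples_def split: if_splits)
qed

text \<open>
  If \<open>C\<close> passes through \<open>X\<close> then \<open>C\<^sup>2\<close> is singular at \<open>X\<close>, so its products with the lines
  through \<open>P\<close> are divisible by \<open>F\<close>; two different lines through \<open>P\<close> show that \<open>F\<close> divides \<open>C\<^sup>2\<close>.
\<close>

lemma F_divides_square:
  assumes C: "C \<in> forms c" "C \<noteq> 0" "\<And>x. x \<in> X \<Longrightarrow> eval_at C x = 0" and c: "c < t"
  shows "t + 1 \<le> 2 * c" "\<exists>B\<in>forms (2 * c - (t + 1)). C * C = F * B"
proof -
  obtain a b where ab: "dot a P = 0" "dot b P = 0" "cross a b \<noteq> 0"
    using two_lines_through_point[OF P] by blast
  then have ab0: "a \<noteq> 0" "b \<noteq> 0" by auto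
  have CC: "C * C \<in> forms (2 * c)" using forms_mult[OF C(1) C(1)] by (simp add: mult_2)
  have *: "t + 1 \<le> 2 * c + 1 \<and> (\<exists>g\<in>forms (2 * c - t). lin e * (C * C) = F * g)"
    if "dot e P = 0" "e \<noteq> 0" for e
  proof -
    have m: "lin e * (C * C) \<in> forms (2 * c + 1)" using forms_mult[OF lin_forms(1) CC] by simp
    have s: "singular_at (lin e * (C * C)) x" if "x \<in> X" for x
      using C(3)[OF that] by (intro singular_at_mult singular_at_product)
    have z: "eval_at (lin e * (C * C)) P = 0" using that by simp
    have n: "lin e * (C * C) \<noteq> 0" using that C(2) by simp
    have l: "2 * c + 1 < 2 * t" using c by simp
    from system_multiple[OF m l s z n] show ?thesis by simp
  qed
  obtain u where u: "u \<in> forms (2 * c - t)" "lin a * (C * C) = F * u" using *[OF ab(1) ab0(1)] by blast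
  obtain v where v: "v \<in> forms (2 * c - t)" "lin b * (C * C) = F * v" using *[OF ab(2) ab0(2)] by blast
  have "F * (lin b * u) = lin b * (lin a * (C * C))" unfolding u(2) by (rule mult.left_commute)
  also have "\<dots> = lin a * (F * v)" unfolding v(2)[symmetric] by (rule mult.left_commute)
  also have "\<dots> = F * (lin a * v)" by (rule mult.left_commute)
  finally have "lin b * u = lin a * v" using F(2) by simp
  then have "u \<in> multiples (lin a) 1 (2 * c - t)" by (rule lin_prime[OF u(1) ab(3)])
  moreover have "u \<noteq> 0" using u(2) C(2) ab0 by auto
  ultimately obtain B where B: "1 \<le> 2 * c - t" "B \<in> forms (2 * c - t - 1)" "u = lin a * B"
    by (auto simp: multiples_def split: if_splits)
  then show "t + 1 \<le> 2 * c" by simp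
  have "lin a * (C * C) = lin a * (F * B)" using u(2) B(3) by (simp add: mult_ac)
  then have "C * C = F * B" using ab0 by simp
  then show "\<exists>B\<in>forms (2 * c - (t + 1)). C * C = F * B" using B(2) by auto
qed

text \<open>
  Write \<open>C\<^sup>2 = F B\<close>. If \<open>C E = F \<partial>B\<close> then \<open>E\<close> vanishes at the points of \<open>X\<close>: on the line through
  such a point in the direction of the derivative, let \<open>m \<ge> 2\<close>, \<open>\<beta>\<close> and \<open>\<gamma>\<close> be the orders of \<open>F\<close>,
  \<open>B\<close> and \<open>C\<close>. If \<open>E\<close> did not vanish, \<open>2 \<gamma> = m + \<beta>\<close> and \<open>\<gamma> = m + (\<beta> - 1)\<close> would give \<open>m + \<beta> = 2\<close>
  although \<open>\<beta> = 2 \<gamma> - m \<ge> m\<close>.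
\<close>

lemma cofactor_vanishes:
  assumes CB: "C * C = F * B" and CE: "C * E = F * dderiv w B" and x: "x \<in> X"
    and B: "B \<in> forms e" and w: "eval_at F w \<noteq> 0" "eval_at B w \<noteq> 0"
  shows "eval_at E x = 0"
proof (rule ccontr)
  assume Ex: "eval_at E x \<noteq> 0"
  let ?r = "restrict_line x w" and ?o = "order (0 :: 'k)"
  have F0: "?r F \<noteq> 0" using coeff_restrict_line_forms(1)[OF F(1), of x w] w by auto
  have B0: "?r B \<noteq> 0" using coeff_restrict_line_forms(1)[OF B, of x w] w by auto
  have sq: "?r C * ?r C = ?r F * ?r B" using arg_cong[OF CB, of ?r] by simp
  then have C0: "?r C \<noteq> 0" using F0 B0 by auto
  have pE: "?r C * ?r E = ?r F * pderiv (?r B)"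
    using arg_cong[OF CE, of ?r] by (simp add: pderiv_restrict_line)
  have "poly (?r E) 0 \<noteq> 0" using Ex by (simp add: poly_restrict_line)
  then have E: "?r E \<noteq> 0" "?o (?r E) = 0" by (auto simp: order_root)
  then have dB: "pderiv (?r B) \<noteq> 0" using pE C0 by auto
  have o1: "?o (?r C) + ?o (?r C) = ?o (?r F) + ?o (?r B)"
    using arg_cong[OF sq, of ?o] C0 F0 B0 by (simp add: order_mult)
  have o2: "?o (?r C) = ?o (?r F) + ?o (pderiv (?r B))"
    using arg_cong[OF pE, of ?o] C0 F0 E dB by (simp add: order_mult)
  have F1: "poly (?r F) 0 = 0" "poly (pderiv (?r F)) 0 = 0"
    using F_singular[OF x] by (simp_all add: pderiv_restrict_line poly_restrict_line singular_at_def)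
  have dF: "pderiv (?r F) \<noteq> 0"
  proof
    assume "pderiv (?r F) = 0"
    then obtain c where "?r F = [:c:]" by (metis pderiv_eq_0_iff degree_eq_zeroE)
    then show False using F1 F0 by simp
  qed
  have "?o (?r F) \<noteq> 0" "?o (pderiv (?r F)) \<noteq> 0"
    using F1 F0 dF by (auto simp: order_root)
  then have m: "?o (?r F) \<ge> 2" using order_pderiv[OF F0, of 0] F1(1) by simp
  then have "?o (?r B) \<noteq> 0" using o1 o2 by simp
  then have "poly (?r B) 0 = 0" by (auto simp: order_root)
  then have "?o (?r B) = Suc (?o (pderiv (?r B)))" using order_pderiv[OF B0, of 0] by simp
  then show False using o1 o2 m by simp
qed

text \<open>
  Let \<open>C\<close> be a curve of minimal degree through \<open>X\<close> and \<open>C\<^sup>2 = F B\<close>. The products \<open>C \<partial>F\<close> are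
  singular at \<open>X\<close>, hence \<open>C \<partial>F = F A\<close>, and \<open>E = 2 \<partial>C - A\<close> satisfies \<open>C E = F \<partial>B\<close>. So \<open>E\<close> passes
  through \<open>X\<close> by the preceding lemma, first for general directions and, by linearity, for all.
  Its degree is smaller than that of \<open>C\<close>, so \<open>E\<close> and \<open>\<partial>B\<close> are zero and \<open>B\<close> is a constant.
\<close>

lemma minimal_curve_square:
  assumes C: "C \<in> forms c" "C \<noteq> 0" "\<And>x. x \<in> X \<Longrightarrow> eval_at C x = 0" and c: "c < t"
    and min: "\<And>e g. e < c \<Longrightarrow> g \<in> forms e \<Longrightarrow> (\<And>x. x \<in> X \<Longrightarrow> eval_at g x = 0) \<Longrightarrow> g = 0"
  shows "2 * c = t + 1" "\<exists>\<beta>. \<beta> \<noteq> 0 \<and> C * C = F * mconst \<beta>"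
proof -
  obtain B where B: "B \<in> forms (2 * c - (t + 1))" "C * C = F * B" and tc: "t + 1 \<le> 2 * c"
    using F_divides_square[OF C c] by blast
  have B0: "B \<noteq> 0" using B(2) C(2) by auto
  have "eval_at C P = 0" using arg_cong[OF B(2), of "\<lambda>f. eval_at f P"] F_P by simp
  have "\<exists>A. A \<in> forms (c - 1) \<and> C * dderiv w F = F * A" for w
  proof (cases "C * dderiv w F = 0")
    case True
    then show ?thesis by (intro exI[of _ 0]) simp
  next
    case False
    have f: "C * dderiv w F \<in> forms (c + t)" using forms_mult[OF C(1) dderiv_forms[OF F(1)]] by simp
    have s: "singular_at (C * dderiv w F) x" if "x \<in> X" for x
      using C(3)[OF that] F_singular[OF that] by (intro singular_at_product) (auto simp: singular_at_def)
    have l: "c + t < 2 * t" using c by simp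
    have z: "eval_at (C * dderiv w F) P = 0" using \<open>eval_at C P = 0\<close> by simp
    from system_multiple(2)[OF f l s z False] show ?thesis by auto
  qed
  then have "\<forall>w. \<exists>A. A \<in> forms (c - 1) \<and> C * dderiv w F = F * A" ..
  from choice[OF this] obtain A where "\<forall>w. A w \<in> forms (c - 1) \<and> C * dderiv w F = F * A w" ..
  then have A: "\<And>w. A w \<in> forms (c - 1)" "\<And>w. C * dderiv w F = F * A w" by simp_all
  define E where "E w = 2 * dderiv w C - A w" for w
  have Ef: "E w \<in> forms (c - 1)" for w
  proof -
    have "dderiv w C + dderiv w C - A w \<in> forms (c - 1)"
      by (intro forms_diff forms_add dderiv_forms[OF C(1)] A(1))
    moreover have "E w = dderiv w C + dderiv w C - A w" unfolding E_def mult_2 ..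
    ultimately show ?thesis by (simp only:)
  qed
  have CE: "C * E w = F * dderiv w B" for w
  proof -
    have "F * (C * A w) = C * (C * dderiv w F)" by (simp add: A(2) mult_ac)
    also have "\<dots> = C * C * dderiv w F" by (simp only: mult.assoc)
    also have "\<dots> = F * (B * dderiv w F)" unfolding B(2) by (simp only: mult.assoc)
    finally have CA: "C * A w = B * dderiv w F" using F(2) by simp
    have "C * E w = dderiv w (C * C) - C * A w" by (simp add: E_def algebra_simps)
    also have "\<dots> = dderiv w (F * B) - B * dderiv w F" by (simp only: B(2) CA)
    finally show ?thesis by (simp add: algebra_simps)
  qed
  have Ex: "eval_at (E w) x = 0" if x: "x \<in> X" for w x
  proof -
    (* The value at x is linear in the direction, so it is zero if it is zero for all directions
       in which neither F nor B vanishes. *)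
    define \<epsilon> where "\<epsilon> = (\<chi> i. eval_at (E (axis i 1)) x)"
    have E\<epsilon>: "eval_at (E w) x = dot \<epsilon> w" for w
    proof -
      have "C * E w = F * (\<Sum>i\<in>UNIV. mconst (w $ i) * dderiv (axis i 1) B)"
        using CE[of w] dderiv_axis_expansion[of w B] by simp
      also have "\<dots> = (\<Sum>i\<in>UNIV. mconst (w $ i) * (F * dderiv (axis i 1) B))"
        by (simp add: sum_distrib_left mult.left_commute)
      also have "\<dots> = C * (\<Sum>i\<in>UNIV. mconst (w $ i) * E (axis i 1))"
        by (simp add: sum_distrib_left mult.left_commute flip: CE)
      finally have "E w = (\<Sum>i\<in>UNIV. mconst (w $ i) * E (axis i 1))" using C(2) by simp
      then show ?thesis by (simp add: \<epsilon>_def dot_def mult.commute)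
    qed
    have "\<epsilon> = 0"
    proof (rule ccontr)
      assume "\<epsilon> \<noteq> 0"
      then have "lin \<epsilon> * (F * B) \<noteq> 0" using F(2) B0 by simp
      moreover have "lin \<epsilon> * (F * B) \<in> forms (1 + (t + 1 + (2 * c - (t + 1))))"
        by (intro forms_mult lin_forms F B)
      ultimately have "\<exists>v. eval_at (lin \<epsilon> * (F * B)) v \<noteq> 0"
        using forms_eq_0_if_eval_0 by metis
      then obtain v where v: "eval_at (lin \<epsilon> * (F * B)) v \<noteq> 0" ..
      then have "eval_at (E v) x \<noteq> 0" "eval_at F v \<noteq> 0" "eval_at B v \<noteq> 0"
        unfolding E\<epsilon> by simp_all
      then show False using cofactor_vanishes[OF B(2) CE[of v] x B(1)] by simp
    qed
    then show ?thesis using E\<epsilon> by simp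
  qed
  have "c > 0" using tc by simp
  then have "E w = 0" for w using min[OF _ Ef] Ex by simp
  then have dB: "dderiv w B = 0" for w using CE[of w] F(2) by simp
  have "2 * c - (t + 1) = 0"
  proof (rule ccontr)
    assume "2 * c - (t + 1) \<noteq> 0"
    then have "B = 0" by (intro forms_eq_0_if_dderiv_0[OF B(1) _ dB]) simp
    with B0 show False by contradiction
  qed
  then show "2 * c = t + 1" using tc by simp
  obtain \<beta> where "B = mconst \<beta>" using forms_0_const B(1) \<open>2 * c - (t + 1) = 0\<close> by metis
  then show "\<exists>\<beta>. \<beta> \<noteq> 0 \<and> C * C = F * mconst \<beta>" using B(2) B0 by auto
qed

text \<open>
  If \<open>F\<close> is proportional to \<open>C\<^sup>2\<close> for a curve \<open>C\<close> of degree \<open>c\<close> through \<open>X\<close>, then a form \<open>h\<close> of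
  degree \<open>2 * t - 1 - c\<close> through \<open>X\<close> is a multiple of \<open>C\<close>, since \<open>C h\<close> is a multiple of \<open>F\<close>. For
  \<open>t = 2 * c - 1\<close> the multiples of \<open>C\<close> have larger codimension in the forms of this degree than
  the number \<open>c * (2 * c - 1)\<close> of points of \<open>X\<close>.
\<close>

lemma no_curve_of_smaller_degree:
  assumes t3: "t \<ge> 3" and g: "g \<in> forms (t - 1)" "\<And>x. x \<in> X \<Longrightarrow> eval_at g x = 0"
  shows "g = 0"
proof (rule ccontr)
  assume "g \<noteq> 0"
  let ?Q = "\<lambda>c. \<exists>C\<in>forms c. C \<noteq> 0 \<and> (\<forall>x\<in>X. eval_at C x = 0)"
  define c where "c = (LEAST c. ?Q c)"
  have Q: "?Q (t - 1)" using g \<open>g \<noteq> 0\<close> by blast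
  have "?Q c" unfolding c_def by (rule LeastI[of ?Q, OF Q])
  have "c \<le> t - 1" unfolding c_def by (rule Least_le[of ?Q, OF Q])
  then have c: "c < t" using t3 by simp
  have min: "h = 0" if "e < c" "h \<in> forms e" "\<And>x. x \<in> X \<Longrightarrow> eval_at h x = 0" for e h
    using not_less_Least[of e ?Q] that unfolding c_def by blast
  obtain C where C: "C \<in> forms c" "C \<noteq> 0" "\<And>x. x \<in> X \<Longrightarrow> eval_at C x = 0" using \<open>?Q c\<close> by blast
  have tc: "2 * c = t + 1"
    by (rule minimal_curve_square(1)[of C]) (use C c min in auto)
  have "\<exists>\<beta>. \<beta> \<noteq> 0 \<and> C * C = F * mconst \<beta>"
    by (rule minimal_curve_square(2)[of C c]) (use C c min in auto)
  then obtain \<beta> where \<beta>: "\<beta> \<noteq> 0" "C * C = F * mconst \<beta>" by blast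
  let ?e = "2 * t - 1 - c"
  let ?V = "{h \<in> forms ?e. \<forall>x\<in>X. eval_at h x = 0}"
  have V: "mpoly3.subspace ?V"
    by (rule mpoly3.subspaceI) (auto simp: poly_scale_mconst intro: forms_add)
  have "?V \<subseteq> multiples C c ?e"
  proof
    fix h assume h: "h \<in> ?V"
    show "h \<in> multiples C c ?e"
    proof (cases "h = 0")
      case False
      have P0: "eval_at C P = 0" using arg_cong[OF \<beta>(2), of "\<lambda>f. eval_at f P"] F_P by simp
      have m: "C * h \<in> forms (2 * t - 1)"
        using forms_mult[OF C(1), of h ?e] h c by simp
      have l: "2 * t - 1 < 2 * t" using t3 by simp
      have s: "singular_at (C * h) x" if "x \<in> X" for x
        using C(3)[OF that] h that by (intro singular_at_product) auto
      have z: "eval_at (C * h) P = 0" using P0 by simp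
      have "C * h \<noteq> 0" using C(2) False by simp
      from system_multiple(2)[OF m l s z this]
      obtain u where u: "u \<in> forms (2 * t - 1 - (t + 1))" "C * h = F * u" by blast
      have "C * (mconst \<beta> * h) = mconst \<beta> * (F * u)" unfolding u(2)[symmetric] by (rule mult.left_commute)
      also have "\<dots> = F * mconst \<beta> * u" by (simp only: ac_simps)
      also have "\<dots> = C * (C * u)" by (simp add: \<beta>(2)[symmetric] mult.assoc)
      finally have "mconst \<beta> * h = C * u" using C(2) by simp
      then have "mconst (1 / \<beta>) * (mconst \<beta> * h) = C * (mconst (1 / \<beta>) * u)"
        by (simp add: mult.left_commute)
      moreover have "mconst (1 / \<beta>) * (mconst \<beta> * h) = h"
        using \<beta>(1) mconst_simps(6)[of "1 / \<beta>" \<beta>] by (simp flip: mult.assoc)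
      moreover have "C * (mconst (1 / \<beta>) * u) \<in> multiples C c (c + (2 * t - 1 - (t + 1)))"
        by (intro multiplesI forms_mconst_mult u)
      moreover have "c + (2 * t - 1 - (t + 1)) = ?e" using tc t3 by simp
      ultimately show ?thesis by simp
    qed simp
  qed
  then have "mpoly3.dim ?V \<le> mpoly3.dim (multiples C c ?e)"
    by (intro dim_subset_forms(1)[OF _ multiples_subset_forms[OF C(1)] V subspace_multiples])
  moreover have "mpoly3.dim (forms ?e :: 'k mpoly3 set) \<le> mpoly3.dim ?V + card X"
    by (rule forms_conditions_le[OF finite_X, of "\<lambda>x f. eval_at f x"]) simp_all
  ultimately have le: "(?e + 2) choose 2 \<le> ((?e + 2 - c) choose 2) + ((t + 1) choose 2)"
    unfolding dim_forms dim_multiples[OF C(2)] card_X by linarith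
  have "2 \<le> c" using tc t3 by simp
  then obtain k where k: "c = 2 + k" by (rule less_eqE)
  have "t = 2 * k + 3" using tc k by simp
  then have "(3 * k + 5) choose 2 \<le> ((2 * k + 3) choose 2) + ((2 * k + 4) choose 2)"
    using le k by (simp add: numeral_eq_Suc)
  then show False
    using two_choose_two[of "3 * k + 4"] two_choose_two[of "2 * k + 2"] two_choose_two[of "2 * k + 3"]
    by (simp add: algebra_simps numeral_eq_Suc)
qed

text \<open>
  \<open>F\<close> has no double line: for \<open>F = \<ell>\<^sup>2 g\<close> the forms \<open>\<ell> \<partial>g\<close> of degree \<open>t - 1\<close> pass through \<open>X\<close>.
\<close>

lemma no_double_line:
  assumes t3: "t \<ge> 3" and g: "g \<in> forms (t - 1)" "F = lin a * (lin a * g)"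
  shows False
proof -
  have a: "a \<noteq> 0" "g \<noteq> 0" using g F(2) by auto
  have "dderiv w g = 0" for w
  proof -
    have "lin a * dderiv w g \<in> forms (t - 1)"
    proof -
      have "lin a * dderiv w g \<in> forms (1 + (t - 1 - 1))"
        by (intro forms_mult lin_forms dderiv_forms g(1))
      moreover have "1 + (t - 1 - 1) = t - 1" using t3 by simp
      ultimately show ?thesis by (simp only:)
    qed
    moreover have "eval_at (lin a * dderiv w g) x = 0" if "x \<in> X" for x
    proof (cases "dot a x = 0")
      case False
      then have "singular_at g x"
        using F_singular[OF that] unfolding g(2) by (auto dest!: singular_at_cancel)
      then show ?thesis by (simp add: singular_at_def)
    qed simp
    ultimately have "lin a * dderiv w g = 0" by (rule no_curve_of_smaller_degree[OF t3])
    then show ?thesis using a by simp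
  qed
  then have "g = 0" using forms_eq_0_if_dderiv_0[OF g(1)] t3 by simp
  then show False using a by simp
qed

end

section \<open>Splitting off lines\<close>

text \<open>
  The conditions have the multiples of \<open>F\<close> in their kernel, whose codimension in degree
  \<open>2 * t - 1\<close> is \<open>3 * card X\<close>, one less than the number of conditions.
\<close>

lemma relation_exists:
  fixes X :: "('k::field_char_0 ^ 3) set"
  assumes X: "finite X" "card X = (t + 1) choose 2" and t: "t \<ge> 1"
    and F: "F \<in> forms (t + 1)" "F \<noteq> 0" "\<And>x. x \<in> X \<Longrightarrow> singular_at F x" "eval_at F P = 0"
  shows "\<exists>w \<mu>. (\<forall>f\<in>forms (2 * t - 1). (\<Sum>x\<in>X. eval_at (dderiv (w x) f) x) + \<mu> * eval_at f P = 0) \<and>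
    \<not> ((\<forall>x\<in>X. w x = 0) \<and> \<mu> = 0)"
proof (rule ccontr)
  assume no: "\<not> ?thesis"
  let ?d = "2 * t - 1"
  have "multiples F (t + 1) ?d \<subseteq> double_system X P ?d"
    using multiples_subset_forms[OF F(1), of ?d] F(3,4) unfolding double_system_def
    by (auto simp: multiples_def split: if_splits intro: singular_at_mult)
  then have "mpoly3.dim (multiples F (t + 1) ?d) \<le> mpoly3.dim (double_system X P ?d)"
    by (rule dim_subset_forms(1)[OF _ double_system_subset subspace_multiples subspace_double_system])
  moreover have "mpoly3.dim (forms ?d :: 'k mpoly3 set) = mpoly3.dim (double_system X P ?d) + (3 * card X + 1)"
  proof (rule dim_forms_if_no_relation[OF X(1)])
    show "?d > 0" using t by simp
    show "(\<forall>x\<in>X. w x = 0) \<and> \<mu> = 0"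
      if "\<forall>f\<in>forms ?d. (\<Sum>x\<in>X. eval_at (dderiv (w x) f) x) + \<mu> * eval_at f P = 0" for w \<mu>
      using no that by blast
  qed
  ultimately have le: "((?d + 2 - (t + 1)) choose 2) + (3 * ((t + 1) choose 2) + 1) \<le> (?d + 2) choose 2"
    unfolding dim_forms dim_multiples[OF F(2)] X(2) by linarith
  obtain n where n: "t = Suc n" using t by (cases t) auto
  show False
    using le two_choose_two[of "2 * n + 2"] two_choose_two[of n] two_choose_two[of "Suc n"]
    unfolding n by (simp add: algebra_simps)
qed

text \<open>
  There are as many points as the dimension of the forms, so some nonzero form vanishes at all
  points except \<open>x\<close>; by assumption it does not vanish at \<open>x\<close>.
\<close>

lemma interpolation:
  fixes X :: "('k::field_char_0 ^ 3) set"
  assumes X: "finite X" "card X = (d + 2) choose 2"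
    and min: "\<And>g. g \<in> forms d \<Longrightarrow> (\<And>x. x \<in> X \<Longrightarrow> eval_at g x = 0) \<Longrightarrow> g = 0"
  shows "\<exists>b. \<forall>x\<in>X. b x \<in> forms d \<and> eval_at (b x) x = 1 \<and> (\<forall>y\<in>X - {x}. eval_at (b x) y = 0)"
proof -
  have "\<exists>b. b \<in> forms d \<and> eval_at b x = 1 \<and> (\<forall>y\<in>X - {x}. eval_at b y = 0)" if x: "x \<in> X" for x
  proof -
    let ?V = "{h \<in> forms d. \<forall>y\<in>X - {x}. eval_at h y = 0}"
    have fin: "finite (X - {x})" using X(1) by simp
    have "mpoly3.dim (forms d :: 'k mpoly3 set) \<le> mpoly3.dim ?V + card (X - {x})"
      by (rule forms_conditions_le[OF fin, of "\<lambda>x f. eval_at f x"]) simp_all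
    moreover have "card (X - {x}) < (d + 2) choose 2" using card_Diff1_less[OF X(1) x] X(2) by simp
    ultimately have "mpoly3.dim ?V > 0" unfolding dim_forms by linarith
    then obtain h where h: "h \<in> ?V" "h \<noteq> 0" using nonzero_if_dim_pos by blast
    have hx: "eval_at h x \<noteq> 0"
    proof
      assume "eval_at h x = 0"
      then have "eval_at h y = 0" if "y \<in> X" for y using h(1) that by (cases "y = x") auto
      then have "h = 0" using h(1) by (intro min) auto
      with h(2) show False by contradiction
    qed
    let ?b = "mconst (1 / eval_at h x) * h"
    have "?b \<in> forms d" using h(1) by (intro forms_mconst_mult) simp
    moreover have "eval_at ?b x = 1" using hx by simp
    moreover have "\<forall>y\<in>X - {x}. eval_at ?b y = 0" using h(1) by simp
    ultimately show ?thesis by blast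
  qed
  then have "\<forall>x\<in>X. \<exists>b. b \<in> forms d \<and> eval_at b x = 1 \<and> (\<forall>y\<in>X - {x}. eval_at b y = 0)" ..
  from bchoice[OF this] show ?thesis .
qed

text \<open>
  The key step. The conditions of double points on \<open>X\<close> and a simple point \<open>P\<close> are dependent in
  degree \<open>2 * t - 1\<close>, because \<open>F\<close> satisfies them. Let \<open>b x\<close> be the form of degree \<open>t - 1\<close> that is
  \<open>1\<close> at \<open>x\<close> and \<open>0\<close> at the rest of \<open>X\<close>. Testing a relation \<open>(w, \<mu>)\<close> on \<open>\<ell> (b x)\<^sup>2\<close> for linear forms
  \<open>\<ell>\<close> shows that \<open>w x = 0\<close> unless \<open>\<mu>\<close> and \<open>b x (P)\<close> are nonzero, and testing it on
  \<open>\<ell> (b x) (b y)\<close> shows that \<open>x\<close>, \<open>y\<close> and \<open>P\<close> are collinear if \<open>b x (P)\<close> and \<open>b y (P)\<close> are both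
  nonzero. So the relation lives on one line through \<open>P\<close>. It involves at least \<open>t\<close> points, because
  some form of degree \<open>2 * t - 1\<close> that is nonzero at \<open>P\<close> is singular at any \<open>t - 1\<close> given points.
\<close>

lemma line_with_many_points:
  fixes X :: "('k::field_char_0 ^ 3) set"
  assumes X: "finite X" "card X = (t + 1) choose 2" and t: "t \<ge> 1"
    and F: "F \<in> forms (t + 1)" "F \<noteq> 0" "\<And>x. x \<in> X \<Longrightarrow> singular_at F x" "eval_at F P = 0"
    and P: "P \<noteq> 0" "\<And>x. x \<in> X \<Longrightarrow> cross P x \<noteq> 0"
    and min: "\<And>g. g \<in> forms (t - 1) \<Longrightarrow> (\<And>x. x \<in> X \<Longrightarrow> eval_at g x = 0) \<Longrightarrow> g = 0"
  shows "\<exists>a. a \<noteq> 0 \<and> dot a P = 0 \<and> t \<le> card {x\<in>X. dot a x = 0}"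
proof -
  obtain w \<mu> where rel: "\<And>f. f \<in> forms (2 * t - 1) \<Longrightarrow>
      (\<Sum>x\<in>X. eval_at (dderiv (w x) f) x) + \<mu> * eval_at f P = 0"
    and nontrivial: "\<not> ((\<forall>x\<in>X. w x = 0) \<and> \<mu> = 0)"
    using relation_exists[OF X t F] by blast
  have "card X = (t - 1 + 2) choose 2" using X(2) t by (simp add: numeral_2_eq_2)
  from interpolation[OF X(1) this min] obtain b where "\<forall>x\<in>X. b x \<in> forms (t - 1) \<and>
      eval_at (b x) x = 1 \<and> (\<forall>y\<in>X - {x}. eval_at (b x) y = 0)" by blast
  note b_all = this
  have b: "b x \<in> forms (t - 1)" "eval_at (b x) x = 1" if "x \<in> X" for x
    using b_all that by auto
  have b0: "eval_at (b x) y = 0" if "x \<in> X" "y \<in> X" "y \<noteq> x" for x y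
    using b_all that by auto
  have test: "lin e * (b x * b y) \<in> forms (2 * t - 1)" if "x \<in> X" "y \<in> X" for e x y
  proof -
    have "lin e * (b x * b y) \<in> forms (1 + ((t - 1) + (t - 1)))"
      by (intro forms_mult lin_forms b that)
    moreover have "1 + ((t - 1) + (t - 1)) = 2 * t - 1" using t by simp
    ultimately show ?thesis by (simp only:)
  qed
  have w0: "w x = 0" if x: "x \<in> X" and z: "\<mu> * eval_at (b x) P = 0" for x
  proof (rule direction_eq_0[of "b x * b x"])
    show "b x * b x \<in> forms ((t - 1) + (t - 1))" by (intro forms_mult b x)
    show "eval_at (b x * b x) x \<noteq> 0" using b x by simp
    fix e
    have "singular_at (lin e * (b x * b x)) y" if "y \<in> X" "y \<noteq> x" for y
      using b0[OF x that] by (intro singular_at_mult singular_at_product)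
    then have "(\<Sum>y\<in>X. eval_at (dderiv (w y) (lin e * (b x * b x))) y) =
        (\<Sum>y\<in>X. if y = x then eval_at (dderiv (w x) (lin e * (b x * b x))) x else 0)"
      by (intro sum.cong) (auto simp: singular_at_def)
    also have "\<dots> = eval_at (dderiv (w x) (lin e * (b x * b x))) x" using x X(1) by simp
    finally show "eval_at (dderiv (w x) (lin e * (b x * b x))) x = 0"
      using rel[OF test[OF x x, of e]] z by auto
  qed
  have collinear: "\<exists>p q. p *s x + q *s y + (\<mu> * (eval_at (b x) P * eval_at (b y) P)) *s P = 0"
    if xy: "x \<in> X" "y \<in> X" "x \<noteq> y" for x y
  proof (intro exI eq_0_if_dot_0)
    fix e
    let ?f = "lin e * (b x * b y)"
    have "singular_at ?f z" if "z \<in> X" "z \<noteq> x" "z \<noteq> y" for z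
      using b0 xy that by (intro singular_at_mult singular_at_product) auto
    then have "(\<Sum>z\<in>X. eval_at (dderiv (w z) ?f) z) = (\<Sum>z\<in>X. (if z = x then eval_at (dderiv (w x) ?f) x else 0) +
        (if z = y then eval_at (dderiv (w y) ?f) y else 0))"
      using xy by (intro sum.cong) (auto simp: singular_at_def)
    also have "\<dots> = eval_at (dderiv (w x) ?f) x + eval_at (dderiv (w y) ?f) y"
      using xy X(1) by (simp add: sum.distrib)
    also have "\<dots> = eval_at (dderiv (w x) (b y)) x * dot e x + eval_at (dderiv (w y) (b x)) y * dot e y"
      using b[of x] b[of y] b0[of x y] b0[of y x] xy by (simp add: mult.commute)
    finally show "dot e (eval_at (dderiv (w x) (b y)) x *s x + eval_at (dderiv (w y) (b x)) y *s y +
        (\<mu> * (eval_at (b x) P * eval_at (b y) P)) *s P) = 0"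
      using rel[OF test[OF xy(1,2), of e]] by (simp add: mult_ac)
  qed
  have \<mu>: "\<mu> \<noteq> 0" using nontrivial w0 by auto
  let ?U = "{x\<in>X. eval_at (b x) P \<noteq> 0}"
  have wU: "w x = 0" if "x \<in> X" "x \<notin> ?U" for x using w0 that by auto
  obtain k where k: "dot k P = 1" using functional_one[OF P(1)] by blast
  have "\<exists>l. \<forall>x\<in>X. dot (l x) x = 0 \<and> dot (l x) P \<noteq> 0"
  proof (rule bchoice, rule ballI)
    fix x assume "x \<in> X"
    then have "cross x P \<noteq> 0" using P(2) cross_commute[of x P] by auto
    then show "\<exists>e. dot e x = 0 \<and> dot e P \<noteq> 0" by (rule separating_functional)
  qed
  then obtain l where l: "\<And>x. x \<in> X \<Longrightarrow> dot (l x) x = 0" "\<And>x. x \<in> X \<Longrightarrow> dot (l x) P \<noteq> 0" by blast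
  have cardU: "t \<le> card ?U"
  proof (rule ccontr)
    assume "\<not> ?thesis"
    then have le: "2 * card ?U \<le> 2 * t - 1" by simp
    let ?p = "\<Prod>x\<in>?U. lin (l x)"
    define f where "f = ?p * ?p * lin k ^ (2 * t - 1 - 2 * card ?U)"
    have "f \<in> forms (card ?U + card ?U + (2 * t - 1 - 2 * card ?U) * 1)"
      unfolding f_def using X(1) by (intro forms_mult forms_power lin_forms prod_lin_forms) auto
    moreover have "card ?U + card ?U + (2 * t - 1 - 2 * card ?U) * 1 = 2 * t - 1" using le by simp
    ultimately have f: "f \<in> forms (2 * t - 1)" by (simp only:)
    have "eval_at (dderiv (w x) f) x = 0" if x: "x \<in> X" for x
    proof (cases "x \<in> ?U")
      case True
      then have "eval_at ?p x = 0" using l(1)[OF x] X(1) by auto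
      then have "singular_at f x" unfolding f_def by (intro singular_at_mult singular_at_product)
      then show ?thesis by (simp add: singular_at_def)
    next
      case False
      then show ?thesis using wU[OF x] by simp
    qed
    then have "\<mu> * eval_at f P = 0" using rel[OF f] by simp
    moreover have "eval_at f P \<noteq> 0" unfolding f_def using l(2) k X(1) by simp
    ultimately show False using \<mu> by simp
  qed
  then have "0 < card ?U" using t by linarith
  then have "?U \<noteq> {}" unfolding card_gt_0_iff by (rule conjunct1)
  then obtain u where u: "u \<in> X" "eval_at (b u) P \<noteq> 0" by blast
  let ?a = "cross P u"
  have "?U \<subseteq> {x\<in>X. dot ?a x = 0}"
  proof
    fix y assume y: "y \<in> ?U"
    have "dot ?a y = 0"
    proof (cases "y = u")
      case False
      let ?r = "\<mu> * (eval_at (b u) P * eval_at (b y) P)"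
      have r: "?r \<noteq> 0" using \<mu> u y by simp
      have "y \<in> X" "u \<noteq> y" using y False by auto
      from collinear[OF u(1) this] obtain p q where pq: "p *s u + q *s y + ?r *s P = 0" by (elim exE)
      have "q * dot ?a y = dot ?a (p *s u + q *s y + ?r *s P)" by simp
      then have "q * dot ?a y = 0" unfolding pq by simp
      moreover have "q \<noteq> 0"
      proof
        assume "q = 0"
        then have "p *s u + ?r *s P = 0" using pq by simp
        then have "cross P (p *s u + ?r *s P) = 0" by simp
        then have "p = 0" using P(2)[OF u(1)] by simp
        then show False using \<open>p *s u + ?r *s P = 0\<close> r P(1) by simp
      qed
      ultimately show ?thesis by simp
    qed simp
    then show "y \<in> {x\<in>X. dot ?a x = 0}" using y by simp
  qed
  then have "card ?U \<le> card {x\<in>X. dot ?a x = 0}" using X(1) by (intro card_mono) auto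
  moreover have "?a \<noteq> 0" using P(2)[OF u(1)] .
  ultimately show ?thesis using cardU by (intro exI[of _ ?a]) simp
qed

lemma singular_cofactor_vanishes:
  assumes "singular_at (lin a * G) y" "dot a y = 0" "a \<noteq> 0"
  shows "eval_at G y = 0"
proof -
  obtain k where "dot k a = 1" using functional_one[OF assms(3)] by blast
  moreover have "eval_at (dderiv k (lin a * G)) y = 0" using assms(1) by (simp add: singular_at_def)
  ultimately show ?thesis using assms(2) by (simp add: dot_commute)
qed

text \<open>
  Splitting off such a line reproduces the situation for \<open>t - 1\<close>: exactly \<open>t\<close> points are removed,
  since more would make the line a double component, and any of them can take the role of \<open>P\<close>.
\<close>

lemma product_of_lines:
  fixes X :: "('k::field_char_0 ^ 3) set"
  assumes "finite X" "card X = (t + 1) choose 2" "distinct_points X"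
    and "F \<in> forms (t + 1)" "F \<noteq> 0" "\<And>x. x \<in> X \<Longrightarrow> singular_at F x" "eval_at F P = 0"
    and "P \<noteq> 0" "\<And>x. x \<in> X \<Longrightarrow> cross P x \<noteq> 0"
    and "\<And>g. t \<ge> 1 \<Longrightarrow> g \<in> forms (t - 1) \<Longrightarrow> (\<And>x. x \<in> X \<Longrightarrow> eval_at g x = 0) \<Longrightarrow> g = 0"
    and "\<And>a g. t \<ge> 1 \<Longrightarrow> g \<in> forms (t - 1) \<Longrightarrow> F \<noteq> lin a * (lin a * g)"
  shows "\<exists>a. F = (\<Prod>i<t + 1. lin (a i))"
  using assms
proof (induction t arbitrary: X F P)
  case 0
  then have "F \<in> forms 1" by simp
  from forms_1_lin[OF this] obtain a where "F = lin a" ..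
  then show ?case by (intro exI[of _ "\<lambda>_. a"]) simp
next
  case (Suc n)
  let ?t = "Suc n"
  have min: "g = 0" if "g \<in> forms (?t - 1)" "\<And>x. x \<in> X \<Longrightarrow> eval_at g x = 0" for g
    using Suc.prems(10)[OF _ that] by simp
  have "\<exists>a. a \<noteq> 0 \<and> dot a P = 0 \<and> ?t \<le> card {x\<in>X. dot a x = 0}"
    by (rule line_with_many_points[OF Suc.prems(1,2) _ Suc.prems(4,5)]) (simp_all add: Suc.prems min)
  then obtain a where a: "a \<noteq> 0" "dot a P = 0" "?t \<le> card {x\<in>X. dot a x = 0}" by blast
  let ?Y = "{x\<in>X. dot a x = 0}"
  have Y: "finite ?Y" using Suc.prems(1) by simp
  have dY: "distinct_points ?Y" by (rule distinct_points_subset[OF Suc.prems(3)]) auto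
  (* The point P counts as a further zero: for t = 1 the double point alone does not suffice. *)
  have PX: "P \<notin> X" using Suc.prems(9) by force
  have "F \<in> multiples (lin a) 1 (?t + 1)"
  proof (rule line_divides[of ?Y "{P}"])
    show "distinct_points (?Y \<union> {P})"
      unfolding distinct_points_def
    proof (intro conjI ballI impI)
      fix x z assume "x \<in> ?Y \<union> {P}" "z \<in> ?Y \<union> {P}" "x \<noteq> z"
      then consider "x \<in> X" "z \<in> X" "x \<noteq> z" | "x = P" "z \<in> X" | "z = P" "x \<in> X" by auto
      then show "cross x z \<noteq> 0"
        using Suc.prems(3) Suc.prems(9) cross_commute[of x z] unfolding distinct_points_def
        by cases auto
    qed (use Suc.prems(3,8) in \<open>auto simp: distinct_points_def\<close>)
  qed (use Suc.prems(4,6,7) a Y PX in \<open>auto simp: singular_at_def\<close>)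
  then have "F \<in> multiples (lin a) 1 (Suc ?t)" by simp
  then obtain G where G: "G \<in> forms ?t" "F = lin a * G" by (rule multiples_linE)
  have G0: "G \<noteq> 0" using Suc.prems(5) G by auto
  have GY: "eval_at G y = 0" if y: "y \<in> ?Y" for y
    using singular_cofactor_vanishes[of a G y] Suc.prems(6)[of y] G(2) a(1) y by simp
  have "card ?Y \<le> ?t"
  proof (rule ccontr)
    assume "\<not> ?thesis"
    then have "G \<in> multiples (lin a) 1 ?t"
      using G(1) GY a dY Y by (intro line_divides[of "{}" ?Y]) auto
    then obtain g where "g \<in> forms n" "G = lin a * g" by (rule multiples_linE)
    then show False using Suc.prems(11)[of g a] G(2) by simp
  qed
  then have cY: "card ?Y = ?t" using a(3) by simp
  let ?X = "X - ?Y"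
  have "card ?X = card X - card ?Y" using Y by (intro card_Diff_subset) auto
  then have cX: "card ?X = (n + 1) choose 2"
    using cY Suc.prems(2) by (simp add: numeral_2_eq_2)
  have "?Y \<noteq> {}" using cY by (metis card.empty nat.distinct(1))
  then obtain y where y: "y \<in> ?Y" by blast
  have dist: "cross x z \<noteq> 0" "x \<noteq> 0" if "x \<in> X" "z \<in> X" "x \<noteq> z" for x z
    using Suc.prems(3) that unfolding distinct_points_def by simp_all
  have "\<exists>c. G = (\<Prod>i<n + 1. lin (c i))"
  proof (rule Suc.IH)
    show "finite ?X" "card ?X = (n + 1) choose 2" "G \<in> forms (n + 1)" "G \<noteq> 0" "eval_at G y = 0"
      using Suc.prems(1) cX G G0 GY[OF y] by simp_all
    show "distinct_points ?X" by (rule distinct_points_subset[OF Suc.prems(3)]) auto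
    show "y \<noteq> 0" using Suc.prems(3) y unfolding distinct_points_def by simp
    show "singular_at G x" if "x \<in> ?X" for x
      using Suc.prems(6)[of x] that G(2) singular_at_cancel[of "lin a" G x] by auto
    show "cross y x \<noteq> 0" if "x \<in> ?X" for x
      using that y by (intro dist) auto
    show "g = 0" if "n \<ge> 1" "g \<in> forms (n - 1)" "\<And>x. x \<in> ?X \<Longrightarrow> eval_at g x = 0" for g
    proof -
      have "lin a * g \<in> forms (1 + (n - 1))" by (rule forms_mult[OF lin_forms(1) that(2)])
      then have "lin a * g \<in> forms (?t - 1)" using that(1) by simp
      moreover have "eval_at (lin a * g) x = 0" if "x \<in> X" for x
        using \<open>\<And>x. x \<in> ?X \<Longrightarrow> eval_at g x = 0\<close>[of x] that by auto
      ultimately have "lin a * g = 0" by (rule min)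
      then show ?thesis using a by simp
    qed
    show "G \<noteq> lin c * (lin c * g)" if "n \<ge> 1" "g \<in> forms (n - 1)" for c g
    proof
      assume "G = lin c * (lin c * g)"
      then have "F = lin c * (lin c * (lin a * g))" using G(2) by (simp only: mult.left_commute)
      moreover have "lin a * g \<in> forms (1 + (n - 1))" by (rule forms_mult[OF lin_forms(1) that(2)])
      then have "lin a * g \<in> forms (?t - 1)" using that(1) by simp
      ultimately show False using Suc.prems(11)[of "lin a * g" c] by simp
    qed
  qed
  then obtain c where "G = (\<Prod>i<n + 1. lin (c i))" ..
  moreover have "(\<Prod>i<n + 1. lin (c i)) = (\<Prod>i<n + 1. lin ((c(?t := a)) i))"
    by (intro prod.cong) auto
  ultimately have "F = (\<Prod>i<?t + 1. lin ((c(?t := a)) i))" using G(2) by (simp add: mult.commute)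
  then show ?case by (rule exI[of _ "c(?t := a)"])
qed

section \<open>Star configurations in the projective plane\<close>

definition line :: "'k::field ^ 3 \<Rightarrow> ('k ^ 3) set set" where
  "line a = {p \<in> proj_plane. vanishes_at (lin a) p}"

lemma is_line_iff: "is_line l \<longleftrightarrow> (\<exists>a. a \<noteq> 0 \<and> l = line a)"
proof
  assume "is_line l"
  then obtain f where f: "f \<in> forms 1" "f \<noteq> 0" "l = {p \<in> proj_plane. vanishes_at f p}"
    unfolding is_line_def by blast
  then obtain a where "f = lin a" using forms_1_lin by blast
  then show "\<exists>a. a \<noteq> 0 \<and> l = line a" using f by (auto simp: line_def)
next
  assume "\<exists>a. a \<noteq> 0 \<and> l = line a"
  then obtain a where "a \<noteq> 0" "l = line a" by blast
  then show "is_line l" unfolding is_line_def line_def by (intro bexI[of _ "lin a"]) simp_all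
qed

lemma mem_line_rep: "p \<in> proj_plane \<Longrightarrow> p \<in> line a \<longleftrightarrow> dot a (rep p) = 0"
  by (simp add: line_def vanishes_at_rep[OF lin_forms(1)])

lemma mem_line_point: "v \<noteq> 0 \<Longrightarrow> point v \<in> line a \<longleftrightarrow> dot a v = 0"
  by (simp add: line_def vanishes_at_point[OF lin_forms(1)] point_in_proj_plane)

lemma line_subset: "line a \<subseteq> proj_plane"
  by (auto simp: line_def)

lemma line_scale: "s \<noteq> 0 \<Longrightarrow> line (s *s a) = line a"
  using mem_line_rep[of _ a] mem_line_rep[of _ "s *s a"] line_subset[of a] line_subset[of "s *s a"] by auto

lemma cross_neq_0_if_line_neq:
  assumes "line a \<noteq> line b" "a \<noteq> 0" "b \<noteq> 0"
  shows "cross a b \<noteq> 0"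
proof
  assume "cross a b = 0"
  from cross_eq_0_imp_scale[OF this assms(2)] obtain s where s: "b = s *s a" ..
  then show False using assms line_scale[of s a] by auto
qed

lemma line_neq_if_cross_neq_0:
  assumes "cross a b \<noteq> 0"
  shows "line a \<noteq> line b"
proof -
  obtain v where v: "dot v a = 0" "dot v b \<noteq> 0" using separating_functional[OF assms] by blast
  then have "v \<noteq> 0" by auto
  then have "point v \<in> line a" "point v \<notin> line b" using v by (simp_all add: mem_line_point dot_commute)
  then show ?thesis by auto
qed

lemma lines_meet_once:
  assumes "cross a b \<noteq> 0" "p \<in> line a" "p \<in> line b" "q \<in> line a" "q \<in> line b"
  shows "p = q"
proof (rule ccontr)
  assume "p \<noteq> q"
  have pq: "p \<in> proj_plane" "q \<in> proj_plane" using assms line_subset by auto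
  then have d: "dot a (rep p) = 0" "dot b (rep p) = 0" "dot a (rep q) = 0" "dot b (rep q) = 0"
    using assms mem_line_rep by auto
  from orthogonal_imp_scale_cross[OF d(1,2) assms(1)] obtain s where "rep p = s *s cross a b" ..
  moreover from orthogonal_imp_scale_cross[OF d(3,4) assms(1)] obtain r where "rep q = r *s cross a b" ..
  ultimately have "cross (rep p) (rep q) = 0" by (rule scaled_imp_cross_0)
  with cross_rep_neq_0[OF pq \<open>p \<noteq> q\<close>] show False by contradiction
qed

lemma lines_meet:
  assumes "cross a b \<noteq> 0"
  shows "point (cross a b) \<in> line a" "point (cross a b) \<in> line b"
  using assms by (simp_all add: mem_line_point)

lemma distinct_points_rep:
  assumes "S \<subseteq> proj_plane"
  shows "distinct_points (rep ` S)"
  unfolding distinct_points_def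
proof (intro conjI ballI impI)
  fix x assume "x \<in> rep ` S"
  then obtain p where "p \<in> S" "x = rep p" by auto
  then show "x \<noteq> 0" using rep(1)[of p] assms by auto
next
  fix x y assume "x \<in> rep ` S" "y \<in> rep ` S" "x \<noteq> y"
  then obtain p q where "p \<in> S" "q \<in> S" "x = rep p" "y = rep q" "p \<noteq> q" by auto
  then show "cross x y \<noteq> 0" using cross_rep_neq_0[of p q] assms by auto
qed

lemma inj_on_rep: "S \<subseteq> proj_plane \<Longrightarrow> inj_on rep S"
  by (rule inj_onI) (metis rep(2) subsetD)

text \<open>
  Every point of the configuration on \<open>l\<close> is the intersection of \<open>l\<close> with exactly one of the
  \<open>t\<close> other lines, because no three lines are concurrent.
\<close>

lemma card_points_on_line:
  assumes star: "is_star_configuration (t + 1) L S" and l: "l \<in> L"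
  shows "card {p \<in> S. p \<in> l} = t"
proof -
  have L: "finite L" "card L = t + 1" "\<And>l. l \<in> L \<Longrightarrow> is_line l"
    and conc: "\<And>l m n. l \<in> L \<Longrightarrow> m \<in> L \<Longrightarrow> n \<in> L \<Longrightarrow> l \<noteq> m \<Longrightarrow> l \<noteq> n \<Longrightarrow> m \<noteq> n \<Longrightarrow> l \<inter> m \<inter> n = {}"
    and S: "S = {p. \<exists>l\<in>L. \<exists>m\<in>L. l \<noteq> m \<and> p \<in> l \<inter> m}"
    using star unfolding is_star_configuration_def no_three_concurrent_def by auto
  have ex: "\<exists>p. p \<in> l \<and> p \<in> m" and unique: "\<And>p q. p \<in> l \<Longrightarrow> p \<in> m \<Longrightarrow> q \<in> l \<Longrightarrow> q \<in> m \<Longrightarrow> p = q"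
    if m: "m \<in> L - {l}" for m
  proof -
    have "is_line l" "is_line m" using L(3) l m by auto
    then obtain a b where ab: "a \<noteq> 0" "l = line a" "b \<noteq> 0" "m = line b"
      unfolding is_line_iff by (elim exE conjE)
    then have c: "cross a b \<noteq> 0" using cross_neq_0_if_line_neq m by auto
    show "\<exists>p. p \<in> l \<and> p \<in> m" using lines_meet[OF c] ab by auto
    show "p = q" if "p \<in> l" "p \<in> m" "q \<in> l" "q \<in> m" for p q
      using lines_meet_once[OF c] that ab by simp
  qed
  then have "\<forall>m\<in>L - {l}. \<exists>p. p \<in> l \<and> p \<in> m" by blast
  from bchoice[OF this] obtain \<pi> where \<pi>: "\<And>m. m \<in> L - {l} \<Longrightarrow> \<pi> m \<in> l \<and> \<pi> m \<in> m" by blast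
  have "bij_betw \<pi> (L - {l}) {p \<in> S. p \<in> l}"
    unfolding bij_betw_def
  proof
    show "inj_on \<pi> (L - {l})"
    proof (rule inj_onI, rule ccontr)
      fix m n assume mn: "m \<in> L - {l}" "n \<in> L - {l}" "\<pi> m = \<pi> n" "m \<noteq> n"
      then have "\<pi> m \<in> l \<inter> m \<inter> n" using \<pi>[OF mn(1)] \<pi>[OF mn(2)] by simp
      then show False using conc[of l m n] l mn by auto
    qed
    show "\<pi> ` (L - {l}) = {p \<in> S. p \<in> l}"
    proof
      show "\<pi> ` (L - {l}) \<subseteq> {p \<in> S. p \<in> l}" using \<pi> l unfolding S by auto
      show "{p \<in> S. p \<in> l} \<subseteq> \<pi> ` (L - {l})"
      proof
        fix p assume p: "p \<in> {p \<in> S. p \<in> l}"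
        then obtain m1 m2 where "m1 \<in> L" "m2 \<in> L" "m1 \<noteq> m2" "p \<in> m1" "p \<in> m2" unfolding S by auto
        then obtain m where m: "m \<in> L - {l}" "p \<in> m" by (cases "m1 = l") auto
        then have "p = \<pi> m" using unique[OF m(1)] \<pi>[OF m(1)] p by simp
        then show "p \<in> \<pi> ` (L - {l})" using m by simp
      qed
    qed
  qed
  then have "card {p \<in> S. p \<in> l} = card (L - {l})" by (rule bij_betw_same_card[symmetric])
  then show ?thesis using L l by simp
qed

lemma star_imp_hilbert_function:
  fixes S :: "('k::field_char_0 ^ 3) set set"
  assumes t: "t \<ge> 1" and S: "S \<subseteq> proj_plane" "card S = (t + 1) choose 2"
    and P: "P \<in> proj_plane" "P \<notin> S"
    and star: "is_star_configuration (t + 1) L S" and l0: "l0 \<in> L" "P \<in> l0"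
  shows "hilbert_function (double_points_ideal S \<inter> point_ideal P) d = star_hilbert t d"
proof -
  have L: "finite L" "card L = t + 1" "\<And>l. l \<in> L \<Longrightarrow> is_line l"
    and conc: "\<And>l m n. l \<in> L \<Longrightarrow> m \<in> L \<Longrightarrow> n \<in> L \<Longrightarrow> l \<noteq> m \<Longrightarrow> l \<noteq> n \<Longrightarrow> m \<noteq> n \<Longrightarrow> l \<inter> m \<inter> n = {}"
    and S_eq: "S = {p. \<exists>l\<in>L. \<exists>m\<in>L. l \<noteq> m \<and> p \<in> l \<inter> m}"
    using star unfolding is_star_configuration_def no_three_concurrent_def by auto
  have "card S > 0" using S(2) t by (simp add: zero_less_binomial)
  then have fin: "finite S" using card_gt_0_iff by blast
  have "\<forall>l\<in>L. \<exists>a. a \<noteq> 0 \<and> l = line a" using L(3) is_line_iff by blast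
  from bchoice[OF this] obtain a where a: "\<And>l. l \<in> L \<Longrightarrow> a l \<noteq> 0 \<and> l = line (a l)" by blast
  have mem: "dot (a l) (rep p) = 0 \<longleftrightarrow> p \<in> l" if "l \<in> L" "p \<in> proj_plane" for l p
    using a[OF that(1)] mem_line_rep[OF that(2), of "a l"] by simp
  interpret star t L a "rep ` S"
  proof
    show "finite L" "card L = t + 1" "finite (rep ` S)" "distinct_points (rep ` S)"
      using L fin distinct_points_rep[OF S(1)] by simp_all
    show "cross (a l) (a m) \<noteq> 0" if "l \<in> L" "m \<in> L" "l \<noteq> m" for l m
      using cross_neq_0_if_line_neq[of "a l" "a m"] a[OF that(1)] a[OF that(2)] that(3) by auto
    show "a l \<noteq> 0" if "l \<in> L" for l using a[OF that] by simp
    show "\<exists>l\<in>L. \<exists>m\<in>L. l \<noteq> m \<and> {n \<in> L. dot (a n) x = 0} = {l, m}" if "x \<in> rep ` S" for x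
    proof -
      obtain p where p: "p \<in> S" "x = rep p" using \<open>x \<in> rep ` S\<close> by auto
      then obtain l m where lm: "l \<in> L" "m \<in> L" "l \<noteq> m" "p \<in> l" "p \<in> m" unfolding S_eq by auto
      have pp: "p \<in> proj_plane" using p S(1) by auto
      have "{n \<in> L. dot (a n) x = 0} = {n \<in> L. p \<in> n}" using mem[OF _ pp] p(2) by auto
      also have "\<dots> = {l, m}"
      proof
        show "{n \<in> L. p \<in> n} \<subseteq> {l, m}" using conc[OF lm(1,2) _ lm(3)] lm(4,5) by auto
      qed (use lm in auto)
      finally show ?thesis using lm(1-3) by (intro bexI conjI)
    qed
    show "card {x \<in> rep ` S. dot (a l) x = 0} = t" if l: "l \<in> L" for l
    proof -
      have "{x \<in> rep ` S. dot (a l) x = 0} = rep ` {p \<in> S. p \<in> l}"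
        using mem[OF l] S(1) by auto
      moreover have "inj_on rep {p \<in> S. p \<in> l}"
        using inj_on_rep[OF S(1)] by (rule inj_on_subset) auto
      ultimately show ?thesis using card_points_on_line[OF star l] by (simp only: card_image)
    qed
  qed
  have "card (rep ` S) = (t + 1) choose 2" using card_image[OF inj_on_rep[OF S(1)]] S(2) by simp
  moreover have "cross (rep P) x \<noteq> 0" if "x \<in> rep ` S" for x
    using that P S(1) cross_rep_neq_0[OF P(1)] by auto
  moreover have "dot (a l0) (rep P) = 0" using mem[OF l0(1) P(1)] l0(2) by simp
  moreover have "rep P \<noteq> 0" using rep(1)[OF P(1)] .
  ultimately have "((d + 2) choose 2) - mpoly3.dim (double_system (rep ` S) (rep P) d) = star_hilbert t d"
    using l0(1) t by (intro star_hilbert_function) auto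
  then show ?thesis using hilbert_function_double_points[OF S(1) P(1)] by simp
qed

text \<open>
  In degree \<open>t + 1\<close> the ideal has dimension one; a generator \<open>F\<close> accounts for the whole ideal in
  all degrees below \<open>2 * t\<close>, as the dimensions agree.
\<close>

lemma curve_system_if_hilbert_function:
  fixes X :: "('k::field_char_0 ^ 3) set"
  assumes t: "t \<ge> 2" and X: "finite X" "card X = (t + 1) choose 2" "distinct_points X" and P: "P \<noteq> 0"
    and H: "\<And>d. ((d + 2) choose 2) - mpoly3.dim (double_system X P d) = star_hilbert t d"
  shows "\<exists>F. curve_system t X P F"
proof -
  have dim: "mpoly3.dim (double_system X P d) = (d + 1 - t) choose 2" if "d < 2 * t" for d
  proof -
    have "mpoly3.dim (double_system X P d) \<le> (d + 2) choose 2"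
      using dim_subset_forms(1)[OF double_system_subset subset_refl subspace_double_system subspace_forms]
      unfolding dim_forms .
    moreover have "(d + 1 - t) choose 2 \<le> (d + 2) choose 2" by (rule binomial_right_mono) simp
    ultimately show ?thesis using H[of d] that unfolding star_hilbert_def by auto
  qed
  have "mpoly3.dim (double_system X P (t + 1)) > 0"
    using dim[of "t + 1"] t by (simp add: numeral_2_eq_2)
  then obtain F where F: "F \<in> double_system X P (t + 1)" "F \<noteq> 0" using nonzero_if_dim_pos by blast
  then have Ff: "F \<in> forms (t + 1)" and Fs: "\<And>x. x \<in> X \<Longrightarrow> singular_at F x" "eval_at F P = 0"
    by (auto simp: double_system_def)
  have "multiples F (t + 1) d = double_system X P d" if "d < 2 * t" for d
  proof (rule dim_subset_forms(2)[OF _ double_system_subset subspace_multiples subspace_double_system])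
    show "multiples F (t + 1) d \<subseteq> double_system X P d"
      using multiples_subset_forms[OF Ff, of d] Fs unfolding double_system_def
      by (auto simp: multiples_def split: if_splits intro: singular_at_mult)
    show "mpoly3.dim (double_system X P d) \<le> mpoly3.dim (multiples F (t + 1) d)"
      unfolding dim[OF that] dim_multiples[OF F(2)] by (rule binomial_right_mono) simp
  qed
  then have "curve_system t X P F" using t X P Ff F(2) by unfold_locales auto
  then show ?thesis ..
qed

text \<open>
  If all double points are singular points of a product of \<open>t + 1\<close> different lines, then each of
  them lies on two of the lines. As there are as many points as pairs of lines, every pair
  of lines meets in one of the points, and different pairs meet in different points.
\<close>

lemma star_if_product_of_lines:
  fixes S :: "('k::field_char_0 ^ 3) set set"
  assumes S: "S \<subseteq> proj_plane" "card S = (t + 1) choose 2" "finite S"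
    and F: "F = (\<Prod>i<t + 1. lin (a i))" "F \<noteq> 0" "\<And>p. p \<in> S \<Longrightarrow> singular_at F (rep p)"
    and lines: "\<And>i j. i < t + 1 \<Longrightarrow> j < t + 1 \<Longrightarrow> i \<noteq> j \<Longrightarrow> cross (a i) (a j) \<noteq> 0"
  shows "is_star_configuration (t + 1) ((\<lambda>i. line (a i)) ` {..<t + 1}) S"
proof -
  let ?I = "{..<t + 1}" and ?line = "\<lambda>i. line (a i)"
  have a0: "a i \<noteq> 0" if "i \<in> ?I" for i
  proof
    assume "a i = 0"
    then have "F = 0" unfolding F(1) using that by (intro prod_zero) (auto intro!: bexI[of _ i])
    with F(2) show False by contradiction
  qed
  have inj: "inj_on ?line ?I"
  proof (rule inj_onI, rule ccontr)
    fix i j assume "i \<in> ?I" "j \<in> ?I" "line (a i) = line (a j)" "i \<noteq> j"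
    then show False using line_neq_if_cross_neq_0[OF lines[of i j]] by simp
  qed
  have two: "\<exists>A. A \<subseteq> ?I \<and> card A = 2 \<and> (\<forall>i\<in>A. p \<in> ?line i)" if p: "p \<in> S" for p
  proof -
    have pp: "p \<in> proj_plane" using p S(1) by auto
    have "eval_at F (rep p) = 0" using F(3)[OF p] by (simp add: singular_at_def)
    then have "\<exists>i\<in>?I. dot (a i) (rep p) = 0" unfolding F(1) eval_hom2 eval_lin by (subst (asm) prod_zero_iff) auto
    then obtain i where i: "i \<in> ?I" "dot (a i) (rep p) = 0" ..
    have "F = lin (a i) * (\<Prod>i\<in>?I - {i}. lin (a i))"
      unfolding F(1) using i by (intro prod.remove) auto
    then have "singular_at (lin (a i) * (\<Prod>i\<in>?I - {i}. lin (a i))) (rep p)"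
      using F(3)[OF p] by simp
    then have "eval_at (\<Prod>i\<in>?I - {i}. lin (a i)) (rep p) = 0"
      by (rule singular_cofactor_vanishes[OF _ i(2) a0[OF i(1)]])
    then have "\<exists>j\<in>?I - {i}. dot (a j) (rep p) = 0"
      unfolding eval_hom2 eval_lin by (subst (asm) prod_zero_iff) auto
    then obtain j where j: "j \<in> ?I - {i}" "dot (a j) (rep p) = 0" ..
    then have "card {i, j} = 2" by auto
    moreover have "\<forall>k\<in>{i, j}. p \<in> ?line k" using i j mem_line_rep[OF pp] by auto
    ultimately show ?thesis using i j by (intro exI[of _ "{i, j}"]) auto
  qed
  then have "\<forall>p\<in>S. \<exists>A. A \<subseteq> ?I \<and> card A = 2 \<and> (\<forall>i\<in>A. p \<in> ?line i)" by blast
  from bchoice[OF this] obtain A where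
    A: "\<And>p. p \<in> S \<Longrightarrow> A p \<subseteq> ?I \<and> card (A p) = 2 \<and> (\<forall>i\<in>A p. p \<in> ?line i)" by blast
  have once: "p = q" if "i \<in> ?I" "j \<in> ?I" "i \<noteq> j" "p \<in> ?line i" "p \<in> ?line j" "q \<in> ?line i" "q \<in> ?line j" for i j p q
    using lines_meet_once[of "a i" "a j"] lines[of i j] that by simp
  have "inj_on A S"
  proof (rule inj_onI)
    fix p q assume pq: "p \<in> S" "q \<in> S" "A p = A q"
    obtain i j where ij: "A p = {i, j}" "i \<noteq> j" using A[OF pq(1)] card_2_iff by metis
    show "p = q" using A[OF pq(1)] A[OF pq(2)] pq(3) ij by (intro once[of i j]) auto
  qed
  then have "card (A ` S) = card {B. B \<subseteq> ?I \<and> card B = 2}"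
    using card_image S(2) n_subsets[of ?I 2] by fastforce
  moreover have "finite {B. B \<subseteq> ?I \<and> card B = 2}" by simp
  moreover have "A ` S \<subseteq> {B. B \<subseteq> ?I \<and> card B = 2}" using A by auto
  ultimately have surj: "A ` S = {B. B \<subseteq> ?I \<and> card B = 2}" by (intro card_subset_eq)
  have pair: "\<exists>p\<in>S. A p = {i, j} \<and> p = q"
    if ij: "i \<in> ?I" "j \<in> ?I" "i \<noteq> j" "q \<in> ?line i" "q \<in> ?line j" for i j q
  proof -
    have "{i, j} \<in> A ` S" unfolding surj using ij by auto
    then obtain p where p: "p \<in> S" "A p = {i, j}" by auto
    then have "p \<in> ?line i" "p \<in> ?line j" using A[OF p(1)] by auto
    then have "p = q" using once ij by blast
    then show ?thesis using p by blast
  qed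
  show ?thesis
    unfolding is_star_configuration_def
  proof (intro conjI)
    show "finite (?line ` ?I)" by simp
    show "card (?line ` ?I) = t + 1" using card_image[OF inj] by simp
    show "\<forall>l\<in>?line ` ?I. is_line l" using a0 is_line_iff by blast
    show "no_three_concurrent (?line ` ?I)"
      unfolding no_three_concurrent_def
    proof (intro ballI impI, elim imageE conjE, rule ccontr)
      fix l m n i j k
      assume l: "l = ?line i" "i \<in> ?I" and m: "m = ?line j" "j \<in> ?I" and n: "n = ?line k" "k \<in> ?I"
        and ne: "l \<noteq> m" "l \<noteq> n" "m \<noteq> n" and "l \<inter> m \<inter> n \<noteq> {}"
      then obtain q where q: "q \<in> ?line i" "q \<in> ?line j" "q \<in> ?line k" by auto
      have ijk: "i \<noteq> j" "i \<noteq> k" "j \<noteq> k" using l m n ne by auto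
      obtain p where "A p = {i, j}" "p = q" using pair[OF l(2) m(2) ijk(1) q(1,2)] by blast
      moreover obtain p' where "A p' = {i, k}" "p' = q" using pair[OF l(2) n(2) ijk(2) q(1,3)] by blast
      ultimately show False using ijk by (auto simp: doubleton_eq_iff)
    qed
    show "S = {p. \<exists>l\<in>?line ` ?I. \<exists>m\<in>?line ` ?I. l \<noteq> m \<and> p \<in> l \<inter> m}"
    proof (intro equalityI subsetI CollectI)
      fix p assume p: "p \<in> S"
      obtain i j where ij: "A p = {i, j}" "i \<noteq> j" using A[OF p] card_2_iff by metis
      then have "i \<in> ?I" "j \<in> ?I" "p \<in> ?line i" "p \<in> ?line j" using A[OF p] by auto
      moreover from this have "?line i \<noteq> ?line j" using inj ij(2) by (auto dest: inj_onD)
      ultimately show "\<exists>l\<in>?line ` ?I. \<exists>m\<in>?line ` ?I. l \<noteq> m \<and> p \<in> l \<inter> m" by blast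
    next
      fix q assume "q \<in> {p. \<exists>l\<in>?line ` ?I. \<exists>m\<in>?line ` ?I. l \<noteq> m \<and> p \<in> l \<inter> m}"
      then obtain i j where ij: "i \<in> ?I" "j \<in> ?I" "?line i \<noteq> ?line j" "q \<in> ?line i" "q \<in> ?line j" by blast
      then have "i \<noteq> j" by auto
      from pair[OF ij(1,2) this ij(4,5)] show "q \<in> S" by blast
    qed
  qed
qed

lemma hilbert_function_imp_star:
  fixes S :: "('k::field_char_0 ^ 3) set set"
  assumes t3: "t \<ge> 3" and S: "S \<subseteq> proj_plane" "card S = (t + 1) choose 2"
    and PS: "P \<in> proj_plane" "P \<notin> S"
    and H: "\<And>d. hilbert_function (double_points_ideal S \<inter> point_ideal P) d = star_hilbert t d"
  shows "\<exists>L. is_star_configuration (t + 1) L S \<and> (\<exists>l\<in>L. P \<in> l)"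
proof -
  let ?X = "rep ` S"
  have "card S > 0" using S(2) t3 by (simp add: zero_less_binomial)
  then have fin: "finite S" using card_gt_0_iff by blast
  have cX: "card ?X = (t + 1) choose 2" using card_image[OF inj_on_rep[OF S(1)]] S(2) by simp
  have P0: "rep P \<noteq> 0" using rep(1)[OF PS(1)] .
  have cP: "cross (rep P) x \<noteq> 0" if "x \<in> ?X" for x
    using that PS S(1) cross_rep_neq_0[OF PS(1)] by auto
  have "\<exists>F. curve_system t ?X (rep P) F"
  proof (rule curve_system_if_hilbert_function[OF _ _ cX distinct_points_rep[OF S(1)] P0])
    show "((d + 2) choose 2) - mpoly3.dim (double_system ?X (rep P) d) = star_hilbert t d" for d
      using H[of d] hilbert_function_double_points[OF S(1) PS(1)] by simp
  qed (use t3 fin in auto)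
  then obtain F where "curve_system t ?X (rep P) F" ..
  then interpret curve_system t ?X "rep P" F .
  have "\<exists>a. F = (\<Prod>i<t + 1. lin (a i))"
    by (rule product_of_lines[OF finite_X cX distinct_X F F_singular F_P P0 cP])
      (use no_curve_of_smaller_degree[OF t3] no_double_line[OF t3] in auto)
  then obtain a where a: "F = (\<Prod>i<t + 1. lin (a i))" ..
  have lines: "cross (a i) (a j) \<noteq> 0" if ij: "i < t + 1" "j < t + 1" "i \<noteq> j" for i j
  proof
    assume c: "cross (a i) (a j) = 0"
    let ?G = "\<Prod>k\<in>{..<t + 1} - {i} - {j}. lin (a k)"
    have Fij: "F = lin (a i) * (lin (a j) * ?G)"
    proof -
      have "F = lin (a i) * (\<Prod>k\<in>{..<t + 1} - {i}. lin (a k))"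
        unfolding a using ij by (intro prod.remove) auto
      moreover have "(\<Prod>k\<in>{..<t + 1} - {i}. lin (a k)) = lin (a j) * ?G"
        using ij by (intro prod.remove) auto
      ultimately show ?thesis by (simp only:)
    qed
    then have "a i \<noteq> 0" using F(2) by auto
    from cross_eq_0_imp_scale[OF c this] obtain s where "a j = s *s a i" ..
    then have "F = lin (a i) * (lin (a i) * (mconst s * ?G))" using Fij by (simp add: lin_scale mult_ac)
    moreover have "card ({..<t + 1} - {i} - {j}) = t - 1" using ij by simp
    then have "?G \<in> forms (t - 1)"
      using prod_lin_forms[of "{..<t + 1} - {i} - {j}" a] by simp
    then have "mconst s * ?G \<in> forms (t - 1)" by (rule forms_mconst_mult)
    ultimately show False using no_double_line[OF t3] by blast
  qed
  have "is_star_configuration (t + 1) ((\<lambda>i. line (a i)) ` {..<t + 1}) S"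
    by (rule star_if_product_of_lines[OF S fin a F(2) _ lines]) (simp_all add: F_singular)
  moreover have "\<exists>l\<in>(\<lambda>i. line (a i)) ` {..<t + 1}. P \<in> l"
  proof -
    have "\<exists>i\<in>{..<t + 1}. dot (a i) (rep P) = 0"
      using F_P unfolding a eval_hom2 eval_lin by (subst (asm) prod_zero_iff) auto
    then show ?thesis using mem_line_rep[OF PS(1)] by auto
  qed
  ultimately show ?thesis by blast
qed

theorem theorem4p6:
  fixes t :: nat
    and S :: "('k::{alg_closed_field, field_char_0} ^ 3) set set"
    and P :: "('k ^ 3) set"
  assumes "t \<ge> 3"
    and "S \<subseteq> proj_plane" and "card S = (t + 1) choose 2"
    and "P \<in> proj_plane" and "P \<notin> S"
  shows "is_first_difference
           ([1..int t] @ replicate t (int t + 1) @ [1])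
           (hilbert_function (double_points_ideal S \<inter> point_ideal P)) \<longleftrightarrow>
         (\<exists>L. is_star_configuration (t + 1) L S \<and> (\<exists>l\<in>L. P \<in> l))"
proof -
  have t: "t \<ge> 1" using assms(1) by simp
  show ?thesis
    unfolding is_first_difference_star_hilbert[OF t]
    using star_imp_hilbert_function[OF t assms(2-5)] hilbert_function_imp_star[OF assms] by blast
qed

end
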